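(* Let $\varepsilon > 0$ be constant, let $-1 + \varepsilon \le \theta = \theta(n) \le 1/2 - \varepsilon$, and suppose that $p = p(n) \in (\varepsilon,1-\varepsilon)$ and $r = r(n) \sim 2\log_{1/p}(n)$ are chosen so that $\mu_r = \Theta(n^{1+\theta})$. Then there exists a set $\mathcal{G}$ of $r$-uniform hypergraphs (on the vertex set of $K_n$) with $\mathbb{P}\big( H_r(G(n,p)) \in \mathcal{G} \big) \to 1$ as $n \to \infty$, such that $$\mathbb{P}\big( H_r(G(n,p)) = H \big) = \pi^{e(H)} (1-\pi)^{\binom{n}{r} - e(H)} \, p^{-t(H)} \, e^{-\Lambda'(n,r) + O^*(n^\theta) + n^{-\Omega(1)}}$$ for every $H \in \mathcal{G}$.
   Context: $G(n,p)$ is the binomial random graph on $n$ labelled vertices. For a graph $G$, $H_r(G)$ is the $r$-uniform hypergraph on $V(G)$ whose hyperedges are the $r$-sets $S$ with $G[S]\cong K_r$. Set $\mu_r = \binom{n}{r} p^{\binom{r}{2}}$, $\pi = p^{\binom{r}{2}}$, and $$\Lambda'(n,r) = \frac{1}{2} \binom{n}{r}\binom{r}{2}\binom{n-r}{r-2} p^{2\binom{r}{2}} \big( p^{-1} - 1 \big).$$ For an $r$-uniform hypergraph $H$, $e(H)$ is its number of hyperedges, $G(H)$ is the graph whose edges are all pairs of vertices contained in some hyperedge of $H$, and $t(H) = \binom{r}{2} e(H) - e(G(H))$. Only those $n$ (an infinite set) for which suitable $p,r$ exist are considered, and $n\to\infty$ through this set. $f=O^*(g)$ means that there is a constant $C$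 with $f(n)=O(g(n)(\log n)^C)$. In the exponent, $n^{-\Omega(1)}$ stands for an error term of absolute value at most $n^{-c}$ for some constant $c>0$ (for large $n$). Error terms are uniform over $H\in\mathcal{G}$. *)

theory Defs
  imports "HOL-Probability.Probability" "HOL-Probability.Product_PMF"
    "HOL-Library.Landau_Symbols" "HOL-Library.Ramsey"
begin

text \<open>
  A (hyper)graph is a pair of a vertex set and a set of (hyper)edges; simple graphs are the
  2-uniform ones. The constant \<^const>\<open>nsets\<close> gives the \<open>r\<close>-element subsets of a set.
\<close>

type_synonym 'a hypergraph = "'a set \<times> 'a set set"

abbreviation verts :: "'a hypergraph \<Rightarrow> 'a set" where "verts \<equiv> fst"
abbreviation edges :: "'a hypergraph \<Rightarrow> 'a set set" where "edges \<equiv> snd"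

definition num_edges :: "'a hypergraph \<Rightarrow> nat" where
  "num_edges H = card (edges H)"

definition uniform_hypergraphs :: "'a set \<Rightarrow> nat \<Rightarrow> 'a hypergraph set" where
  "uniform_hypergraphs V r = {H. verts H = V \<and> edges H \<subseteq> nsets V r}"

definition complete_graph :: "'a set \<Rightarrow> 'a hypergraph" where
  "complete_graph V = (V, nsets V 2)"

definition induced :: "'a hypergraph \<Rightarrow> 'a set \<Rightarrow> 'a hypergraph" where
  "induced G S = (S, {e \<in> edges G. e \<subseteq> S})"

definition isomorphic :: "'a hypergraph \<Rightarrow> 'b hypergraph \<Rightarrow> bool" where
  "isomorphic G G' \<longleftrightarrow> (\<exists>f. bij_betw f (verts G) (verts G') \<and> edges G' = (`) f ` edges G)"

definition clique_hypergraph :: "nat \<Rightarrow> 'a hypergraph \<Rightarrow> 'a hypergraph" where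
  "clique_hypergraph r G =
     (verts G, {S \<in> nsets (verts G) r. isomorphic (induced G S) (complete_graph {..<r})})"

text \<open>In the usual notation, \<open>clique_hypergraph r G\<close> is \<open>H\<^sub>r(G)\<close>, \<open>shadow_graph H\<close> is \<open>G(H)\<close> and \<open>overlap r H\<close> is \<open>t(H)\<close>.\<close>

definition shadow_graph :: "'a hypergraph \<Rightarrow> 'a hypergraph" where
  "shadow_graph H = (verts H, {e \<in> nsets (verts H) 2. \<exists>h \<in> edges H. e \<subseteq> h})"

definition overlap :: "nat \<Rightarrow> 'a hypergraph \<Rightarrow> int" where
  "overlap r H = int (r choose 2) * int (num_edges H) - int (num_edges (shadow_graph H))"

definition gnp :: "nat \<Rightarrow> real \<Rightarrow> nat hypergraph pmf" where
  "gnp n p =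
     map_pmf (\<lambda>b. ({..<n}, {e \<in> nsets {..<n} 2. b e}))
       (Pi_pmf (nsets {..<n} 2) False (\<lambda>_. bernoulli_pmf p))"

text \<open>\<open>clique_prob\<close> and \<open>clique_mean\<close> are the quantities written \<open>\<pi>\<close> and \<open>\<mu>\<^sub>r\<close>. The truncated
  subtractions in \<open>Lambda'\<close> are harmless when \<open>2 \<le> r \<le> n\<close>.\<close>

definition clique_prob :: "real \<Rightarrow> nat \<Rightarrow> real" where
  "clique_prob p r = p ^ (r choose 2)"

definition clique_mean :: "nat \<Rightarrow> real \<Rightarrow> nat \<Rightarrow> real" where
  "clique_mean n p r = real (n choose r) * p ^ (r choose 2)"

definition Lambda' :: "nat \<Rightarrow> real \<Rightarrow> nat \<Rightarrow> real" where
  "Lambda' n p r =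
     1 / 2 * real (n choose r) * real (r choose 2) * real ((n - r) choose (r - 2))
       * p ^ (2 * (r choose 2)) * (inverse p - 1)"

definition bigo_star :: "nat filter \<Rightarrow> (nat \<Rightarrow> real) \<Rightarrow> (nat \<Rightarrow> real) set" where
  "bigo_star F g = {f. \<exists>C::real. f \<in> O[F](\<lambda>n. g n * ln (real n) powr C)}"

abbreviation at_top_through :: "nat set \<Rightarrow> nat filter" where
  "at_top_through N \<equiv> inf at_top (principal N)"

end

theory Submission
  imports Defs "HOL-Real_Asymp.Real_Asymp"
begin

text \<open>
  Let \<open>F\<close> be the set of hyperedges and \<open>U F\<close> the union of their edge sets. Then the probability of \<open>F\<close> is
  \<open>p ^ card (U F)\<close>, which is \<open>\<pi>\<close> to the number of hyperedges times \<open>p\<close> to the power \<open>- t(H)\<close>, times the probability that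
  no other \<open>r\<close>-set becomes a clique once \<open>U F\<close> is present. The latter is
  \<open>exp (- S1 + S2)\<close> up to small errors, where \<open>S1\<close> is the conditional mean and \<open>S2\<close> sums the covariances
  of pairs of \<open>r\<close>-sets with exactly one common edge: a second-order version of Janson's inequality shows
  this for the \<open>r\<close>-sets with at most one edge in \<open>U F\<close>. Since a typical \<open>F\<close> has about \<open>\<mu>\<close>
  hyperedges, \<open>S1\<close> is about \<open>\<mu> + 2 \<Lambda>'\<close> and \<open>S2\<close> about \<open>\<Lambda>'\<close>.

  The remaining \<open>r\<close>-sets, with several edges in \<open>U F\<close>, are harmless as soon as \<open>F\<close> is close to an edge-disjoint family. So
  \<open>F\<close> is replaced by its core, which omits the hyperedges sharing two or more edges with the others. For the
  upper bound this is monotonicity; for the lower bound it costs only the number of ways to recover \<open>F\<close>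
  from its core, because hypergraphs that are much less likely than their cores are together unlikely, and
  only about \<open>n\<close> to the power \<open>\<theta>\<close> hyperedges, up to logarithms, are omitted.
\<close>

section \<open>Random subsets of a finite set\<close>

text \<open>For positive \<theta> the quantity \<Lambda>' is about n to the power 2 \<theta>, beyond
  the permitted error, while a first-order Janson bound has an error of the order of \<Lambda>'
  itself; this forces the second order. The term - \<mu> in the exponent is matched by the power of
  1 - \<pi> in the theorem, and what remains is - 2 \<Lambda>' + \<Lambda>'. The r-sets with several
  edges in \<open>U F\<close> escape Janson's method because each such edge amplifies their
  conditional probability by 1/p. They are controlled on average over \<open>F\<close>, by expanding
  the amplification over subfamilies of \<open>F\<close>; this needs subfamilies to be present
  almost independently, hence the core. The bound \<theta> \<le> 1/2 - \<epsilon> enters twice. Let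
  x be n to the power \<theta>. As x^2 \<le> n, only about \<mu> / n, that is x, hyperedges fall
  outside the core, up to logarithms. As x^4 is smaller than n^2 by a power of n, typically no other
  r-set has all its edges in the core; such a set would make it impossible for the core to be a
  clique hypergraph. Logarithms are collected in D = (ln n)^20.\<close>

definition expec :: "real \<Rightarrow> 'a set \<Rightarrow> ('a set \<Rightarrow> real) \<Rightarrow> real" where
  "expec p E g = (\<Sum>w\<in>Pow E. p ^ card w * (1 - p) ^ card (E - w) * g w)"

text \<open>Expectations and probabilities are finite sums over \<open>Pow E\<close>, so no
  measurability questions arise; \<open>gnp_prob\<close> identifies them with the product measure at
  the end.\<close>

definition pr :: "real \<Rightarrow> 'a set \<Rightarrow> ('a set \<Rightarrow> bool) \<Rightarrow> real" where
  "pr p E P = expec p E (\<lambda>w. of_bool (P w))"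

lemma expec_empty [simp]: "expec p {} g = g {}"
  by (simp add: expec_def)

text \<open>Conditioning on the presence of one element. The inductions over the ground set run on
  this recursion.\<close>

lemma expec_insert:
  assumes "finite E" "e \<notin> E"
  shows "expec p (insert e E) g
    = p * expec p E (\<lambda>w. g (insert e w)) + (1 - p) * expec p E g"
proof -
  have inj: "inj_on (insert e) (Pow E)"
    using assms by (auto simp: inj_on_def)
  have disj: "Pow E \<inter> insert e ` Pow E = {}"
    using assms by auto
  have 1: "(\<Sum>w\<in>Pow E. p ^ card w * (1 - p) ^ card (insert e E - w) * g w) = (1 - p) * expec p E g"
    unfolding expec_def sum_distrib_left
  proof (rule sum.cong)
    fix w assume "w \<in> Pow E"
    hence "insert e E - w = insert e (E - w)" "finite (E - w)" "e \<notin> E - w"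
      using assms by auto
    thus "p ^ card w * (1 - p) ^ card (insert e E - w) * g w =
      (1 - p) * (p ^ card w * (1 - p) ^ card (E - w) * g w)" by simp
  qed simp
  have 2: "(\<Sum>w\<in>Pow E. p ^ card (insert e w) * (1 - p) ^ card (insert e E - insert e w) * g (insert e w))
    = p * expec p E (\<lambda>w. g (insert e w))"
    unfolding expec_def sum_distrib_left
  proof (rule sum.cong)
    fix w assume "w \<in> Pow E"
    hence "insert e E - insert e w = E - w" "finite w" "e \<notin> w"
      using assms finite_subset by auto
    thus "p ^ card (insert e w) * (1 - p) ^ card (insert e E - insert e w) * g (insert e w) =
      p * (p ^ card w * (1 - p) ^ card (E - w) * g (insert e w))" by simp
  qed simp
  show ?thesis
    using 1 2 assms disj
    by (simp add: expec_def[of p "insert e E"] Pow_insert sum.union_disjoint sum.reindex[OF inj])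
qed

lemma expec_cmult: "expec p E (\<lambda>w. c * g w) = c * expec p E g"
  by (simp add: expec_def sum_distrib_left algebra_simps)

lemma expec_add: "expec p E (\<lambda>w. f w + g w) = expec p E f + expec p E g"
  by (simp add: expec_def sum.distrib algebra_simps)

lemma expec_diff: "expec p E (\<lambda>w. f w - g w) = expec p E f - expec p E g"
  by (simp add: expec_def sum_subtractf algebra_simps)

lemma expec_sum: "expec p E (\<lambda>w. \<Sum>i\<in>A. g i w) = (\<Sum>i\<in>A. expec p E (g i))"
  unfolding expec_def by (subst sum.swap) (simp add: sum_distrib_left)

lemma expec_cong: "(\<And>w. w \<subseteq> E \<Longrightarrow> f w = g w) \<Longrightarrow> expec p E f = expec p E g"
  unfolding expec_def by (auto intro!: sum.cong)

lemma expec_mono: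
  "0 \<le> p \<Longrightarrow> p \<le> 1 \<Longrightarrow> (\<And>w. w \<subseteq> E \<Longrightarrow> f w \<le> g w) \<Longrightarrow> expec p E f \<le> expec p E g"
  unfolding expec_def by (auto intro!: sum_mono mult_left_mono)

lemma expec_const:
  assumes "finite E" shows "expec p E (\<lambda>w. c) = c"
  using assms
proof (induction E rule: finite_induct)
  case (insert e E)
  thus ?case by (simp add: expec_insert algebra_simps)
qed simp

text \<open>The elements of \<open>M\<close> are independent of all others, so conditioning on
  \<open>M \<subseteq> w\<close> amounts to adding \<open>M\<close> to an unconditioned random
  set.\<close>

lemma expec_superset:
  assumes E: "finite E" and "M \<subseteq> E"
  shows "expec p E (\<lambda>w. of_bool (M \<subseteq> w) * g w) = p ^ card M * expec p E (\<lambda>w. g (w \<union> M))"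
proof -
  have "finite M" using assms finite_subset by auto
  thus ?thesis using \<open>M \<subseteq> E\<close>
  proof (induction M arbitrary: g rule: finite_induct)
    case (insert e M)
    have one: "expec p E (\<lambda>w. of_bool (e \<in> w) * h w) = p * expec p E (\<lambda>w. h (insert e w))"
      for h
    proof -
      define E' where "E' = E - {e}"
      have E': "E = insert e E'" "finite E'" "e \<notin> E'"
        using insert.prems E by (auto simp: E'_def)
      have 0: "expec p E' (\<lambda>w. of_bool (e \<in> w) * h w) = 0"
        unfolding expec_def using E'(3) by (intro sum.neutral) auto
      show ?thesis
        unfolding E'(1) using E'(2,3) 0 by (simp add: expec_insert algebra_simps)
    qed
    have "expec p E (\<lambda>w. of_bool (insert e M \<subseteq> w) * g w)
      = expec p E (\<lambda>w. of_bool (M \<subseteq> w) * (of_bool (e \<in> w) * g w))"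
      by (intro expec_cong) auto
    also have "\<dots> = p ^ card M * expec p E (\<lambda>w. of_bool (e \<in> w \<union> M) * g (w \<union> M))"
      using insert by auto
    also have "\<dots> = p ^ card M * expec p E (\<lambda>w. of_bool (e \<in> w) * g (w \<union> M))"
      using insert.hyps by (intro arg_cong2[where f = "(*)"] expec_cong) auto
    also have "\<dots> = p ^ card (insert e M) * expec p E (\<lambda>w. g (w \<union> insert e M))"
      using insert.hyps by (simp add: one)
    finally show ?case .
  qed simp
qed

text \<open>Induction on the ground set. Given the state of \<open>e\<close> the inductive
  hypothesis applies; the two conditional means of each function are ordered, and Chebyshev's
  inequality for a two-point distribution combines them.\<close>

lemma harris:
  assumes "finite E" "0 \<le> p" "p \<le> 1"
    and "\<And>a b. a \<subseteq> b \<Longrightarrow> f a \<le> f b" "\<And>a b. a \<subseteq> b \<Longrightarrow> g a \<le> g b"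
  shows "expec p E f * expec p E g \<le> expec p E (\<lambda>w. f w * g w)"
  using assms(1,4,5)
proof (induction E arbitrary: f g rule: finite_induct)
  case (insert e E)
  define a0 a1 b0 b1 where "a0 = expec p E f" "a1 = expec p E (\<lambda>w. f (insert e w))"
    "b0 = expec p E g" "b1 = expec p E (\<lambda>w. g (insert e w))"
  note defs = this
  have le: "a0 \<le> a1" "b0 \<le> b1"
    unfolding defs using assms(2,3) insert.prems[OF subset_insertI] by (auto intro!: expec_mono)
  have ih0: "a0 * b0 \<le> expec p E (\<lambda>w. f w * g w)"
    unfolding defs by (rule insert.IH) (use insert.prems in auto)
  have ih1: "a1 * b1 \<le> expec p E (\<lambda>w. f (insert e w) * g (insert e w))"
    unfolding defs
    by (rule insert.IH[of "\<lambda>w. f (insert e w)" "\<lambda>w. g (insert e w)"];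
        intro insert.prems; blast)
  have "0 \<le> p * (1 - p) * ((a1 - a0) * (b1 - b0))"
    using le assms(2,3) by (intro mult_nonneg_nonneg) auto
  hence "(p * a1 + (1 - p) * a0) * (p * b1 + (1 - p) * b0)
    \<le> p * (a1 * b1) + (1 - p) * (a0 * b0)"
    by (simp add: algebra_simps)
  also have "\<dots> \<le> p * expec p E (\<lambda>w. f (insert e w) * g (insert e w))
      + (1 - p) * expec p E (\<lambda>w. f w * g w)"
    using ih0 ih1 assms(2,3) by (intro add_mono mult_left_mono) auto
  finally show ?case
    using insert.hyps by (simp add: expec_insert defs)
qed simp

locale bernoulli_subset =
  fixes p :: real and E :: "'a set"
  assumes fin_E [simp, intro]: "finite E" and p_pos: "0 < p" and p_lt_1: "p < 1"
begin

abbreviation "ex \<equiv> expec p E"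
abbreviation "prb \<equiv> pr p E"

lemma p_bounds: "0 \<le> p" "p \<le> 1" using p_pos p_lt_1 by auto

lemma pr_mono: "(\<And>w. w \<subseteq> E \<Longrightarrow> P w \<Longrightarrow> Q w) \<Longrightarrow> prb P \<le> prb Q"
  unfolding pr_def using p_bounds by (intro expec_mono) auto

lemma pr_cong: "(\<And>w. w \<subseteq> E \<Longrightarrow> P w \<longleftrightarrow> Q w) \<Longrightarrow> prb P = prb Q"
  unfolding pr_def by (intro expec_cong) auto

lemma pr_nonneg: "0 \<le> prb P"
  unfolding pr_def expec_def using p_bounds by (auto intro!: sum_nonneg)

lemma pr_True [simp]: "prb (\<lambda>w. True) = 1"
  by (simp add: pr_def expec_const)

lemma pr_le_1: "prb P \<le> 1"
  using pr_mono[of P "\<lambda>w. True"] by simp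

lemma pr_pos:
  assumes "w \<subseteq> E" "P w" shows "0 < prb P"
  unfolding pr_def expec_def
  using assms p_pos p_lt_1 by (intro sum_pos2[of _ w]) auto

lemma pr_superset_conj:
  "M \<subseteq> E \<Longrightarrow> prb (\<lambda>w. M \<subseteq> w \<and> P w) = p ^ card M * prb (\<lambda>w. P (w \<union> M))"
  using expec_superset[of E M p "\<lambda>w. of_bool (P w)"]
  by (simp add: pr_def of_bool_conj)

lemma pr_superset: "M \<subseteq> E \<Longrightarrow> prb (\<lambda>w. M \<subseteq> w) = p ^ card M"
  using pr_superset_conj[of M "\<lambda>w. True"] by simp

lemma pr_Not: "prb (\<lambda>w. \<not> P w) = 1 - prb P"
proof -
  have "prb (\<lambda>w. \<not> P w) = ex (\<lambda>w. 1 - of_bool (P w))"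
    unfolding pr_def by (intro expec_cong) auto
  thus ?thesis by (simp add: expec_diff expec_const pr_def)
qed

lemma pr_conj_Not: "prb (\<lambda>w. P w \<and> \<not> Q w) = prb P - prb (\<lambda>w. P w \<and> Q w)"
proof -
  have "prb (\<lambda>w. P w \<and> \<not> Q w) = ex (\<lambda>w. of_bool (P w) - of_bool (P w \<and> Q w))"
    unfolding pr_def by (intro expec_cong) auto
  thus ?thesis by (simp add: expec_diff pr_def)
qed

lemma pr_disj_le: "prb (\<lambda>w. P w \<or> Q w) \<le> prb P + prb Q"
  unfolding pr_def expec_add[symmetric] using p_bounds by (intro expec_mono) auto

lemma markov:
  assumes "\<And>w. w \<subseteq> E \<Longrightarrow> 0 \<le> g w" "ex g \<le> b" "0 < c"
  shows "prb (\<lambda>w. c \<le> g w) \<le> b / c"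
proof -
  have "prb (\<lambda>w. c \<le> g w) \<le> ex (\<lambda>w. (1/c) * g w)"
    unfolding pr_def using p_bounds assms by (intro expec_mono) auto
  also have "\<dots> \<le> b / c"
    unfolding expec_cmult using assms by (simp add: divide_right_mono)
  finally show ?thesis .
qed

lemma harris_dec:
  assumes P: "\<And>a b. a \<subseteq> b \<Longrightarrow> P b \<Longrightarrow> P a" and Q: "\<And>a b. a \<subseteq> b \<Longrightarrow> Q b \<Longrightarrow> Q a"
  shows "prb P * prb Q \<le> prb (\<lambda>w. P w \<and> Q w)"
proof -
  \<comment> \<open>Negated indicators of decreasing events are increasing functions, and the two
    signs cancel in the product.\<close>
  have "ex (\<lambda>w. - of_bool (P w)) * ex (\<lambda>w. - of_bool (Q w))
    \<le> ex (\<lambda>w. (- of_bool (P w)) * (- of_bool (Q w)))"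
    using p_bounds P Q by (intro harris) auto
  moreover have "ex (\<lambda>w. - of_bool (P w)) = - prb P" for P
    using expec_cmult[of p E "-1"] by (simp add: pr_def)
  ultimately show ?thesis by (simp add: pr_def of_bool_conj)
qed

text \<open>Adding \<open>M\<close> to \<open>w\<close> can only destroy a decreasing property, so
  forcing \<open>M\<close> never helps \<open>Q\<close>.\<close>

lemma harris_superset:
  assumes M: "M \<subseteq> E" and Q: "\<And>a b. a \<subseteq> b \<Longrightarrow> Q b \<Longrightarrow> Q a"
  shows "prb (\<lambda>w. M \<subseteq> w \<and> Q w) \<le> p ^ card M * prb Q"
proof -
  have "prb (\<lambda>w. Q (w \<union> M)) \<le> prb Q"
    using Q by (intro pr_mono) blast
  thus ?thesis
    using p_bounds by (simp add: pr_superset_conj[OF M] mult_left_mono)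
qed

end

section \<open>A second-order Janson inequality\<close>

locale cylinder_events = bernoulli_subset p E for p :: real and E :: "'a set" +
  fixes I :: "'i set" and S :: "'i \<Rightarrow> 'a set"
  assumes fin_I [simp, intro]: "finite I" and S_sub: "\<And>i. i \<in> I \<Longrightarrow> S i \<subseteq> E"
begin

definition none :: "'i set \<Rightarrow> 'a set \<Rightarrow> bool" where
  "none F w \<longleftrightarrow> (\<forall>j\<in>F. \<not> S j \<subseteq> w)"

lemma none_dec: "a \<subseteq> b \<Longrightarrow> none F b \<Longrightarrow> none F a"
  by (auto simp: none_def)

lemma card_union_eq: "A \<subseteq> E \<Longrightarrow> B \<subseteq> E \<Longrightarrow> card (A \<union> B) = card A + card (B - A)"
  by (metis Diff_disjoint Un_Diff_cancel card_Un_disjoint fin_E finite_Diff finite_subset)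

text \<open>Union bound over \<open>D\<close> on top of \<open>A \<subseteq> w \<and> Q w\<close>.
  Harris' inequality then frees each term from \<open>Q\<close>, leaving the conditional probability
  of one event given \<open>A\<close>, times common factors.\<close>

lemma pr_union_bound:
  assumes A: "A \<subseteq> E" and D: "D \<subseteq> I" and Q: "\<And>a b. a \<subseteq> b \<Longrightarrow> Q b \<Longrightarrow> Q a"
  shows "prb (\<lambda>w. A \<subseteq> w \<and> Q w) - p ^ card A * prb Q * (\<Sum>j\<in>D. p ^ card (S j - A))
    \<le> prb (\<lambda>w. A \<subseteq> w \<and> Q w \<and> none D w)"
proof -
  have fin: "finite D" using D finite_subset by auto
  have "prb (\<lambda>w. A \<subseteq> w \<and> Q w) - (\<Sum>j\<in>D. prb (\<lambda>w. A \<union> S j \<subseteq> w \<and> Q w))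
    = ex (\<lambda>w. of_bool (A \<subseteq> w \<and> Q w) - (\<Sum>j\<in>D. of_bool (A \<union> S j \<subseteq> w \<and> Q w)))"
    by (simp add: pr_def expec_diff expec_sum)
  also have "\<dots> \<le> prb (\<lambda>w. A \<subseteq> w \<and> Q w \<and> none D w)"
    unfolding pr_def
  proof (rule expec_mono)
    fix w assume "w \<subseteq> E"
    show "of_bool (A \<subseteq> w \<and> Q w) - (\<Sum>j\<in>D. of_bool (A \<union> S j \<subseteq> w \<and> Q w))
        \<le> (of_bool (A \<subseteq> w \<and> Q w \<and> none D w) :: real)"
    proof (cases "A \<subseteq> w \<and> Q w \<and> \<not> none D w")
      case True
      then obtain j where j: "j \<in> D" "S j \<subseteq> w" by (auto simp: none_def)
      have "(1::real) \<le> (\<Sum>j\<in>D. of_bool (A \<union> S j \<subseteq> w \<and> Q w))"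
        using sum_mono2[of D "{j}" "\<lambda>j. of_bool (A \<union> S j \<subseteq> w \<and> Q w) :: real"] fin j True by simp
      thus ?thesis using True by simp
    next
      case False
      have "(0::real) \<le> (\<Sum>j\<in>D. of_bool (A \<union> S j \<subseteq> w \<and> Q w))" by (intro sum_nonneg) auto
      thus ?thesis using False by auto
    qed
  qed (use p_bounds in auto)
  finally have 1: "prb (\<lambda>w. A \<subseteq> w \<and> Q w) - (\<Sum>j\<in>D. prb (\<lambda>w. A \<union> S j \<subseteq> w \<and> Q w))
    \<le> prb (\<lambda>w. A \<subseteq> w \<and> Q w \<and> none D w)" .
  have "prb (\<lambda>w. A \<union> S j \<subseteq> w \<and> Q w) \<le> p ^ card A * prb Q * p ^ card (S j - A)" if "j \<in> D" for j
  proof -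
    have "S j \<subseteq> E" using D S_sub that by auto
    thus ?thesis
      using harris_superset[of "A \<union> S j" Q] A Q card_union_eq[of A "S j"]
      by (simp add: power_add algebra_simps)
  qed
  hence "(\<Sum>j\<in>D. prb (\<lambda>w. A \<union> S j \<subseteq> w \<and> Q w))
      \<le> (\<Sum>j\<in>D. p ^ card A * prb Q * p ^ card (S j - A))" by (rule sum_mono)
  thus ?thesis using 1 by (simp add: sum_distrib_left)
qed

lemma pr_disjoint_none:
  assumes "A \<subseteq> E" "\<And>j. j \<in> F \<Longrightarrow> S j \<inter> A = {}"
  shows "prb (\<lambda>w. A \<subseteq> w \<and> none F w) = p ^ card A * prb (none F)"
proof -
  have "prb (\<lambda>w. none F (w \<union> A)) = prb (none F)"
    using assms(2) by (intro pr_cong) (unfold none_def, blast)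
  thus ?thesis by (simp add: pr_superset_conj[OF assms(1)])
qed

text \<open>The basic step of Janson's inequality: events disjoint from \<open>A\<close> are
  independent of it and factor out, those meeting \<open>A\<close> go into a union bound.\<close>

lemma janson_step:
  assumes A: "A \<subseteq> E" and F: "F \<subseteq> I"
  shows "p ^ card A * prb (none {j\<in>F. S j \<inter> A = {}})
      * (1 - (\<Sum>j | j \<in> F \<and> S j \<inter> A \<noteq> {}. p ^ card (S j - A)))
    \<le> prb (\<lambda>w. A \<subseteq> w \<and> none F w)"
proof -
  define D0 D where "D0 = {j\<in>F. S j \<inter> A = {}}" and "D = {j\<in>F. S j \<inter> A \<noteq> {}}"
  have "(\<lambda>w. A \<subseteq> w \<and> none F w) = (\<lambda>w. A \<subseteq> w \<and> none D0 w \<and> none D w)"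
    by (auto simp: none_def D0_def D_def fun_eq_iff)
  moreover have "prb (\<lambda>w. A \<subseteq> w \<and> none D0 w) = p ^ card A * prb (none D0)"
    using A by (intro pr_disjoint_none) (auto simp: D0_def)
  ultimately show ?thesis
    using pr_union_bound[of A D "none D0"] A F none_dec[of _ _ D0]
    by (auto simp: D_def D0_def algebra_simps)
qed

lemma pr_none_mono: "G \<subseteq> F \<Longrightarrow> prb (none F) \<le> prb (none G)"
  by (intro pr_mono) (auto simp: none_def)

lemma janson_step':
  assumes A: "A \<subseteq> E" and F: "F \<subseteq> I"
    and \<delta>: "(\<Sum>j | j \<in> F \<and> S j \<inter> A \<noteq> {}. p ^ card (S j - A)) \<le> \<delta>" "\<delta> \<le> 1"
  shows "p ^ card A * prb (none F) * (1 - \<delta>) \<le> prb (\<lambda>w. A \<subseteq> w \<and> none F w)"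
proof -
  have "p ^ card A * prb (none F) * (1 - \<delta>) \<le> p ^ card A * prb (none {j\<in>F. S j \<inter> A = {}})
      * (1 - (\<Sum>j | j \<in> F \<and> S j \<inter> A \<noteq> {}. p ^ card (S j - A)))"
    using \<delta> p_bounds pr_nonneg by (intro mult_mono pr_none_mono) auto
  thus ?thesis using janson_step[OF A F] by linarith
qed

text \<open>Second Bonferroni inequality with \<open>A\<close> and \<open>Q\<close> as side
  conditions. The pair terms are relaxed by Harris' inequality; the single terms enter negatively
  and stay exact, to be bounded from below by \<open>janson_step_apart\<close>.\<close>

lemma pr_bonferroni:
  assumes A: "A \<subseteq> E" and D: "D \<subseteq> I" and Q: "\<And>a b. a \<subseteq> b \<Longrightarrow> Q b \<Longrightarrow> Q a"
  shows "prb (\<lambda>w. A \<subseteq> w \<and> Q w \<and> none D w) \<le> prb (\<lambda>w. A \<subseteq> w \<and> Q w)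
      - (\<Sum>j\<in>D. prb (\<lambda>w. A \<union> S j \<subseteq> w \<and> Q w))
      + (1/2) * (\<Sum>j\<in>D. \<Sum>k\<in>D-{j}. p ^ card (A \<union> S j \<union> S k)) * prb Q"
proof -
  have fin: "finite D" using D finite_subset by auto
  let ?X = "\<lambda>w j. of_bool (A \<union> S j \<subseteq> w \<and> Q w) :: real"
  have "prb (\<lambda>w. A \<subseteq> w \<and> Q w \<and> none D w)
    \<le> ex (\<lambda>w. of_bool (A \<subseteq> w \<and> Q w) - (\<Sum>j\<in>D. ?X w j) + (1/2) * (\<Sum>j\<in>D. \<Sum>k\<in>D-{j}. ?X w j * ?X w k))"
    unfolding pr_def
  proof (rule expec_mono)
    fix w assume "w \<subseteq> E"
    define T where "T = {j\<in>D. A \<union> S j \<subseteq> w \<and> Q w}"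
    define m where "m = card T"
    have T: "T \<subseteq> D" "finite T" using fin by (auto simp: T_def)
    have X: "?X w j = of_bool (j \<in> T)" if "j \<in> D" for j using that by (auto simp: T_def)
    have s1: "(\<Sum>j\<in>D. ?X w j) = m"
    proof -
      have "(\<Sum>j\<in>D. ?X w j) = (\<Sum>j\<in>D. of_bool (j \<in> T))" by (intro sum.cong X) auto
      also have "\<dots> = real (card (D \<inter> T))" using fin by (simp add: of_bool_def sum.If_cases Int_def)
      finally show ?thesis using T by (simp add: m_def Int_absorb1)
    qed
    have "(\<Sum>j\<in>D. \<Sum>k\<in>D-{j}. ?X w j * ?X w k) = (\<Sum>j\<in>D. ?X w j * (real m - ?X w j))"
    proof (rule sum.cong[OF refl])
      fix j assume "j \<in> D"
      hence "(\<Sum>k\<in>D-{j}. ?X w k) = real m - ?X w j"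
        unfolding s1[symmetric] using fin by (subst sum_diff1) auto
      thus "(\<Sum>k\<in>D-{j}. ?X w j * ?X w k) = ?X w j * (real m - ?X w j)"
        unfolding sum_distrib_left[symmetric] by (rule arg_cong)
    qed
    also have "\<dots> = (\<Sum>j\<in>D. ?X w j * (real m - 1))"
      by (intro sum.cong) auto
    also have "\<dots> = (\<Sum>j\<in>D. ?X w j) * (real m - 1)" by (rule sum_distrib_right[symmetric])
    also have "\<dots> = real m * (real m - 1)" unfolding s1 ..
    finally have s2: "(\<Sum>j\<in>D. \<Sum>k\<in>D-{j}. ?X w j * ?X w k) = real m * (real m - 1)" .
    \<comment> \<open>Twice this expression is (m - 1)(m - 2), which is never negative at an
      integer.\<close>
    have pos: "0 \<le> 1 - real m + (1/2) * (real m * (real m - 1))"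
    proof -
      have "0 \<le> (int m - 1) * (int m - 2)"
        by (cases "m \<le> 1") (auto simp: zero_le_mult_iff)
      hence "0 \<le> real_of_int ((int m - 1) * (int m - 2))" by (simp only: of_int_0_le_iff)
      thus ?thesis by (simp add: algebra_simps)
    qed
    show "of_bool (A \<subseteq> w \<and> Q w \<and> none D w)
        \<le> of_bool (A \<subseteq> w \<and> Q w) - (\<Sum>j\<in>D. ?X w j) + (1/2) * (\<Sum>j\<in>D. \<Sum>k\<in>D-{j}. ?X w j * ?X w k)"
    proof (cases "A \<subseteq> w \<and> Q w")
      case False
      hence "m = 0" by (auto simp: m_def T_def)
      thus ?thesis unfolding s1 s2 using False by auto
    next
      case True
      show ?thesis
      proof (cases "none D w")
        case none: True
        hence "T = {}" by (auto simp: T_def none_def)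
        hence "m = 0" by (simp add: m_def)
        thus ?thesis unfolding s1 s2 using True none by auto
      next
        case False
        thus ?thesis unfolding s1 s2 using True pos by simp
      qed
    qed
  qed (use p_bounds in auto)
  also have "\<dots> = prb (\<lambda>w. A \<subseteq> w \<and> Q w) - (\<Sum>j\<in>D. prb (\<lambda>w. A \<union> S j \<subseteq> w \<and> Q w))
      + (1/2) * (\<Sum>j\<in>D. \<Sum>k\<in>D-{j}. prb (\<lambda>w. (A \<union> S j \<union> S k) \<subseteq> w \<and> Q w))"
  proof -
    have "(\<lambda>w. ?X w j * ?X w k) = (\<lambda>w. of_bool ((A \<union> S j \<union> S k) \<subseteq> w \<and> Q w))" for j k
      by (auto simp: fun_eq_iff)
    thus ?thesis unfolding pr_def expec_add expec_diff expec_cmult expec_sum by simp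
  qed
  also have "\<dots> \<le> prb (\<lambda>w. A \<subseteq> w \<and> Q w) - (\<Sum>j\<in>D. prb (\<lambda>w. A \<union> S j \<subseteq> w \<and> Q w))
      + (1/2) * (\<Sum>j\<in>D. \<Sum>k\<in>D-{j}. p ^ card (A \<union> S j \<union> S k) * prb Q)"
  proof -
    have "prb (\<lambda>w. A \<union> S j \<union> S k \<subseteq> w \<and> Q w) \<le> p ^ card (A \<union> S j \<union> S k) * prb Q"
      if "j \<in> D" "k \<in> D" for j k
    proof (rule harris_superset[OF _ Q])
      show "A \<union> S j \<union> S k \<subseteq> E" using A D S_sub that by (intro Un_least) auto
    qed
    thus ?thesis by (intro add_left_mono mult_left_mono sum_mono) auto
  qed
  finally show ?thesis by (simp add: sum_distrib_right mult.assoc)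
qed

end

text \<open>The sums are conditional expected numbers of further events given event
  \<open>i\<close>: \<open>\<delta>\<close> bounds those sharing an element with it,
  \<open>\<beta>\<close> those sharing at least two. Events sharing exactly one element are treated
  exactly; \<open>\<beta>\<close> and the square of \<open>\<delta>\<close> are errors.\<close>

locale weakly_dependent_events = cylinder_events p E I S
  for p :: real and E :: "'a set" and I :: "'i set" and S :: "'i \<Rightarrow> 'a set" +
  fixes \<delta> \<beta> \<kappa> :: real
  assumes delta_sum: "\<And>i. i \<in> I \<Longrightarrow> (\<Sum>j | j \<in> I - {i} \<and> S j \<inter> S i \<noteq> {}. p ^ card (S j - S i)) \<le> \<delta>"
    and beta_sum: "\<And>i. i \<in> I \<Longrightarrow> (\<Sum>j | j \<in> I - {i} \<and> 2 \<le> card (S j \<inter> S i). p ^ card (S j - S i)) \<le> \<beta>"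
    and kappa: "\<And>i. i \<in> I \<Longrightarrow> p ^ card (S i) \<le> \<kappa>"
    and delta_half: "\<delta> \<le> 1 / 2" and kappa_half: "\<kappa> \<le> 1 / 2"
begin

lemma finite_S: "i \<in> I \<Longrightarrow> finite (S i)"
  using S_sub finite_subset by blast

definition once :: "'i set \<Rightarrow> 'i \<Rightarrow> 'i set" where
  "once F i = {j\<in>F. card (S j \<inter> S i) = 1}"

definition once_sum :: "'i set \<Rightarrow> 'i \<Rightarrow> real" where
  "once_sum F i = (\<Sum>j\<in>once F i. p ^ card (S j))"

text \<open>One shared element raises the conditional probability by the factor
  \<open>1 / p\<close>. This is the source of the covariance factor \<open>1 / p - 1\<close>
  below.\<close>

lemma power_Diff_once:
  assumes "j \<in> I" "card (S j \<inter> S i) = 1" shows "p ^ card (S j - S i) = p ^ card (S j) / p"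
proof -
  have "card (S j) = Suc (card (S j - S i))"
    using assms finite_S card_Int_Diff[of "S j" "S i"] by simp
  thus ?thesis using p_pos by simp
qed

lemma power_le_Diff: "j \<in> I \<Longrightarrow> p ^ card (S j) \<le> p ^ card (S j - A)"
  using p_bounds finite_S by (intro power_decreasing card_mono) auto

text \<open>The neighbours of \<open>i\<close> are split by the number of shared elements, and
  \<open>b\<close> is the conditional weight of those sharing two or more. It also bounds their
  unconditional weight, which the denominator in \<open>occurrence_upper\<close> needs.\<close>

lemma sum_bounds:
  assumes i: "i \<in> I" and F: "F \<subseteq> I - {i}"
  obtains b where "0 \<le> b" "b \<le> \<beta>" "once_sum F i / p + b \<le> \<delta>"
    "(\<Sum>j | j \<in> F \<and> S j \<inter> S i \<noteq> {}. p ^ card (S j - S i)) = once_sum F i / p + b"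
    "(\<Sum>j | j \<in> F \<and> S j \<inter> S i \<noteq> {}. p ^ card (S j)) \<le> once_sum F i + b"
    "0 \<le> once_sum F i" "once_sum F i \<le> once_sum F i / p"
proof -
  have finF: "finite F" using F finite_subset[OF _ fin_I] by blast
  define D D1 where "D = {j\<in>F. S j \<inter> S i \<noteq> {}}" and "D1 = {j\<in>F. 2 \<le> card (S j \<inter> S i)}"
  have D: "D = once F i \<union> D1" "once F i \<inter> D1 = {}" "finite (once F i)" "finite D1"
  proof -
    have "S j \<inter> S i \<noteq> {} \<longleftrightarrow> card (S j \<inter> S i) = 1 \<or> 2 \<le> card (S j \<inter> S i)" if "j \<in> F" for j
    proof -
      have "finite (S j \<inter> S i)" using that F finite_S by auto
      hence "S j \<inter> S i \<noteq> {} \<longleftrightarrow> card (S j \<inter> S i) \<noteq> 0" by auto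
      thus ?thesis by linarith
    qed
    thus "D = once F i \<union> D1" by (auto simp: D_def D1_def once_def)
  qed (use finF in \<open>auto simp: D1_def once_def\<close>)
  define b where "b = (\<Sum>j\<in>D1. p ^ card (S j - S i))"
  have "(\<Sum>j\<in>once F i. p ^ card (S j - S i)) = once_sum F i / p"
    unfolding once_sum_def sum_divide_distrib using F
    by (intro sum.cong power_Diff_once) (auto simp: once_def)
  hence eq: "(\<Sum>j\<in>D. p ^ card (S j - S i)) = once_sum F i / p + b"
    using D by (simp add: sum.union_disjoint b_def)
  show ?thesis
  proof
    show "0 \<le> b" unfolding b_def using p_bounds by (auto intro!: sum_nonneg)
    show "b \<le> \<beta>"
    proof -
      have "b \<le> (\<Sum>j | j \<in> I - {i} \<and> 2 \<le> card (S j \<inter> S i). p ^ card (S j - S i))"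
        unfolding b_def D1_def using F p_bounds by (intro sum_mono2) auto
      thus ?thesis using beta_sum[OF i] by simp
    qed
    have "(\<Sum>j\<in>D. p ^ card (S j - S i)) \<le> (\<Sum>j | j \<in> I - {i} \<and> S j \<inter> S i \<noteq> {}. p ^ card (S j - S i))"
      unfolding D_def using F p_bounds by (intro sum_mono2) auto
    thus "once_sum F i / p + b \<le> \<delta>" using delta_sum[OF i] eq by simp
    show "(\<Sum>j | j \<in> F \<and> S j \<inter> S i \<noteq> {}. p ^ card (S j - S i)) = once_sum F i / p + b"
      using eq by (simp add: D_def)
    have "(\<Sum>j\<in>D. p ^ card (S j)) = once_sum F i + (\<Sum>j\<in>D1. p ^ card (S j))"
      using D by (simp add: sum.union_disjoint once_sum_def)
    also have "\<dots> \<le> once_sum F i + b"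
      unfolding b_def using F by (intro add_left_mono sum_mono power_le_Diff) (auto simp: D1_def)
    finally show "(\<Sum>j | j \<in> F \<and> S j \<inter> S i \<noteq> {}. p ^ card (S j)) \<le> once_sum F i + b"
      by (simp add: D_def)
    show nn: "0 \<le> once_sum F i" unfolding once_sum_def using p_bounds by (auto intro!: sum_nonneg)
    show "once_sum F i \<le> once_sum F i / p"
      using p_pos p_lt_1 nn by (simp add: field_simps mult_left_le_one_le)
  qed
qed

text \<open>Given event \<open>j\<close>, the events overlapping \<open>S j\<close> are counted by
  \<open>\<delta>\<close> and the others keep their unconditional probability.\<close>

lemma sum_once_Diff_le:
  assumes i: "i \<in> I" and F: "F \<subseteq> I - {i}" and j: "j \<in> once F i"
  shows "(\<Sum>k\<in>once F i - {j}. p ^ card (S k - S j)) \<le> \<delta> + once_sum F i"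
proof -
  have finF: "finite F" using F finite_subset[OF _ fin_I] by blast
  have jI: "j \<in> I" using j F by (auto simp: once_def)
  have sub: "once F i \<subseteq> I" using F by (auto simp: once_def)
  have fin: "finite (once F i)" using finF by (simp add: once_def)
  let ?A = "{k \<in> once F i - {j}. S k \<inter> S j \<noteq> {}}" and ?B = "{k \<in> once F i - {j}. S k \<inter> S j = {}}"
  have "once F i - {j} = ?A \<union> ?B" by auto
  hence "(\<Sum>k\<in>once F i - {j}. p ^ card (S k - S j)) = (\<Sum>k\<in>?A \<union> ?B. p ^ card (S k - S j))"
    by (rule sum.cong[OF _ refl])
  also have "\<dots> = (\<Sum>k\<in>?A. p ^ card (S k - S j)) + (\<Sum>k\<in>?B. p ^ card (S k - S j))"
    using fin by (intro sum.union_disjoint) auto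
  also have "(\<Sum>k\<in>?B. p ^ card (S k - S j)) = (\<Sum>k\<in>?B. p ^ card (S k))"
    by (intro sum.cong) (auto simp: Diff_triv)
  also have "\<dots> \<le> once_sum F i" unfolding once_sum_def
    using fin p_bounds by (intro sum_mono2) auto
  also have "(\<Sum>k\<in>?A. p ^ card (S k - S j)) \<le> (\<Sum>k | k \<in> I - {j} \<and> S k \<inter> S j \<noteq> {}. p ^ card (S k - S j))"
    using sub p_bounds by (intro sum_mono2) auto
  also have "\<dots> \<le> \<delta>" by (rule delta_sum[OF jI])
  finally show ?thesis by simp
qed

text \<open>As the events of \<open>F\<close> avoid \<open>A\<close>, forcing \<open>A\<close>
  besides \<open>S j\<close> disturbs only those meeting \<open>S j\<close>, whose total weight is
  at most \<open>\<delta>\<close>.\<close>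

lemma janson_step_apart:
  assumes j: "j \<in> I" and F: "F \<subseteq> I - {j}" and A: "A \<subseteq> E" "\<And>k. k \<in> F \<Longrightarrow> S k \<inter> A = {}"
  shows "p ^ card (A \<union> S j) * prb (none F) * (1 - \<delta>) \<le> prb (\<lambda>w. A \<union> S j \<subseteq> w \<and> none F w)"
proof (rule janson_step')
  have "(\<Sum>k | k \<in> F \<and> S k \<inter> (A \<union> S j) \<noteq> {}. p ^ card (S k - (A \<union> S j)))
    = (\<Sum>k | k \<in> F \<and> S k \<inter> S j \<noteq> {}. p ^ card (S k - S j))"
  proof (rule sum.cong)
    show "{k \<in> F. S k \<inter> (A \<union> S j) \<noteq> {}} = {k \<in> F. S k \<inter> S j \<noteq> {}}" using A(2) by blast
    fix k assume "k \<in> {k \<in> F. S k \<inter> S j \<noteq> {}}"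
    hence "S k - (A \<union> S j) = S k - S j" using A(2)[of k] by blast
    thus "p ^ card (S k - (A \<union> S j)) = p ^ card (S k - S j)" by simp
  qed
  also have "\<dots> \<le> (\<Sum>k | k \<in> I - {j} \<and> S k \<inter> S j \<noteq> {}. p ^ card (S k - S j))"
    using F p_bounds by (intro sum_mono2) auto
  also have "\<dots> \<le> \<delta>" by (rule delta_sum[OF j])
  finally show "(\<Sum>k | k \<in> F \<and> S k \<inter> (A \<union> S j) \<noteq> {}. p ^ card (S k - (A \<union> S j))) \<le> \<delta>" .
  show "A \<union> S j \<subseteq> E" using A(1) S_sub[OF j] by simp
  show "F \<subseteq> I" using F by auto
  show "\<delta> \<le> 1" using delta_half by simp
qed

lemma pr_none_insert: "prb (none (insert i F)) = prb (none F) - prb (\<lambda>w. S i \<subseteq> w \<and> none F w)"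
proof -
  have "prb (none (insert i F)) = prb (\<lambda>w. none F w \<and> \<not> S i \<subseteq> w)"
    by (intro pr_cong) (auto simp: none_def)
  thus ?thesis by (simp add: pr_conj_Not conj_commute)
qed

text \<open>
  The conditional probability of \<open>S i \<subseteq> w\<close> given that no earlier event occurs is \<open>p ^ card (S i)\<close> times a
  ratio in which the events independent of \<open>i\<close> cancel. Numerator and denominator of what is left are
  expanded to second order, so that events meeting \<open>S i\<close> exactly once contribute their covariance.
\<close>

lemma occurrence_lower:
  assumes i: "i \<in> I" and F: "F \<subseteq> I - {i}"
  shows "prb (none F) * (p ^ card (S i) * (1 - (1/p - 1) * once_sum F i - \<beta> - 6 * \<delta>\<^sup>2))
    \<le> prb (\<lambda>w. S i \<subseteq> w \<and> none F w)"
proof -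
  define D0 where "D0 = {j\<in>F. S j \<inter> S i = {}}"
  define s where "s = once_sum F i"
  have FI: "F \<subseteq> I" using F by auto
  have finF: "finite F" using FI finite_subset[OF _ fin_I] by blast
  have D0: "D0 \<subseteq> I" using FI by (auto simp: D0_def)
  have once: "once F i \<subseteq> I" "\<And>j. j \<in> once F i \<Longrightarrow> j \<notin> D0"
    using FI by (auto simp: once_def D0_def)
  obtain b where b: "0 \<le> b" "b \<le> \<beta>" "s / p + b \<le> \<delta>"
    "(\<Sum>j | j \<in> F \<and> S j \<inter> S i \<noteq> {}. p ^ card (S j - S i)) = s / p + b"
    "(\<Sum>j | j \<in> F \<and> S j \<inter> S i \<noteq> {}. p ^ card (S j)) \<le> s + b"
    "0 \<le> s" "s \<le> s / p"
    unfolding s_def by (rule sum_bounds[OF i F])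
  have \<delta>0: "0 \<le> \<delta>" and s\<delta>: "s \<le> \<delta>" using b by linarith+
  have num: "p ^ card (S i) * prb (none D0) * (1 - (s / p + b)) \<le> prb (\<lambda>w. S i \<subseteq> w \<and> none F w)"
    using janson_step[of "S i" F] S_sub[OF i] FI b(4) by (simp add: D0_def)
  \<comment> \<open>For an upper bound the events meeting \<open>S i\<close> in two or more elements
    may be dropped. Bonferroni is applied to those meeting it once, with the independent events
    \<open>D0\<close> as side condition.\<close>
  have den: "prb (none F) \<le> prb (none D0) * (1 - s + 2 * s * \<delta>)"
  proof -
    have "prb (none F) \<le> prb (\<lambda>w. {} \<subseteq> w \<and> none D0 w \<and> none (once F i) w)"
      by (intro pr_mono) (auto simp: none_def D0_def once_def)
    also have "\<dots> \<le> prb (none D0) - (\<Sum>j\<in>once F i. prb (\<lambda>w. S j \<subseteq> w \<and> none D0 w))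
        + (1/2) * (\<Sum>j\<in>once F i. \<Sum>k\<in>once F i-{j}. p ^ card (S j \<union> S k)) * prb (none D0)"
      using pr_bonferroni[of "{}" "once F i" "none D0"] once none_dec[of _ _ D0] by auto
    also have "\<dots> \<le> prb (none D0) - (\<Sum>j\<in>once F i. p ^ card (S j) * prb (none D0) * (1 - \<delta>))
        + (1/2) * (\<Sum>j\<in>once F i. p ^ card (S j) * (\<delta> + s)) * prb (none D0)"
    proof (intro add_mono diff_mono sum_mono mult_right_mono mult_left_mono pr_nonneg order_refl)
      fix j assume j: "j \<in> once F i"
      hence jI: "j \<in> I" using once by auto
      show "p ^ card (S j) * prb (none D0) * (1 - \<delta>) \<le> prb (\<lambda>w. S j \<subseteq> w \<and> none D0 w)"
        using janson_step_apart[of j D0 "{}"] jI D0 once(2)[OF j] by auto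
      have "(\<Sum>k\<in>once F i-{j}. p ^ card (S j \<union> S k)) = p ^ card (S j) * (\<Sum>k\<in>once F i-{j}. p ^ card (S k - S j))"
        unfolding sum_distrib_left using once S_sub jI
        by (intro sum.cong) (auto simp: card_union_eq subset_iff power_add)
      also have "\<dots> \<le> p ^ card (S j) * (\<delta> + s)"
        using sum_once_Diff_le[OF i F j] p_bounds by (intro mult_left_mono) (auto simp: s_def)
      finally show "(\<Sum>k\<in>once F i-{j}. p ^ card (S j \<union> S k)) \<le> p ^ card (S j) * (\<delta> + s)" .
    qed auto
    also have "\<dots> = prb (none D0) * (1 - s * (1 - \<delta>) + (1/2) * (s * (\<delta> + s)))"
    proof -
      have "(\<Sum>j\<in>once F i. p ^ card (S j) * prb (none D0) * (1 - \<delta>)) = s * prb (none D0) * (1 - \<delta>)"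
        "(\<Sum>j\<in>once F i. p ^ card (S j) * (\<delta> + s)) = s * (\<delta> + s)"
        unfolding s_def once_sum_def sum_distrib_right by simp_all
      thus ?thesis by (simp only:) (simp add: algebra_simps)
    qed
    also have "\<dots> \<le> prb (none D0) * (1 - s + 2 * s * \<delta>)"
    proof (intro mult_left_mono pr_nonneg)
      have "s * s \<le> s * \<delta>" using s\<delta> b by (intro mult_left_mono)
      thus "1 - s * (1 - \<delta>) + (1/2) * (s * (\<delta> + s)) \<le> 1 - s + 2 * s * \<delta>"
        by (simp add: algebra_simps)
    qed
    finally show ?thesis .
  qed
  define c where "c = 1 - (1/p - 1) * s - \<beta> - 6 * \<delta>\<^sup>2"
  \<comment> \<open>If \<open>c \<le> 0\<close> the two sides have opposite signs. Otherwise the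
    claim amounts to dividing \<open>1 - a\<close> by \<open>1 - x\<close> up to second
    order.\<close>
  have key: "prb (none F) * c \<le> prb (none D0) * (1 - (s / p + b))"
  proof (cases "c \<le> 0")
    case True
    hence "prb (none F) * c \<le> 0" using pr_nonneg by (simp add: mult_nonneg_nonpos)
    also have "0 \<le> prb (none D0) * (1 - (s / p + b))"
      using pr_nonneg b delta_half by (intro mult_nonneg_nonneg) auto
    finally show ?thesis .
  next
    case False
    define a x where "a = s / p + b" and "x = s - 2 * s * \<delta>"
    have x: "0 \<le> x" "x \<le> 1/2"
    proof -
      have "s * \<delta> \<le> s * (1/2)" using b delta_half by (intro mult_left_mono) auto
      thus "0 \<le> x" by (simp add: x_def)
      have "0 \<le> s * \<delta>" using b \<delta>0 by simp
      thus "x \<le> 1/2" using s\<delta> delta_half by (simp add: x_def)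
    qed
    have a: "0 \<le> a" "a \<le> \<delta>" using b p_pos by (auto simp: a_def)
    have ca: "c \<le> 1 - a + s - 6 * \<delta>\<^sup>2" using b by (simp add: c_def a_def algebra_simps)
    have "prb (none F) * c \<le> (prb (none D0) * (1 - x)) * c"
      using den False by (intro mult_right_mono) (auto simp: x_def algebra_simps)
    also have "\<dots> \<le> (prb (none D0) * (1 - x)) * (1 - a + s - 6 * \<delta>\<^sup>2)"
      using ca x pr_nonneg by (intro mult_left_mono) auto
    also have "\<dots> \<le> prb (none D0) * (1 - a)"
      unfolding mult.assoc
    proof (intro mult_left_mono pr_nonneg)
      have 1: "s * (2 * \<delta> + a) \<le> \<delta> * (2 * \<delta> + \<delta>)"
        using s\<delta> a b \<delta>0 by (intro mult_mono) auto
      have 1: "s * (2 * \<delta> + a) \<le> 3 * \<delta>\<^sup>2" using 1 by (simp add: power2_eq_square)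
      \<comment> \<open>The cross terms amount to at most \<open>3 * \<delta>\<^sup>2\<close>. The
        constant 6 is twice that, because \<open>1 - x\<close> may be as small as 1/2.\<close>
      have 2: "(1/2) * (6 * \<delta>\<^sup>2) \<le> (1 - x) * (6 * \<delta>\<^sup>2)" using x by (intro mult_right_mono) auto
      have 3: "0 \<le> x * s" using x b by simp
      have 4: "0 \<le> s * \<delta> * a" using b \<delta>0 a by simp
      have "(1 - x) * (1 - a + s - 6 * \<delta>\<^sup>2) = 1 - a + (s - x * (1 - a)) - x * s - (1 - x) * (6 * \<delta>\<^sup>2)"
        by (simp add: algebra_simps)
      also have "s - x * (1 - a) = s * (2 * \<delta> + a) - 2 * (s * \<delta> * a)"
        by (simp add: x_def algebra_simps)
      also have "1 - a + (s * (2 * \<delta> + a) - 2 * (s * \<delta> * a)) - x * s - (1 - x) * (6 * \<delta>\<^sup>2) \<le> 1 - a"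
        using 1 2 3 4 by linarith
      finally show "(1 - x) * (1 - a + s - 6 * \<delta>\<^sup>2) \<le> 1 - a" .
    qed
    finally show ?thesis by (simp add: a_def)
  qed
  have "p ^ card (S i) * (prb (none F) * c) \<le> p ^ card (S i) * (prb (none D0) * (1 - (s / p + b)))"
    using key p_bounds by (intro mult_left_mono) auto
  thus ?thesis using num by (simp add: c_def s_def algebra_simps)
qed

text \<open>Mirror image of \<open>occurrence_lower\<close>: Bonferroni for the numerator, where
  \<open>S i\<close> is forced, and the union bound for the denominator.\<close>

lemma occurrence_upper:
  assumes i: "i \<in> I" and F: "F \<subseteq> I - {i}"
  shows "prb (\<lambda>w. S i \<subseteq> w \<and> none F w)
    \<le> prb (none F) * (p ^ card (S i) * (1 - (1/p - 1) * once_sum F i + \<beta> + 6 * \<delta>\<^sup>2 / p))"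
proof -
  define D0 D where "D0 = {j\<in>F. S j \<inter> S i = {}}" and "D = {j\<in>F. S j \<inter> S i \<noteq> {}}"
  define s where "s = once_sum F i"
  have FI: "F \<subseteq> I" using F by auto
  have finF: "finite F" using FI finite_subset[OF _ fin_I] by blast
  have D0: "D0 \<subseteq> I" "D \<subseteq> I" using FI by (auto simp: D0_def D_def)
  have once: "once F i \<subseteq> I" "\<And>j. j \<in> once F i \<Longrightarrow> j \<notin> D0" "\<And>j. j \<in> once F i \<Longrightarrow> card (S j \<inter> S i) = 1"
    using FI by (auto simp: once_def D0_def)
  obtain b where b: "0 \<le> b" "b \<le> \<beta>" "s / p + b \<le> \<delta>"
    "(\<Sum>j | j \<in> F \<and> S j \<inter> S i \<noteq> {}. p ^ card (S j - S i)) = s / p + b"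
    "(\<Sum>j | j \<in> F \<and> S j \<inter> S i \<noteq> {}. p ^ card (S j)) \<le> s + b"
    "0 \<le> s" "s \<le> s / p"
    unfolding s_def by (rule sum_bounds[OF i F])
  have \<delta>0: "0 \<le> \<delta>" and s\<delta>: "s / p \<le> \<delta>" "s \<le> \<delta>" "s + b \<le> \<delta>" using b by linarith+
  have Si: "S i \<subseteq> E" by (rule S_sub[OF i])
  have num: "prb (\<lambda>w. S i \<subseteq> w \<and> none F w) \<le> p ^ card (S i) * (prb (none D0) * (1 - s / p + 2 * \<delta>\<^sup>2 / p))"
  proof -
    have "prb (\<lambda>w. S i \<subseteq> w \<and> none F w) \<le> prb (\<lambda>w. S i \<subseteq> w \<and> none D0 w \<and> none (once F i) w)"
      by (intro pr_mono) (auto simp: none_def D0_def once_def)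
    also have "\<dots> \<le> prb (\<lambda>w. S i \<subseteq> w \<and> none D0 w)
        - (\<Sum>j\<in>once F i. prb (\<lambda>w. S i \<union> S j \<subseteq> w \<and> none D0 w))
        + (1/2) * (\<Sum>j\<in>once F i. \<Sum>k\<in>once F i-{j}. p ^ card (S i \<union> S j \<union> S k)) * prb (none D0)"
      by (rule pr_bonferroni[OF Si once(1) none_dec])
    also have "\<dots> \<le> p ^ card (S i) * prb (none D0)
        - (\<Sum>j\<in>once F i. p ^ card (S i) * (p ^ card (S j) / p) * prb (none D0) * (1 - \<delta>))
        + (1/2) * (\<Sum>j\<in>once F i. p ^ card (S i) * (p ^ card (S j) / p) * ((\<delta> + s) / p)) * prb (none D0)"
    proof (intro add_mono diff_mono sum_mono mult_right_mono mult_left_mono pr_nonneg order_refl)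
      show "prb (\<lambda>w. S i \<subseteq> w \<and> none D0 w) \<le> p ^ card (S i) * prb (none D0)"
        using Si by (subst pr_disjoint_none) (auto simp: D0_def)
      fix j assume j: "j \<in> once F i"
      hence jI: "j \<in> I" using once by auto
      have cardU: "p ^ card (S i \<union> S j) = p ^ card (S i) * (p ^ card (S j) / p)"
        using card_union_eq[of "S i" "S j"] Si S_sub[OF jI] power_Diff_once[OF jI once(3)[OF j]]
        by (simp add: power_add)
      show "p ^ card (S i) * (p ^ card (S j) / p) * prb (none D0) * (1 - \<delta>)
          \<le> prb (\<lambda>w. S i \<union> S j \<subseteq> w \<and> none D0 w)"
        unfolding cardU[symmetric] using jI D0(1) once(2)[OF j] Si
        by (intro janson_step_apart) (auto simp: D0_def)
      have "(\<Sum>k\<in>once F i-{j}. p ^ card (S i \<union> S j \<union> S k))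
        \<le> (\<Sum>k\<in>once F i-{j}. p ^ card (S i \<union> S j) * (p ^ card (S k - S j) / p))"
      proof (intro sum_mono)
        fix k assume k: "k \<in> once F i - {j}"
        hence kI: "k \<in> I" using once by auto
        \<comment> \<open>Removing \<open>S i\<close> as well takes at most one more element from
          \<open>S k\<close>, hence at most one more factor \<open>1 / p\<close>.\<close>
        have "card (S k - S j) \<le> card ((S k - (S i \<union> S j)) \<union> (S k \<inter> S i))"
          using finite_S[OF kI] by (intro card_mono) auto
        also have "\<dots> \<le> card (S k - (S i \<union> S j)) + card (S k \<inter> S i)" by (rule card_Un_le)
        finally have "card (S k - S j) \<le> Suc (card (S k - (S i \<union> S j)))"
          using once(3)[of k] k by simp
        hence "p ^ Suc (card (S k - (S i \<union> S j))) \<le> p ^ card (S k - S j)"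
          using p_bounds by (intro power_decreasing) auto
        hence "p ^ card (S k - (S i \<union> S j)) \<le> p ^ card (S k - S j) / p"
          using p_pos by (simp add: field_simps)
        moreover have "card (S i \<union> S j \<union> S k) = card (S i \<union> S j) + card (S k - (S i \<union> S j))"
          using Si S_sub[OF jI] S_sub[OF kI] by (intro card_union_eq) auto
        ultimately show "p ^ card (S i \<union> S j \<union> S k) \<le> p ^ card (S i \<union> S j) * (p ^ card (S k - S j) / p)"
          using p_bounds by (simp only: power_add) (intro mult_left_mono, auto)
      qed
      also have "\<dots> = p ^ card (S i \<union> S j) * ((\<Sum>k\<in>once F i-{j}. p ^ card (S k - S j)) / p)"
        by (simp add: sum_distrib_left sum_divide_distrib)
      also have "\<dots> \<le> p ^ card (S i \<union> S j) * ((\<delta> + s) / p)"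
        using sum_once_Diff_le[OF i F j] p_pos by (intro mult_left_mono divide_right_mono) (auto simp: s_def)
      finally show "(\<Sum>k\<in>once F i-{j}. p ^ card (S i \<union> S j \<union> S k))
        \<le> p ^ card (S i) * (p ^ card (S j) / p) * ((\<delta> + s) / p)" by (simp add: cardU)
    qed auto
    also have "\<dots> = p ^ card (S i) * (prb (none D0) *
        (1 - s / p * (1 - \<delta>) + (1/2) * (s / p * ((\<delta> + s) / p))))"
    proof -
      have "(\<Sum>j\<in>once F i. p ^ card (S i) * (p ^ card (S j) / p) * prb (none D0) * (1 - \<delta>))
          = p ^ card (S i) * (s / p) * prb (none D0) * (1 - \<delta>)"
        "(\<Sum>j\<in>once F i. p ^ card (S i) * (p ^ card (S j) / p) * ((\<delta> + s) / p))
          = p ^ card (S i) * (s / p) * ((\<delta> + s) / p)"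
        unfolding s_def once_sum_def sum_distrib_right sum_distrib_left sum_divide_distrib by simp_all
      thus ?thesis by (simp only:) (simp add: algebra_simps)
    qed
    also have "\<dots> \<le> p ^ card (S i) * (prb (none D0) * (1 - s / p + 2 * \<delta>\<^sup>2 / p))"
    proof (intro mult_left_mono pr_nonneg)
      have 1: "s / p * \<delta> \<le> \<delta> * \<delta>" using s\<delta> \<delta>0 by (intro mult_right_mono)
      have "\<delta> * \<delta> * p \<le> \<delta> * \<delta> * 1" using p_bounds by (intro mult_left_mono) auto
      hence 2: "\<delta> * \<delta> \<le> \<delta> * \<delta> / p" using p_pos by (simp add: field_simps)
      have 3: "s / p * ((\<delta> + s) / p) \<le> \<delta> * ((\<delta> + \<delta>) / p)"
        using s\<delta> \<delta>0 b p_pos by (intro mult_mono divide_right_mono) auto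
      have 3: "s / p * ((\<delta> + s) / p) \<le> 2 * (\<delta> * \<delta> / p)" using 3 by (simp add: algebra_simps)
      have "1 - s / p * (1 - \<delta>) + (1/2) * (s / p * ((\<delta> + s) / p))
        = 1 - s / p + s / p * \<delta> + (1/2) * (s / p * ((\<delta> + s) / p))"
        by (simp only: right_diff_distrib)
      also have "\<dots> \<le> 1 - s / p + 2 * (\<delta> * \<delta> / p)"
      proof -
        have "X + (1/2) * T \<le> 2 * Z" if "X \<le> Y" "Y \<le> Z" "T \<le> 2 * Z" for X Y Z T :: real
          using that by linarith
        from this[OF 1 2 3] show ?thesis by simp
      qed
      finally show "1 - s / p * (1 - \<delta>) + (1/2) * (s / p * ((\<delta> + s) / p)) \<le> 1 - s / p + 2 * \<delta>\<^sup>2 / p"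
        by (simp add: power2_eq_square)
    qed (use p_bounds in auto)
    finally show ?thesis .
  qed
  define y where "y = s + b"
  have y: "0 \<le> y" "y \<le> \<delta>" using b s\<delta> by (auto simp: y_def)
  have den: "prb (none D0) * (1 - y) \<le> prb (none F)"
  proof -
    have "prb (none D0) * (1 - y) \<le> prb (none D0) - prb (none D0) * (\<Sum>j\<in>D. p ^ card (S j))"
      using b(5)[folded D_def] pr_nonneg[of "none D0"] mult_left_mono[of "\<Sum>j\<in>D. p ^ card (S j)" y "prb (none D0)"]
      by (simp add: algebra_simps y_def)
    also have "\<dots> \<le> prb (\<lambda>w. {} \<subseteq> w \<and> none D0 w \<and> none D w)"
      using pr_union_bound[of "{}" D "none D0"] D0 none_dec[of _ _ D0] by auto
    also have "\<dots> = prb (none F)"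
      by (intro pr_cong) (auto simp: none_def D0_def D_def)
    finally show ?thesis .
  qed
  define c where "c = 1 - (1/p - 1) * s + \<beta> + 6 * \<delta>\<^sup>2 / p"
  have \<delta>2: "\<delta>\<^sup>2 \<le> \<delta>\<^sup>2 / p" using p_pos p_lt_1 by (simp add: field_simps mult_left_le_one_le)
  have c1: "1 - s / p + y + 6 * (\<delta>\<^sup>2 / p) \<le> c"
    using b by (simp add: c_def y_def algebra_simps)
  have cpos: "0 \<le> c" using c1 s\<delta> delta_half y \<delta>2 zero_le_power2[of \<delta>] by linarith
  have "1 - s / p + 2 * \<delta>\<^sup>2 / p \<le> (1 - y) * (1 - s / p + y + 6 * (\<delta>\<^sup>2 / p))"
  proof -
    have 1: "y * y \<le> \<delta> * \<delta>" using y \<delta>0 by (intro mult_mono)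
    \<comment> \<open>Again 6 is twice 3: two units for the numerator, one for \<open>y * y\<close>,
      and \<open>1 - y\<close> is at least 1/2.\<close>
    have 2: "(1/2) * (6 * (\<delta>\<^sup>2 / p)) \<le> (1 - y) * (6 * (\<delta>\<^sup>2 / p))"
      using y delta_half p_pos by (intro mult_right_mono) auto
    have 3: "0 \<le> y * (s / p)" using y b p_pos by simp
    have 1: "y * y \<le> \<delta>\<^sup>2" using 1 by (simp add: power2_eq_square)
    have "(1 - y) * (1 - s / p + y + 6 * (\<delta>\<^sup>2 / p))
      = 1 - s / p + y * (s / p) - y * y + (1 - y) * (6 * (\<delta>\<^sup>2 / p))"
      by (simp only: left_diff_distrib right_diff_distrib distrib_left distrib_right)
    thus ?thesis using 1 2 3 \<delta>2 by simp
  qed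
  also have "\<dots> \<le> (1 - y) * c" using c1 y delta_half by (intro mult_left_mono) auto
  finally have "prb (none D0) * (1 - s / p + 2 * \<delta>\<^sup>2 / p) \<le> prb (none D0) * ((1 - y) * c)"
    using pr_nonneg by (intro mult_left_mono)
  also have "\<dots> = (prb (none D0) * (1 - y)) * c" by simp
  also have "\<dots> \<le> prb (none F) * c" using den cpos by (intro mult_right_mono)
  finally have "p ^ card (S i) * (prb (none D0) * (1 - s / p + 2 * \<delta>\<^sup>2 / p)) \<le> p ^ card (S i) * (prb (none F) * c)"
    using p_bounds by (intro mult_left_mono) auto
  thus ?thesis using num by (simp add: c_def s_def algebra_simps)
qed

section \<open>The probability that no event occurs\<close>

definition first_sum :: "'i set \<Rightarrow> real" where "first_sum F = (\<Sum>i\<in>F. p ^ card (S i))"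

text \<open>The sum runs over ordered pairs, hence the half: each unordered pair sharing one element
  contributes its covariance once.\<close>

definition second_sum :: "'i set \<Rightarrow> real" where
  "second_sum F = (1/2) * (1/p - 1) * (\<Sum>i\<in>F. \<Sum>j\<in>once (F - {i}) i. p ^ card (S i) * p ^ card (S j))"

text \<open>The new event is paired with each earlier neighbour in both orders, which cancels the
  half.\<close>

lemma second_sum_insert:
  assumes "finite F" "i \<notin> F"
  shows "second_sum (insert i F) = second_sum F + (1/p - 1) * (p ^ card (S i) * once_sum F i)"
proof -
  have 1: "(\<Sum>j\<in>once (insert i F - {a}) a. p ^ card (S a) * p ^ card (S j))
    = (\<Sum>j\<in>once (F - {a}) a. p ^ card (S a) * p ^ card (S j))
      + of_bool (a \<in> once F i) * (p ^ card (S a) * p ^ card (S i))" if "a \<in> F" for a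
  proof (cases "a \<in> once F i")
    case True
    hence "once (insert i F - {a}) a = insert i (once (F - {a}) a)" "i \<notin> once (F - {a}) a"
      using that assms by (auto simp: once_def Int_commute)
    thus ?thesis using True assms by (simp add: once_def)
  next
    case False
    hence "once (insert i F - {a}) a = once (F - {a}) a"
      using that assms by (auto simp: once_def Int_commute)
    thus ?thesis using False by simp
  qed
  have 2: "(\<Sum>a\<in>F. of_bool (a \<in> once F i) * (p ^ card (S a) * p ^ card (S i)))
    = p ^ card (S i) * once_sum F i"
  proof -
    have "(\<Sum>a\<in>F. of_bool (a \<in> once F i) * (p ^ card (S a) * p ^ card (S i)))
      = (\<Sum>a\<in>once F i. p ^ card (S a) * p ^ card (S i))"
      using assms by (intro sum.mono_neutral_cong_right) (auto simp: once_def)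
    thus ?thesis by (simp add: once_sum_def sum_distrib_left mult.commute)
  qed
  have 3: "insert i F - {i} = F" using assms by auto
  have "(\<Sum>a\<in>insert i F. \<Sum>j\<in>once (insert i F - {a}) a. p ^ card (S a) * p ^ card (S j))
    = p ^ card (S i) * once_sum F i + ((\<Sum>a\<in>F. \<Sum>j\<in>once (F - {a}) a. p ^ card (S a) * p ^ card (S j))
       + p ^ card (S i) * once_sum F i)"
    using assms 1 2 by (simp add: 3 sum.distrib once_sum_def sum_distrib_left)
  thus ?thesis unfolding second_sum_def by (simp only:) (simp add: field_simps)
qed

lemma nonneg_err: "i \<in> I \<Longrightarrow> 0 \<le> \<beta>" "i \<in> I \<Longrightarrow> 0 \<le> \<delta>"
  using order_trans[OF sum_nonneg beta_sum[of i]] order_trans[OF sum_nonneg delta_sum[of i]] p_bounds by auto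

text \<open>Chain rule: adding event \<open>i\<close> multiplies the probability by one minus its
  conditional probability, at most \<open>exp (- c)\<close>. The \<open>once_sum\<close> terms
  accumulate to the covariance sum.\<close>

theorem pr_none_upper:
  assumes "F \<subseteq> I"
  shows "prb (none F) \<le> exp (- first_sum F + second_sum F + first_sum F * (\<beta> + 6 * \<delta>\<^sup>2))"
proof -
  have "finite F" using assms finite_subset[OF _ fin_I] by blast
  thus ?thesis using assms
  proof (induction F rule: finite_induct)
    case empty
    show ?case using pr_le_1 by (simp add: first_sum_def second_sum_def)
  next
    case (insert i F)
    define c where "c = p ^ card (S i) * (1 - (1/p - 1) * once_sum F i - \<beta> - 6 * \<delta>\<^sup>2)"
    have "prb (none (insert i F)) \<le> prb (none F) * (1 - c)"
      using occurrence_lower[of i F] insert by (auto simp: pr_none_insert c_def algebra_simps)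
    also have "\<dots> \<le> prb (none F) * exp (- c)"
      using exp_ge_add_one_self[of "- c"] pr_nonneg by (intro mult_left_mono) auto
    also have "\<dots> \<le> exp (- first_sum F + second_sum F + first_sum F * (\<beta> + 6 * \<delta>\<^sup>2)) * exp (- c)"
      using insert by (intro mult_right_mono) auto
    also have "\<dots> = exp (- first_sum (insert i F) + second_sum (insert i F)
        + first_sum (insert i F) * (\<beta> + 6 * \<delta>\<^sup>2))"
      using insert.hyps by (simp add: exp_add[symmetric] second_sum_insert first_sum_def c_def algebra_simps)
    finally show ?case .
  qed
qed

text \<open>The same chain rule with \<open>1 - c \<ge> exp (- c - 2 * c\<^sup>2)\<close> for
  \<open>c \<le> 1/2\<close>; the squares are responsible for the term with
  \<open>\<kappa>\<close>.\<close>

theorem pr_none_lower: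
  assumes "F \<subseteq> I"
  shows "exp (- first_sum F + second_sum F - first_sum F * (\<beta> + 6 * \<delta>\<^sup>2 / p + 2 * \<kappa>)) \<le> prb (none F)"
proof -
  have "finite F" using assms finite_subset[OF _ fin_I] by blast
  thus ?thesis using assms
  proof (induction F rule: finite_induct)
    case empty
    have "none {} = (\<lambda>w. True)" by (auto simp: none_def fun_eq_iff)
    thus ?case by (simp add: first_sum_def second_sum_def)
  next
    case (insert i F)
    have i: "i \<in> I" "F \<subseteq> I - {i}" "F \<subseteq> I" using insert by auto
    define q where "q = p ^ card (S i)"
    define e where "e = - (1/p - 1) * once_sum F i + \<beta> + 6 * \<delta>\<^sup>2 / p"
    \<comment> \<open>Capping by the unconditional probability, legitimate by Harris' inequality,
      keeps \<open>c\<close> at most \<open>\<kappa>\<close>, hence at most 1/2, whatever the size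
      of \<open>e\<close>.\<close>
    define c where "c = min q (q * (1 + e))"
    have q: "0 < q" "q \<le> \<kappa>" using kappa[OF i(1)] p_pos by (auto simp: q_def)
    have "prb (\<lambda>w. S i \<subseteq> w \<and> none F w) \<le> prb (none F) * (q * (1 + e))"
      using occurrence_upper[OF i(1,2)] by (simp add: q_def e_def algebra_simps)
    moreover have "prb (\<lambda>w. S i \<subseteq> w \<and> none F w) \<le> prb (none F) * q"
      using harris_superset[OF S_sub[OF i(1)], of "none F"] none_dec[of _ _ F] by (auto simp: q_def mult.commute)
    ultimately have "prb (\<lambda>w. S i \<subseteq> w \<and> none F w) \<le> prb (none F) * c"
      by (auto simp: c_def min_def)
    hence step: "prb (none F) * (1 - c) \<le> prb (none (insert i F))"
      by (simp add: pr_none_insert algebra_simps)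
    have c0: "0 \<le> c"
    proof -
      have "0 \<le> 1 + e"
      proof -
        obtain b where b: "0 \<le> b" "b \<le> \<beta>" "once_sum F i / p + b \<le> \<delta>"
          "(\<Sum>j | j \<in> F \<and> S j \<inter> S i \<noteq> {}. p ^ card (S j - S i)) = once_sum F i / p + b"
          "(\<Sum>j | j \<in> F \<and> S j \<inter> S i \<noteq> {}. p ^ card (S j)) \<le> once_sum F i + b"
          "0 \<le> once_sum F i" "once_sum F i \<le> once_sum F i / p"
          by (rule sum_bounds[OF i(1,2)])
        hence "(1/p - 1) * once_sum F i \<le> \<delta>" by (simp add: algebra_simps)
        moreover have "0 \<le> 6 * \<delta>\<^sup>2 / p" using p_pos by simp
        ultimately show ?thesis using delta_half nonneg_err[OF i(1)]
          by (simp only: e_def minus_mult_left[symmetric])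
      qed
      thus ?thesis using q by (simp add: c_def)
    qed
    have c_half: "c \<le> 1/2" using q kappa_half by (simp add: c_def)
    have ec: "exp (- c - 2 * c\<^sup>2) \<le> 1 - c"
    proof -
      have "exp (- c - 2 * c\<^sup>2) \<le> exp (ln (1 - c))"
        using ln_one_minus_pos_lower_bound[OF c0 c_half] by simp
      thus ?thesis using c_half by simp
    qed
    have cc: "c\<^sup>2 \<le> q * \<kappa>"
      unfolding power2_eq_square using c0 q by (intro mult_mono) (auto simp: c_def)
    have "exp (- first_sum (insert i F) + second_sum (insert i F)
        - first_sum (insert i F) * (\<beta> + 6 * \<delta>\<^sup>2 / p + 2 * \<kappa>)) 
      = exp (- first_sum F + second_sum F - first_sum F * (\<beta> + 6 * \<delta>\<^sup>2 / p + 2 * \<kappa>)) * exp (- (q * (1 + e)) - 2 * (q * \<kappa>))"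
      using insert.hyps
      by (simp add: exp_add[symmetric] second_sum_insert first_sum_def q_def e_def algebra_simps)
    also have "\<dots> \<le> prb (none F) * exp (- c - 2 * c\<^sup>2)"
      using insert.IH[OF i(3)] cc by (intro mult_mono) (auto simp: c_def pr_nonneg)
    also have "\<dots> \<le> prb (none F) * (1 - c)"
      using ec pr_nonneg by (intro mult_left_mono) auto
    finally show ?case using step by simp
  qed
qed

end

section \<open>Cliques and their overlaps\<close>

lemma finite_nsets: "finite A \<Longrightarrow> finite (nsets A k)"
  by (rule finite_imp_finite_nsets)

lemma card_nsets: "finite A \<Longrightarrow> card (nsets A k) = card A choose k"
proof -
  assume A: "finite A"
  have "nsets A k = {B. B \<subseteq> A \<and> card B = k}"
    using A finite_subset by (auto simp: nsets_def)
  thus ?thesis using A by (simp add: n_subsets)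
qed

lemma nsets_Int: "nsets A k \<inter> nsets B k = nsets (A \<inter> B) k"
  by (auto simp: nsets_def)

locale clique_model = bernoulli_subset p "nsets {..<n} 2" for p :: real and n :: nat +
  fixes r :: nat
  assumes r_ge: "3 \<le> r" and r_le: "r \<le> n"
begin

abbreviation V :: "nat set" where "V \<equiv> {..<n}"
abbreviation E :: "nat set set" where "E \<equiv> nsets V 2"

text \<open>\<open>K f\<close> is the complete graph on \<open>f\<close>, \<open>U F\<close> the
  edge set of the shadow graph of \<open>F\<close>, and \<open>cl w\<close> the hyperedge set of the
  clique hypergraph of the graph with edge set \<open>w\<close>.\<close>

definition R :: "nat set set" where "R = nsets V r"
definition K :: "nat set \<Rightarrow> nat set set" where "K f = nsets f 2"
definition U :: "nat set set \<Rightarrow> nat set set" where "U F = (\<Union>f\<in>F. K f)"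
definition cl :: "nat set set \<Rightarrow> nat set set" where "cl w = {f\<in>R. K f \<subseteq> w}"
definition q :: real where "q = p ^ (r choose 2)"
definition \<mu> :: real where "\<mu> = real (n choose r) * q"

lemma fin_R [simp, intro]: "finite R"
  by (simp add: R_def finite_nsets)

lemma card_R: "card R = n choose r"
  by (simp add: R_def card_nsets)

lemma RD: "f \<in> R \<Longrightarrow> f \<subseteq> V" "f \<in> R \<Longrightarrow> finite f" "f \<in> R \<Longrightarrow> card f = r"
  by (auto simp: R_def nsets_def)

lemma finite_K [simp]: "finite f \<Longrightarrow> finite (K f)"
  by (simp add: K_def finite_nsets)

lemma K_sub: "f \<in> R \<Longrightarrow> K f \<subseteq> E"
  unfolding K_def by (intro nsets_mono RD)

lemma card_K: "f \<in> R \<Longrightarrow> card (K f) = r choose 2"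
  by (simp add: K_def card_nsets RD)

lemma K_Int: "K f \<inter> K g = K (f \<inter> g)"
  by (simp add: K_def nsets_Int)

lemma card_K_Int: "f \<in> R \<Longrightarrow> card (K f \<inter> K g) = card (f \<inter> g) choose 2"
  by (simp add: K_Int) (simp add: K_def card_nsets RD)

lemma card_K_Diff: "f \<in> R \<Longrightarrow> g \<in> R \<Longrightarrow> card (K g - K f) = (r choose 2) - (card (f \<inter> g) choose 2)"
  by (simp add: card_Diff_subset_Int Int_commute card_K_Int card_K RD)

lemma q_pos: "0 < q" and q_le_1: "q \<le> 1"
  using p_pos p_bounds by (auto simp: q_def power_le_one)

lemma \<mu>_pos: "0 < \<mu>"
  using q_pos r_le by (simp add: \<mu>_def)

lemma card_Int_le: "f \<in> R \<Longrightarrow> g \<in> R \<Longrightarrow> card (f \<inter> g) \<le> r"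
  using card_mono[of f "f \<inter> g"] RD by auto

lemma card_Int_eq_r: "f \<in> R \<Longrightarrow> g \<in> R \<Longrightarrow> card (f \<inter> g) = r \<longleftrightarrow> f = g"
  using RD card_subset_eq[of f "f \<inter> g"] card_subset_eq[of g "f \<inter> g"] by (metis inf_le1 inf_le2 inf.idem)

lemma card_Int_less: "f \<in> R \<Longrightarrow> g \<in> R \<Longrightarrow> f \<noteq> g \<Longrightarrow> card (f \<inter> g) < r"
  using card_Int_le card_Int_eq_r by (metis le_neq_implies_less)

lemma U_sub: "F \<subseteq> R \<Longrightarrow> U F \<subseteq> E"
  using K_sub by (auto simp: U_def)

lemma finite_U: "F \<subseteq> R \<Longrightarrow> finite (U F)"
  using U_sub finite_subset fin_E by blast

lemma cl_sub: "cl w \<subseteq> R" by (auto simp: cl_def)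

lemma finite_cl [simp]: "finite (cl w)" using cl_sub finite_subset by blast

lemma sub_cl_iff: "F \<subseteq> R \<Longrightarrow> F \<subseteq> cl w \<longleftrightarrow> U F \<subseteq> w"
  by (auto simp: cl_def U_def)

lemma pr_sub_cl: "F \<subseteq> R \<Longrightarrow> prb (\<lambda>w. F \<subseteq> cl w) = p ^ card (U F)"
  by (simp add: sub_cl_iff pr_superset U_sub)

section \<open>Counting sets by their intersection with a given one\<close>

lemma count_Int:
  assumes f: "f \<in> R" and s: "s \<le> r"
  shows "card {g\<in>R. card (f \<inter> g) = s} = (r choose s) * ((n - r) choose (r - s))"
proof -
  have "bij_betw (\<lambda>(a, b). a \<union> b) (nsets f s \<times> nsets (V - f) (r - s)) {g\<in>R. card (f \<inter> g) = s}"
  proof (rule bij_betwI[where g = "\<lambda>g. (f \<inter> g, g - f)"])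
    show "(\<lambda>(a, b). a \<union> b) \<in> nsets f s \<times> nsets (V - f) (r - s) \<rightarrow> {g\<in>R. card (f \<inter> g) = s}"
    proof (rule funcsetI, clarify)
      fix a b assume ab: "a \<in> nsets f s" "b \<in> nsets (V - f) (r - s)"
      have ab': "a \<subseteq> f" "finite a" "card a = s" "b \<subseteq> V - f" "finite b" "card b = r - s"
        using ab unfolding nsets_def by auto
      have "f \<inter> (a \<union> b) = a" "a \<inter> b = {}" using ab' by blast+
      thus "a \<union> b \<in> R \<and> card (f \<inter> (a \<union> b)) = s"
        using ab' RD(1)[OF f] s by (simp add: nsets_def R_def card_Un_disjoint) blast
    qed
    show "(\<lambda>g. (f \<inter> g, g - f)) \<in> {g\<in>R. card (f \<inter> g) = s} \<rightarrow> nsets f s \<times> nsets (V - f) (r - s)"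
    proof (rule funcsetI)
      fix g assume g: "g \<in> {g\<in>R. card (f \<inter> g) = s}"
      hence "card (g - f) = r - s" using RD by (simp add: card_Diff_subset_Int Int_commute)
      thus "(f \<inter> g, g - f) \<in> nsets f s \<times> nsets (V - f) (r - s)"
        using g RD(1)[of g] RD(2)[of g] by (auto simp: nsets_def)
    qed
    show "(\<lambda>g. (f \<inter> g, g - f)) ((\<lambda>(a, b). a \<union> b) x) = x"
      if "x \<in> nsets f s \<times> nsets (V - f) (r - s)" for x
    proof -
      obtain a b where x: "x = (a, b)" "a \<subseteq> f" "b \<subseteq> V - f"
        using \<open>x \<in> _\<close> unfolding nsets_def by fast
      thus ?thesis by auto
    qed
    show "(\<lambda>(a, b). a \<union> b) ((\<lambda>g. (f \<inter> g, g - f)) g) = g" for g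
      by auto
  qed
  hence "card {g\<in>R. card (f \<inter> g) = s} = card (nsets f s \<times> nsets (V - f) (r - s))"
    by (rule bij_betw_same_card[symmetric])
  thus ?thesis using f RD[OF f] by (simp add: card_cartesian_product card_nsets card_Diff_subset)
qed

lemma count_edge:
  assumes e: "e \<in> E" shows "card {f\<in>R. e \<in> K f} = (n - 2) choose (r - 2)"
proof -
  have e': "e \<subseteq> V" "finite e" "card e = 2" using e by (auto simp: nsets_def)
  have "bij_betw (\<lambda>b. e \<union> b) (nsets (V - e) (r - 2)) {f\<in>R. e \<in> K f}"
  proof (rule bij_betwI[where g = "\<lambda>f. f - e"])
    show "(\<lambda>b. e \<union> b) \<in> nsets (V - e) (r - 2) \<rightarrow> {f\<in>R. e \<in> K f}"
    proof (rule funcsetI)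
      fix b assume b: "b \<in> nsets (V - e) (r - 2)"
      hence "e \<inter> b = {}" by (auto simp: nsets_def)
      thus "e \<union> b \<in> {f\<in>R. e \<in> K f}"
        using b e' r_ge by (auto simp: nsets_def R_def K_def card_Un_disjoint)
    qed
    show "(\<lambda>f. f - e) \<in> {f\<in>R. e \<in> K f} \<rightarrow> nsets (V - e) (r - 2)"
      using e' by (auto simp: nsets_def R_def K_def card_Diff_subset)
  qed (auto simp: nsets_def K_def)
  hence "card {f\<in>R. e \<in> K f} = card (nsets (V - e) (r - 2))"
    by (rule bij_betw_same_card[symmetric])
  thus ?thesis using e' by (simp add: card_nsets card_Diff_subset)
qed

text \<open>
  \<open>T s\<close> is the conditional expected number of cliques that share exactly \<open>s\<close> vertices with a given clique.
\<close>

definition T :: "nat \<Rightarrow> real" where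
  "T s = real (r choose s) * real ((n - r) choose (r - s)) * p ^ ((r choose 2) - (s choose 2))"
text \<open>Two common vertices give one common edge, three give at least three. Divided by
  \<open>p\<close>, these sums become the \<open>\<delta>\<close> and \<open>\<beta>\<close> of the
  Janson bounds.\<close>

definition d2 :: real where "d2 = (\<Sum>s\<in>{2..<r}. T s)"
definition d3 :: real where "d3 = (\<Sum>s\<in>{3..<r}. T s)"

lemma T_nonneg: "0 \<le> T s" using p_bounds by (simp add: T_def)

lemma d2_eq: "d2 = T 2 + d3"
  using r_ge by (simp add: d2_def d3_def sum.atLeast_Suc_lessThan eval_nat_numeral)

lemma d3_nonneg: "0 \<le> d3" and d2_nonneg: "0 \<le> d2"
  by (auto simp: d2_def d3_def intro!: sum_nonneg T_nonneg)

definition near :: "nat set \<Rightarrow> nat set set \<Rightarrow> nat set set" where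
  "near f F = {g\<in>F. g \<noteq> f \<and> 2 \<le> card (f \<inter> g)}"

lemma near_sub: "near f F \<subseteq> F" by (auto simp: near_def)

lemma finite_near [simp]: "F \<subseteq> R \<Longrightarrow> finite (near f F)"
  using near_sub finite_subset fin_R by (metis order_trans)

lemma sum_by_Int:
  assumes f: "f \<in> R"
  shows "(\<Sum>g | g \<in> R \<and> g \<noteq> f \<and> a \<le> card (f \<inter> g). p ^ card (K g - K f)) = (\<Sum>s\<in>{a..<r}. T s)"
proof -
  let ?G = "{g\<in>R. g \<noteq> f \<and> a \<le> card (f \<inter> g)}"
  have "(\<Sum>g\<in>?G. p ^ card (K g - K f))
    = (\<Sum>s\<in>{a..<r}. \<Sum>g | g \<in> ?G \<and> card (f \<inter> g) = s. p ^ card (K g - K f))"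
    using f by (intro sum.group[symmetric]) (auto intro: card_Int_less)
  also have "\<dots> = (\<Sum>s\<in>{a..<r}. T s)"
  proof (intro sum.cong refl)
    fix s assume s: "s \<in> {a..<r}"
    have "{g. g \<in> ?G \<and> card (f \<inter> g) = s} = {g\<in>R. card (f \<inter> g) = s}"
      using s f RD(3)[OF f] by auto
    hence "(\<Sum>g | g \<in> ?G \<and> card (f \<inter> g) = s. p ^ card (K g - K f))
      = (\<Sum>g | g \<in> R \<and> card (f \<inter> g) = s. p ^ ((r choose 2) - (s choose 2)))"
      using f by (intro sum.cong) (auto simp: card_K_Diff)
    thus "(\<Sum>g | g \<in> ?G \<and> card (f \<inter> g) = s. p ^ card (K g - K f)) = T s"
      using count_Int[OF f, of s] s by (simp add: T_def)
  qed
  finally show ?thesis .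
qed

lemma near_sum: "f \<in> R \<Longrightarrow> (\<Sum>g\<in>near f R. p ^ card (K g - K f)) = d2"
  using sum_by_Int[of f 2] by (simp add: near_def d2_def)

lemma near3_sum: "f \<in> R \<Longrightarrow> (\<Sum>g | g \<in> near f R \<and> 3 \<le> card (f \<inter> g). p ^ card (K g - K f)) = d3"
proof -
  have "{g. g \<in> near f R \<and> 3 \<le> card (f \<inter> g)} = {g\<in>R. g \<noteq> f \<and> 3 \<le> card (f \<inter> g)}"
    by (auto simp: near_def)
  thus "f \<in> R \<Longrightarrow> ?thesis" using sum_by_Int[of f 3] by (simp add: d3_def)
qed

section \<open>Moments of the number of cliques\<close>

lemma card_union: "A \<subseteq> E \<Longrightarrow> B \<subseteq> E \<Longrightarrow> card (A \<union> B) = card A + card (B - A)"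
  by (metis Diff_disjoint Un_Diff_cancel card_Un_disjoint fin_E finite_Diff finite_subset)

lemma pr_pair: "f \<in> R \<Longrightarrow> g \<in> R \<Longrightarrow> prb (\<lambda>w. f \<in> cl w \<and> g \<in> cl w) = q * p ^ card (K g - K f)"
  using pr_sub_cl[of "{f, g}"] card_union[of "K f" "K g"] K_sub
  by (simp add: U_def card_K power_add q_def)

lemma real_card_sum: "F \<subseteq> R \<Longrightarrow> real (card F) = (\<Sum>f\<in>R. of_bool (f \<in> F))"
  by (simp add: Int_absorb1 of_bool_def sum.If_cases Int_def[symmetric])

lemma power_card_le: "f \<in> R \<Longrightarrow> q \<le> p ^ card (K f - A)"
  using p_bounds card_K[of f] RD(2)[of f] unfolding q_def
  by (intro power_decreasing) (auto intro!: card_mono simp flip: card_K)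

text \<open>Pairs with fewer than two common vertices are independent and give at most
  \<open>\<mu>\<^sup>2\<close>; the diagonal gives \<open>\<mu>\<close> and the near pairs
  \<open>\<mu> * d2\<close>.\<close>

lemma second_moment: "ex (\<lambda>w. (real (card (cl w)) - \<mu>)\<^sup>2) \<le> \<mu> + \<mu> * d2"
proof -
  have mean: "ex (\<lambda>w. real (card (cl w))) = \<mu>"
  proof -
    have "ex (\<lambda>w. real (card (cl w))) = (\<Sum>f\<in>R. prb (\<lambda>w. {f} \<subseteq> cl w))"
      unfolding pr_def by (subst real_card_sum[OF cl_sub]) (simp only: expec_sum insert_subset empty_subsetI simp_thms)
    also have "\<dots> = (\<Sum>f\<in>R. q)"
      by (intro sum.cong refl, subst pr_sub_cl) (auto simp: U_def card_K q_def)
    finally show ?thesis by (simp add: \<mu>_def card_R)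
  qed
  have row: "(\<Sum>g\<in>R. q * p ^ card (K g - K f)) \<le> q * (1 + d2 + \<mu>)" if f: "f \<in> R" for f
  proof -
    have "R = insert f (near f R \<union> {g\<in>R. card (f \<inter> g) < 2})"
      using f by (auto simp: near_def)
    hence "(\<Sum>g\<in>R. p ^ card (K g - K f)) = (\<Sum>g\<in>insert f (near f R \<union> {g\<in>R. card (f \<inter> g) < 2}). p ^ card (K g - K f))"
      by simp
    also have "\<dots> = 1 + (d2 + (\<Sum>g | g \<in> R \<and> card (f \<inter> g) < 2. p ^ card (K g - K f)))"
    proof -
      have "f \<notin> near f R \<union> {g\<in>R. card (f \<inter> g) < 2}" using f r_ge RD by (auto simp: near_def)
      moreover have "near f R \<inter> {g\<in>R. card (f \<inter> g) < 2} = {}" by (auto simp: near_def)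
      ultimately show ?thesis
        using f by (simp add: sum.union_disjoint near_sum)
    qed
    also have "(\<Sum>g | g \<in> R \<and> card (f \<inter> g) < 2. p ^ card (K g - K f)) = (\<Sum>g | g \<in> R \<and> card (f \<inter> g) < 2. q)"
    proof (intro sum.cong refl)
      fix g assume g: "g \<in> {g \<in> R. card (f \<inter> g) < 2}"
      thus "p ^ card (K g - K f) = q" using f by (simp add: card_K_Diff q_def binomial_eq_0)
    qed
    also have "\<dots> \<le> (\<Sum>g\<in>R. q)" using q_pos by (intro sum_mono2) auto
    also have "\<dots> = \<mu>" by (simp add: \<mu>_def card_R)
    finally show ?thesis using q_pos by (simp add: sum_distrib_left[symmetric] add.assoc)
  qed
  have "ex (\<lambda>w. (real (card (cl w)))\<^sup>2) = (\<Sum>f\<in>R. \<Sum>g\<in>R. prb (\<lambda>w. f \<in> cl w \<and> g \<in> cl w))"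
    unfolding pr_def power2_eq_square
    by (subst (1 2) real_card_sum[OF cl_sub]) (simp only: expec_sum sum_product of_bool_conj)
  also have "\<dots> = (\<Sum>f\<in>R. \<Sum>g\<in>R. q * p ^ card (K g - K f))"
    by (intro sum.cong refl pr_pair)
  also have "\<dots> \<le> (\<Sum>f\<in>R. q * (1 + d2 + \<mu>))" by (intro sum_mono row)
  also have "\<dots> = \<mu> + \<mu> * d2 + \<mu>\<^sup>2"
    by (simp add: card_R \<mu>_def power2_eq_square algebra_simps)
  finally have sq: "ex (\<lambda>w. (real (card (cl w)))\<^sup>2) \<le> \<mu> + \<mu> * d2 + \<mu>\<^sup>2" .
  have "ex (\<lambda>w. (real (card (cl w)) - \<mu>)\<^sup>2)
    = ex (\<lambda>w. (real (card (cl w)))\<^sup>2 - 2 * \<mu> * real (card (cl w)) + \<mu>\<^sup>2)"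
    by (simp add: power2_diff algebra_simps)
  also have "\<dots> = ex (\<lambda>w. (real (card (cl w)))\<^sup>2) - 2 * \<mu> * \<mu> + \<mu>\<^sup>2"
    unfolding expec_add expec_diff expec_cmult mean by (simp add: expec_const)
  also have "\<dots> \<le> \<mu> + \<mu> * d2" using sq by (simp add: power2_eq_square)
  finally show ?thesis .
qed

definition pairs :: "nat set set \<Rightarrow> nat" where "pairs F = (\<Sum>f\<in>F. card (near f F))"

lemma expec_pairs: "ex (\<lambda>w. real (pairs (cl w))) = \<mu> * d2"
proof -
  have "real (pairs F) = (\<Sum>f\<in>R. \<Sum>g\<in>near f R. of_bool (f \<in> F \<and> g \<in> F))" if "F \<subseteq> R" for F
  proof -
    have "(\<Sum>f\<in>R. \<Sum>g\<in>near f R. of_bool (f \<in> F \<and> g \<in> F)) = (\<Sum>f\<in>F. \<Sum>g\<in>near f R. of_bool (f \<in> F \<and> g \<in> F) :: real)"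
      using that by (intro sum.mono_neutral_right ballI sum.neutral) auto
    also have "\<dots> = (\<Sum>f\<in>F. \<Sum>g\<in>near f F. 1)"
      using that by (intro sum.cong refl sum.mono_neutral_cong_right) (auto simp: near_def)
    finally show ?thesis by (simp add: pairs_def)
  qed
  hence "ex (\<lambda>w. real (pairs (cl w))) = (\<Sum>f\<in>R. \<Sum>g\<in>near f R. prb (\<lambda>w. f \<in> cl w \<and> g \<in> cl w))"
    using cl_sub by (simp only: expec_sum pr_def)
  also have "\<dots> = (\<Sum>f\<in>R. \<Sum>g\<in>near f R. q * p ^ card (K g - K f))"
    by (intro sum.cong refl pr_pair) (auto simp: near_def)
  also have "\<dots> = \<mu> * d2"
    by (simp add: sum_distrib_left[symmetric] near_sum card_R \<mu>_def)
  finally show ?thesis .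
qed

end

section \<open>The core of the clique hypergraph\<close>

text \<open>Subsets with j elements contribute at most u^j / j! when u is the total weight, so this
  is a tail of the exponential series. The induction on \<open>A\<close> avoids factorials: a set
  containing \<open>a\<close> has \<open>k - 1\<close> further elements to find.\<close>

lemma sum_prod_card_ge:
  fixes y :: "'b \<Rightarrow> real"
  assumes "finite A" "\<And>a. a \<in> A \<Longrightarrow> 0 \<le> y a"
  shows "(\<Sum>J | J \<subseteq> A \<and> k \<le> card J. \<Prod>h\<in>J. y h) \<le> (\<Sum>a\<in>A. y a) ^ k * exp (\<Sum>a\<in>A. y a)"
  using assms
proof (induction A arbitrary: k rule: finite_induct)
  case empty
  have "{J :: 'b set. J \<subseteq> {} \<and> k \<le> card J} = (if k = 0 then {{}} else {})"
    by (auto simp: subset_empty)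
  thus ?case by (simp only:) simp
next
  case (insert a A)
  define u where "u = (\<Sum>b\<in>A. y b)"
  have u: "0 \<le> u" unfolding u_def using insert.prems by (intro sum_nonneg) auto
  have ya: "0 \<le> y a" using insert.prems by auto
  have ih: "(\<Sum>J | J \<subseteq> A \<and> k \<le> card J. \<Prod>h\<in>J. y h) \<le> u ^ k * exp u" for k
    unfolding u_def using insert.prems by (intro insert.IH) auto
  have inj: "inj_on (insert a) {J. J \<subseteq> A \<and> k - 1 \<le> card J}"
    using insert.hyps by (auto simp: inj_on_def)
  have card: "card (insert a J) = Suc (card J)" if "J \<subseteq> A" for J
    using that insert.hyps finite_subset[OF that] by (subst card_insert_disjoint) auto
  have eq: "{J. J \<subseteq> insert a A \<and> k \<le> card J}
    = {J. J \<subseteq> A \<and> k \<le> card J} \<union> insert a ` {J. J \<subseteq> A \<and> k - 1 \<le> card J}" (is "?L = ?X \<union> ?Y")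
  proof (intro equalityI subsetI)
    fix J assume J: "J \<in> ?L"
    show "J \<in> ?X \<union> ?Y"
    proof (cases "a \<in> J")
      case True
      hence "J = insert a (J - {a})" "J - {a} \<subseteq> A" using J by auto
      thus ?thesis using J card[of "J - {a}"] by (intro UnI2 image_eqI[of _ _ "J - {a}"]) auto
    next
      case False
      thus ?thesis using J by auto
    qed
  next
    fix J assume "J \<in> ?X \<union> ?Y"
    thus "J \<in> ?L" using card by auto
  qed
  have disj: "?X \<inter> ?Y = {}" using insert.hyps by auto
  have fin: "finite ?X" "finite ?Y" using insert.hyps by auto
  have "(\<Sum>J\<in>?L. \<Prod>h\<in>J. y h) = (\<Sum>J\<in>?X. \<Prod>h\<in>J. y h) + (\<Sum>J\<in>?Y. \<Prod>h\<in>J. y h)"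
    unfolding eq using fin disj by (rule sum.union_disjoint)
  also have "(\<Sum>J\<in>?Y. \<Prod>h\<in>J. y h) = (\<Sum>J | J \<subseteq> A \<and> k - 1 \<le> card J. y a * (\<Prod>h\<in>J. y h))"
    unfolding sum.reindex[OF inj] comp_def
  proof (intro sum.cong refl)
    fix J assume "J \<in> {J. J \<subseteq> A \<and> k - 1 \<le> card J}"
    hence "finite J" "a \<notin> J" using insert.hyps finite_subset by auto
    thus "(\<Prod>h\<in>insert a J. y h) = y a * (\<Prod>h\<in>J. y h)" by simp
  qed
  also have "\<dots> = y a * (\<Sum>J | J \<subseteq> A \<and> k - 1 \<le> card J. \<Prod>h\<in>J. y h)"
    by (simp add: sum_distrib_left)
  also have "(\<Sum>J\<in>?X. \<Prod>h\<in>J. y h) + y a * (\<Sum>J | J \<subseteq> A \<and> k - 1 \<le> card J. \<Prod>h\<in>J. y h)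
    \<le> u ^ k * exp u + y a * (u ^ (k - 1) * exp u)"
    using ya by (intro add_mono mult_left_mono ih)
  also have "\<dots> \<le> (u + y a) ^ k * exp (u + y a)"
  proof (cases k)
    case 0
    have "exp u * (1 + y a) \<le> exp u * exp (y a)"
      using exp_ge_add_one_self[of "y a"] by (intro mult_left_mono) auto
    thus ?thesis using 0 by (simp add: exp_add algebra_simps)
  next
    case (Suc k')
    have "u ^ k * exp u + y a * (u ^ (k - 1) * exp u) = (u ^ k' * (u + y a)) * exp u"
      using Suc by (simp add: algebra_simps)
    also have "\<dots> \<le> ((u + y a) ^ k' * (u + y a)) * exp (u + y a)"
      using u ya by (intro mult_mono power_mono) auto
    finally show ?thesis using Suc by (simp add: mult.commute)
  qed
  finally show ?case using insert.hyps by (simp add: u_def add.commute)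
qed

text \<open>Expanding the product over subsets, the supersets of \<open>B\<close> carry the part in
  which every factor from \<open>B\<close> is \<open>x a\<close> instead of \<open>1 + x a\<close>;
  each such replacement keeps at least the fraction \<open>c\<close>.\<close>

lemma prod_superset_sum:
  fixes x :: "'b \<Rightarrow> real"
  assumes A: "finite A" and B: "B \<subseteq> A" and c: "0 \<le> c" "\<And>a. a \<in> A \<Longrightarrow> 0 \<le> x a \<and> c * (1 + x a) \<le> x a"
  shows "c ^ card B * (\<Prod>a\<in>A. 1 + x a) \<le> (\<Sum>J | B \<subseteq> J \<and> J \<subseteq> A. \<Prod>a\<in>J. x a)"
proof -
  have finB: "finite B" using A B finite_subset by auto
  have inj: "inj_on ((\<union>) B) (Pow (A - B))" by (auto simp: inj_on_def)
  have eq: "{J. B \<subseteq> J \<and> J \<subseteq> A} = (\<union>) B ` Pow (A - B)"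
  proof (intro equalityI subsetI)
    fix J assume "J \<in> {J. B \<subseteq> J \<and> J \<subseteq> A}"
    thus "J \<in> (\<union>) B ` Pow (A - B)" by (intro image_eqI[of _ _ "J - B"]) auto
  qed (use B in auto)
  have "c ^ card B * (\<Prod>a\<in>A. 1 + x a) = (\<Prod>a\<in>B. c * (1 + x a)) * (\<Prod>a\<in>A-B. 1 + x a)"
    using prod.subset_diff[OF B A, of "\<lambda>a. 1 + x a"] by (simp add: prod.distrib)
  also have "\<dots> \<le> (\<Prod>a\<in>B. x a) * (\<Prod>a\<in>A-B. 1 + x a)"
  proof (intro mult_right_mono prod_mono prod_nonneg)
    fix a assume "a \<in> B"
    thus "0 \<le> c * (1 + x a) \<and> c * (1 + x a) \<le> x a" using B c(1) c(2)[of a] by auto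
  next
    fix a assume "a \<in> A - B"
    thus "0 \<le> 1 + x a" using c(2)[of a] by auto
  qed
  also have "(\<Prod>a\<in>A-B. 1 + x a) = (\<Prod>a\<in>A-B. x a + 1)" by (simp add: add.commute)
  also have "\<dots> = (\<Sum>X\<in>Pow (A - B). \<Prod>a\<in>X. x a)"
    using A by (subst prod_add) auto
  also have "(\<Prod>a\<in>B. x a) * \<dots> = (\<Sum>X\<in>Pow (A - B). \<Prod>a\<in>B \<union> X. x a)"
    unfolding sum_distrib_left
  proof (intro sum.cong refl)
    fix X assume "X \<in> Pow (A - B)"
    hence "finite X" "B \<inter> X = {}" using A finite_subset[of X A] by auto
    thus "(\<Prod>a\<in>B. x a) * (\<Prod>a\<in>X. x a) = (\<Prod>a\<in>B \<union> X. x a)"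
      using finB by (simp add: prod.union_disjoint)
  qed
  also have "\<dots> = (\<Sum>J | B \<subseteq> J \<and> J \<subseteq> A. \<Prod>a\<in>J. x a)"
    unfolding eq sum.reindex[OF inj] by simp
  finally show ?thesis .
qed

context clique_model
begin

text \<open>
  Hyperedges of the core have at most one edge in common with all the others together. Hence any set \<open>J\<close>
  of core hyperedges is present with probability at most \<open>(q / p) ^ card J\<close>, as if they were nearly
  independent.
\<close>

definition core :: "nat set set \<Rightarrow> nat set set" where
  "core F = {h\<in>F. card (K h \<inter> U (F - {h})) \<le> 1}"

lemma core_sub: "core F \<subseteq> F" by (auto simp: core_def)

text \<open>Private edge sets of different hyperedges are disjoint, so adding up their sizes bounds
  the number of edges of a subfamily from below.\<close>

definition priv :: "nat set set \<Rightarrow> nat set \<Rightarrow> nat set set" where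
  "priv F h = K h - U (F - {h})"

lemma card_priv_sum:
  assumes F: "F \<subseteq> R" and J: "J \<subseteq> F"
  shows "(\<Sum>h\<in>J. card (priv F h)) \<le> card (U J)"
proof -
  have finJ: "finite J" using F J finite_subset fin_R by (meson order_trans)
  have "(\<Sum>h\<in>J. card (priv F h)) = card (\<Union>h\<in>J. priv F h)"
  proof (rule card_UN_disjoint[symmetric])
    show "\<forall>h\<in>J. finite (priv F h)" using F J RD(2) by (auto simp: priv_def subset_iff)
    show "\<forall>h\<in>J. \<forall>h'\<in>J. h \<noteq> h' \<longrightarrow> priv F h \<inter> priv F h' = {}"
      using J by (auto simp: priv_def U_def)
  qed (rule finJ)
  also have "\<dots> \<le> card (U J)"
    using F J by (intro card_mono finite_U) (auto simp: priv_def U_def)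
  finally show ?thesis .
qed

lemma card_priv:
  assumes "F \<subseteq> R" "h \<in> F"
  shows "card (priv F h) = (r choose 2) - card (K h \<inter> U (F - {h}))"
  unfolding priv_def using assms RD(2)[of h] by (subst card_Diff_subset_Int) (auto simp: card_K)

lemma card_U_sub_core:
  assumes F: "F \<subseteq> R" and J: "J \<subseteq> core F"
  shows "card J * ((r choose 2) - 1) \<le> card (U J)"
proof -
  have "card J * ((r choose 2) - 1) = (\<Sum>h\<in>J. (r choose 2) - 1)" by simp
  also have "\<dots> \<le> (\<Sum>h\<in>J. card (priv F h))"
  proof (rule sum_mono)
    fix h assume "h \<in> J"
    thus "(r choose 2) - 1 \<le> card (priv F h)"
      using F J by (subst card_priv) (auto simp: core_def)
  qed
  also have "\<dots> \<le> card (U J)" using F J core_sub by (intro card_priv_sum) auto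
  finally show ?thesis .
qed

lemma card_U_le:
  assumes "F \<subseteq> R" shows "card (U F) \<le> (r choose 2) * card F"
proof -
  have "card (U F) \<le> (\<Sum>h\<in>F. card (K h))"
    unfolding U_def using assms finite_subset by (intro card_UN_le) auto
  also have "\<dots> = (\<Sum>h\<in>F. r choose 2)" using assms by (intro sum.cong) (auto simp: card_K)
  finally show ?thesis by (simp add: mult.commute)
qed

lemma edge_card_Int:
  assumes "e \<in> K f" "e \<in> K g" "finite f"
  shows "e \<subseteq> f \<inter> g" "card e = 2" "2 \<le> card (f \<inter> g)" "card (f \<inter> g) = 2 \<Longrightarrow> e = f \<inter> g"
proof -
  show e: "e \<subseteq> f \<inter> g" "card e = 2" using assms by (auto simp: K_def nsets_def)
  show "2 \<le> card (f \<inter> g)" using card_mono[OF _ e(1)] e(2) assms(3) by auto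
  show "card (f \<inter> g) = 2 \<Longrightarrow> e = f \<inter> g" using e assms(3) by (intro card_subset_eq) auto
qed

lemma mem_near: "f \<in> R \<Longrightarrow> g \<in> F \<Longrightarrow> g \<noteq> f \<Longrightarrow> e \<in> K f \<Longrightarrow> e \<in> K g \<Longrightarrow> g \<in> near f F"
  using edge_card_Int(3)[of e f g] RD(2)[of f] by (auto simp: near_def)

text \<open>A core hyperedge has at most one edge that is not private, and then some hyperedge is
  near it; so \<open>pairs F\<close> bounds the total loss.\<close>

lemma card_U_core_ge:
  assumes F: "F \<subseteq> R"
  shows "(r choose 2) * card (core F) \<le> card (U (core F)) + pairs F"
proof -
  have finF: "finite F" using F finite_subset by auto
  have "(r choose 2) * card (core F) = (\<Sum>h\<in>core F. r choose 2)" by simp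
  also have "\<dots> \<le> (\<Sum>h\<in>core F. card (priv F h) + card (near h F))"
  proof (rule sum_mono)
    fix h assume h: "h \<in> core F"
    hence hF: "h \<in> F" "card (K h \<inter> U (F - {h})) \<le> 1" by (auto simp: core_def)
    have "card (K h \<inter> U (F - {h})) \<le> card (near h F)"
    proof (cases "K h \<inter> U (F - {h}) = {}")
      case False
      then obtain e g where "e \<in> K h" "e \<in> K g" "g \<in> F" "g \<noteq> h" by (auto simp: U_def)
      hence "g \<in> near h F" using mem_near hF F by blast
      hence "card (near h F) \<noteq> 0" using finite_near[OF F] by auto
      thus ?thesis using hF(2) by linarith
    qed simp
    thus "r choose 2 \<le> card (priv F h) + card (near h F)" using card_priv[OF F hF(1)] by linarith
  qed
  also have "\<dots> = (\<Sum>h\<in>core F. card (priv F h)) + (\<Sum>h\<in>core F. card (near h F))"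
    by (rule sum.distrib)
  also have "\<dots> \<le> card (U (core F)) + pairs F"
    unfolding pairs_def using F finF core_sub by (intro add_mono card_priv_sum sum_mono2) auto
  finally show ?thesis .
qed

text \<open>A hyperedge meeting \<open>f\<close> in only two vertices covers only one edge of
  \<open>f\<close>. So two covered edges need two such hyperedges or one larger overlap.\<close>

lemma two_edges_cases:
  assumes f: "f \<in> R" and F: "F \<subseteq> R" "f \<notin> F" and two: "2 \<le> card (K f \<inter> U F)"
  obtains (big) h where "h \<in> near f F" "3 \<le> card (f \<inter> h)"
    | (twice) h h' where "h \<in> near f F" "h' \<in> near f F" "h \<noteq> h'" "card (f \<inter> h) = 2" "card (f \<inter> h') = 2"
proof (cases "\<exists>h\<in>near f F. 3 \<le> card (f \<inter> h)")
  case True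
  thus ?thesis using big by blast
next
  case False
  obtain e e' where e: "e \<in> K f \<inter> U F" "e' \<in> K f \<inter> U F" "e \<noteq> e'"
    using two card_le_Suc0_iff_eq[of "K f \<inter> U F"] RD(2)[OF f] by force
  then obtain h h' where h: "h \<in> F" "e \<in> K h" "h' \<in> F" "e' \<in> K h'" by (auto simp: U_def)
  have near: "h \<in> near f F" "h' \<in> near f F"
    using h e F(2) f by (auto intro: mem_near)
  hence "card (f \<inter> h) = 2" "card (f \<inter> h') = 2" using False by (fastforce simp: near_def)+
  moreover have "h \<noteq> h'"
    using edge_card_Int(4)[of e f h] edge_card_Int(4)[of e' f h'] e h RD(2)[OF f] calculation by auto
  ultimately show ?thesis using near twice by blast
qed

text \<open>Reveal \<open>h\<close>, then \<open>g\<close>, then \<open>g'\<close>. In the last step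
  \<open>h\<close> fixes at most one further edge besides those fixed by \<open>g\<close>, which
  costs \<open>1 / p\<close>.\<close>

lemma pr_triple:
  assumes h: "h \<in> R" "g \<in> R" "g' \<in> R" and c: "card (h \<inter> g') = 2"
  shows "prb (\<lambda>w. {h, g, g'} \<subseteq> cl w) \<le> q * p ^ card (K g - K h) * (p ^ card (K g' - K g) / p)"
proof -
  have "card (U {h, g, g'}) = card (K h \<union> K g \<union> K g')" by (simp add: U_def Un_assoc)
  also have "\<dots> = card (K h \<union> K g) + card (K g' - (K h \<union> K g))"
    using K_sub h by (intro card_union) auto
  also have "card (K h \<union> K g) = (r choose 2) + card (K g - K h)"
    using K_sub h by (subst card_union) (auto simp: card_K)
  finally have 1: "card (U {h, g, g'}) = (r choose 2) + card (K g - K h) + card (K g' - (K h \<union> K g))" .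
  have "card (K g' - K g) \<le> card ((K g' - (K h \<union> K g)) \<union> (K h \<inter> K g'))"
    using RD(2)[OF h(3)] RD(2)[OF h(1)] by (intro card_mono) auto
  also have "\<dots> \<le> card (K g' - (K h \<union> K g)) + card (K h \<inter> K g')" by (rule card_Un_le)
  also have "card (K h \<inter> K g') = 1" using h c by (simp add: card_K_Int)
  finally have "p ^ Suc (card (K g' - (K h \<union> K g))) \<le> p ^ card (K g' - K g)"
    using p_bounds by (intro power_decreasing) auto
  hence "p ^ card (K g' - (K h \<union> K g)) \<le> p ^ card (K g' - K g) / p"
    using p_pos by (simp add: field_simps)
  hence "q * p ^ card (K g - K h) * p ^ card (K g' - (K h \<union> K g))
    \<le> q * p ^ card (K g - K h) * (p ^ card (K g' - K g) / p)"
    using q_pos p_pos by (intro mult_left_mono) auto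
  thus ?thesis using h by (subst pr_sub_cl) (auto simp: 1 power_add q_def)
qed

text \<open>Those \<open>g'\<close> not near \<open>g\<close> have conditional probability
  \<open>q\<close> given \<open>g\<close>, no more than their conditional probability given
  \<open>h\<close>. So either group is bounded by \<open>d2\<close>.\<close>

lemma near_Diff_sum:
  assumes h: "h \<in> R" and g: "g \<in> R" and A: "A \<subseteq> near h R - {g}"
  shows "(\<Sum>g'\<in>A. p ^ card (K g' - K g)) \<le> 2 * d2"
proof -
  have finA: "finite A" using A finite_near[of R h] finite_subset[of A "near h R"] by auto
  have AR: "A \<subseteq> R" using A near_sub by blast
  have "(\<Sum>g'\<in>A. p ^ card (K g' - K g)) = (\<Sum>g'\<in>A \<inter> near g R. p ^ card (K g' - K g)) + (\<Sum>g'\<in>A - near g R. p ^ card (K g' - K g))"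
    using finA by (rule sum.Int_Diff)
  also have "(\<Sum>g'\<in>A \<inter> near g R. p ^ card (K g' - K g)) \<le> (\<Sum>g'\<in>near g R. p ^ card (K g' - K g))"
    using p_bounds by (intro sum_mono2) auto
  also have "\<dots> = d2" by (rule near_sum[OF g])
  also have "(\<Sum>g'\<in>A - near g R. p ^ card (K g' - K g)) \<le> (\<Sum>g'\<in>A - near g R. p ^ card (K g' - K h))"
  proof (rule sum_mono)
    fix g' assume g': "g' \<in> A - near g R"
    hence "card (g \<inter> g') < 2" using A AR by (auto simp: near_def)
    hence "p ^ card (K g' - K g) = q" using g g' AR by (subst card_K_Diff) (auto simp: q_def binomial_eq_0)
    thus "p ^ card (K g' - K g) \<le> p ^ card (K g' - K h)"
      using power_card_le[of g' "K h"] g' AR by auto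
  qed
  also have "\<dots> \<le> (\<Sum>g'\<in>near h R. p ^ card (K g' - K h))"
    using p_bounds A by (intro sum_mono2) auto
  also have "\<dots> = d2" by (rule near_sum[OF h])
  finally show ?thesis by simp
qed

text \<open>A removed hyperedge shares two edges with the others. By \<open>two_edges_cases\<close>
  it lies in a pair with a large overlap, counted by \<open>d3\<close>, or in a triple with two
  single-edge overlaps, where \<open>d2\<close> enters twice.\<close>

lemma expec_removed: "ex (\<lambda>w. real (card (cl w - core (cl w)))) \<le> \<mu> * (d3 + 2 * d2\<^sup>2 / p)"
proof -
  define N3 N2 where "N3 h = {g. g \<in> near h R \<and> 3 \<le> card (h \<inter> g)}"
    and "N2 h = {g. g \<in> near h R \<and> card (h \<inter> g) = 2}" for h
  have fin: "finite (N3 h)" "finite (N2 h)" for h by (auto simp: N3_def N2_def)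
  have pt: "real (card (F - core F)) \<le> (\<Sum>h\<in>R. (\<Sum>g\<in>N3 h. of_bool ({h, g} \<subseteq> F))
      + (\<Sum>g\<in>N2 h. \<Sum>g'\<in>N2 h - {g}. of_bool ({h, g, g'} \<subseteq> F)))" if F: "F \<subseteq> R" for F
  proof -
    have "real (card (F - core F)) = (\<Sum>h\<in>R. of_bool (h \<in> F - core F))"
      using F by (intro real_card_sum) auto
    also have "\<dots> \<le> (\<Sum>h\<in>R. (\<Sum>g\<in>N3 h. of_bool ({h, g} \<subseteq> F))
      + (\<Sum>g\<in>N2 h. \<Sum>g'\<in>N2 h - {g}. of_bool ({h, g, g'} \<subseteq> F)))"
    proof (rule sum_mono)
      fix h assume h: "h \<in> R"
      let ?A = "\<Sum>g\<in>N3 h. of_bool ({h, g} \<subseteq> F) :: real"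
      let ?C = "\<lambda>g. \<Sum>g'\<in>N2 h - {g}. of_bool ({h, g, g'} \<subseteq> F) :: real"
      have nn: "0 \<le> ?A" "0 \<le> ?C g" "0 \<le> (\<Sum>g\<in>N2 h. ?C g)" for g by (intro sum_nonneg; simp)+
      show "of_bool (h \<in> F - core F) \<le> ?A + (\<Sum>g\<in>N2 h. ?C g)"
      proof (cases "h \<in> F - core F")
        case True
        hence twice: "2 \<le> card (K h \<inter> U (F - {h}))" by (auto simp: core_def)
        have others: "F - {h} \<subseteq> R" "h \<notin> F - {h}" using F by auto
        show ?thesis
        proof (rule two_edges_cases[OF h others twice])
          fix g assume "g \<in> near h (F - {h})" "3 \<le> card (h \<inter> g)"
          hence g: "g \<in> N3 h" "g \<in> F" using F by (auto simp: near_def N3_def)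
          have "(of_bool ({h, g} \<subseteq> F) :: real) \<le> ?A"
            using g fin by (intro member_le_sum) auto
          thus ?thesis using g True nn(3) by simp
        next
          fix g g'
          assume "g \<in> near h (F - {h})" "g' \<in> near h (F - {h})" "g \<noteq> g'" "card (h \<inter> g) = 2" "card (h \<inter> g') = 2"
          hence g: "g \<in> N2 h" "g \<in> F" "g' \<in> N2 h" "g' \<in> F" "g' \<noteq> g"
            using F by (auto simp: near_def N2_def)
          have "(of_bool ({h, g, g'} \<subseteq> F) :: real) \<le> ?C g"
            using g fin by (intro member_le_sum) auto
          also have "\<dots> \<le> (\<Sum>g\<in>N2 h. ?C g)"
            using g fin nn by (intro member_le_sum) auto
          finally show ?thesis using g True nn(1) by simp
        qed
      next
        case False
        hence "of_bool (h \<in> F - core F) = (0::real)" by simp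
        thus ?thesis using nn(1,3) by linarith
      qed
    qed
    finally show ?thesis .
  qed
  have "ex (\<lambda>w. real (card (cl w - core (cl w)))) \<le> ex (\<lambda>w. \<Sum>h\<in>R. (\<Sum>g\<in>N3 h. of_bool ({h, g} \<subseteq> cl w))
      + (\<Sum>g\<in>N2 h. \<Sum>g'\<in>N2 h - {g}. of_bool ({h, g, g'} \<subseteq> cl w)))"
    using p_bounds by (intro expec_mono pt cl_sub)
  also have "\<dots> = (\<Sum>h\<in>R. (\<Sum>g\<in>N3 h. prb (\<lambda>w. {h, g} \<subseteq> cl w))
      + (\<Sum>g\<in>N2 h. \<Sum>g'\<in>N2 h - {g}. prb (\<lambda>w. {h, g, g'} \<subseteq> cl w)))"
    unfolding pr_def expec_sum expec_add ..
  also have "\<dots> \<le> (\<Sum>h\<in>R. (\<Sum>g\<in>N3 h. q * p ^ card (K g - K h))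
      + (\<Sum>g\<in>N2 h. \<Sum>g'\<in>N2 h - {g}. q * p ^ card (K g - K h) * (p ^ card (K g' - K g) / p)))"
    by (intro sum_mono add_mono pr_triple)
      (auto simp: N3_def N2_def near_def pr_pair)
  also have "\<dots> \<le> (\<Sum>h\<in>R. q * d3 + q * d2 * (2 * d2 / p))"
  proof (intro sum_mono add_mono)
    fix h assume h: "h \<in> R"
    show "(\<Sum>g\<in>N3 h. q * p ^ card (K g - K h)) \<le> q * d3"
      using near3_sum[OF h] by (simp add: N3_def sum_distrib_left[symmetric])
    have "(\<Sum>g\<in>N2 h. \<Sum>g'\<in>N2 h - {g}. q * p ^ card (K g - K h) * (p ^ card (K g' - K g) / p))
      \<le> (\<Sum>g\<in>N2 h. q * p ^ card (K g - K h) * (2 * d2 / p))"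
    proof (rule sum_mono)
      fix g assume g: "g \<in> N2 h"
      have "(\<Sum>g'\<in>N2 h - {g}. p ^ card (K g' - K g)) \<le> 2 * d2"
        using g by (intro near_Diff_sum[OF h]) (auto simp: N2_def near_def)
      hence "q * p ^ card (K g - K h) * ((\<Sum>g'\<in>N2 h - {g}. p ^ card (K g' - K g)) / p)
        \<le> q * p ^ card (K g - K h) * (2 * d2 / p)"
        using q_pos p_pos by (intro mult_left_mono divide_right_mono) auto
      thus "(\<Sum>g'\<in>N2 h - {g}. q * p ^ card (K g - K h) * (p ^ card (K g' - K g) / p))
        \<le> q * p ^ card (K g - K h) * (2 * d2 / p)"
        by (simp only: sum_distrib_left sum_divide_distrib)
    qed
    also have "\<dots> = q * (2 * d2 / p) * (\<Sum>g\<in>N2 h. p ^ card (K g - K h))"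
      by (simp add: sum_distrib_left sum_divide_distrib mult_ac)
    also have "\<dots> \<le> q * (2 * d2 / p) * (\<Sum>g\<in>near h R. p ^ card (K g - K h))"
      using q_pos p_pos d2_nonneg by (intro mult_left_mono sum_mono2) (auto simp: N2_def)
    also have "\<dots> = q * d2 * (2 * d2 / p)" using near_sum[OF h] by simp
    finally show "(\<Sum>g\<in>N2 h. \<Sum>g'\<in>N2 h - {g}. q * p ^ card (K g - K h) * (p ^ card (K g' - K g) / p))
      \<le> q * d2 * (2 * d2 / p)" .
  qed
  also have "\<dots> = \<mu> * (d3 + 2 * d2\<^sup>2 / p)"
    by (simp add: card_R \<mu>_def power2_eq_square algebra_simps)
  finally show ?thesis .
qed

section \<open>Vertex sets overlapping the core in several edges\<close>

definition m :: "nat set \<Rightarrow> nat set set \<Rightarrow> nat" where "m f M = card (K f \<inter> M)"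

text \<open>The conditional probability of \<open>h\<close> given \<open>f\<close>, with the factor
  \<open>1 / p\<close> that \<open>expec_sub_core\<close> loses for each core hyperedge.\<close>

definition y :: "nat set \<Rightarrow> nat set \<Rightarrow> real" where "y f h = p ^ card (K h - K f) / p"

lemma y_nonneg: "0 \<le> y f h" using p_pos by (simp add: y_def)

lemma y_sum: "f \<in> R \<Longrightarrow> (\<Sum>h\<in>near f R. y f h) = d2 / p"
  by (simp add: y_def sum_divide_distrib[symmetric] near_sum)

text \<open>Counting an edge once for every hyperedge that covers it only enlarges the exponent, and
  makes the bound a product.\<close>

lemma inverse_power_m_le:
  assumes f: "f \<in> R" and F: "F \<subseteq> R" "f \<notin> F"
  shows "1 / p ^ m f (U F) \<le> (\<Prod>h\<in>near f F. 1 / p ^ card (K h \<inter> K f))"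
proof -
  have "K f \<inter> U F \<subseteq> (\<Union>h\<in>near f F. K h \<inter> K f)"
  proof
    fix e assume e: "e \<in> K f \<inter> U F"
    then obtain h where h: "h \<in> F" "e \<in> K h" by (auto simp: U_def)
    hence "h \<in> near f F" using mem_near[OF f, of h F e] e F by auto
    thus "e \<in> (\<Union>h\<in>near f F. K h \<inter> K f)" using h e by auto
  qed
  hence "m f (U F) \<le> card (\<Union>h\<in>near f F. K h \<inter> K f)"
    unfolding m_def using F(1) RD(2)[OF f] by (intro card_mono) auto
  also have "\<dots> \<le> (\<Sum>h\<in>near f F. card (K h \<inter> K f))"
    using F(1) by (intro card_UN_le) auto
  finally have "p ^ (\<Sum>h\<in>near f F. card (K h \<inter> K f)) \<le> p ^ m f (U F)"
    using p_bounds by (intro power_decreasing) auto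
  hence "1 / p ^ m f (U F) \<le> 1 / p ^ (\<Sum>h\<in>near f F. card (K h \<inter> K f))"
    using p_pos by (intro divide_left_mono) auto
  also have "\<dots> = (\<Prod>h\<in>near f F. 1 / p ^ card (K h \<inter> K f))"
    by (simp add: power_sum prod_dividef)
  finally show ?thesis .
qed

text \<open>
  Writing each factor of the previous bound as \<open>1 + x\<close> turns the product into a sum over subsets of the
  core, whose expectation the independence of the core controls.
\<close>

lemma inverse_power_m_le_sum:
  assumes f: "f \<in> R" and F: "F \<subseteq> R" "f \<notin> F" and B: "B \<subseteq> near f F"
  shows "(1 - p) ^ card B * (1 / p ^ m f (U F))
    \<le> (\<Sum>J | B \<subseteq> J \<and> J \<subseteq> near f F. \<Prod>h\<in>J. 1 / p ^ card (K h \<inter> K f) - 1)"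
proof -
  let ?x = "\<lambda>h. 1 / p ^ card (K h \<inter> K f) - 1"
  have "(1 - p) ^ card B * (1 / p ^ m f (U F)) \<le> (1 - p) ^ card B * (\<Prod>h\<in>near f F. 1 + ?x h)"
    using inverse_power_m_le[OF f F] p_bounds by (intro mult_left_mono) auto
  also have "\<dots> \<le> (\<Sum>J | B \<subseteq> J \<and> J \<subseteq> near f F. \<Prod>h\<in>J. ?x h)"
  proof (rule prod_superset_sum)
    fix h assume h: "h \<in> near f F"
    hence hR: "h \<in> R" and c2: "2 \<le> card (h \<inter> f)" using F by (auto simp: near_def Int_commute)
    \<comment> \<open>With a common edge, \<open>x / (1 + x)\<close> is 1 minus a positive power of
      \<open>p\<close>, hence at least \<open>1 - p\<close>.\<close>
    have "1 \<le> card (K h \<inter> K f)"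
      using c2 by (simp add: card_K_Int[OF hR] Suc_leI zero_less_binomial_iff)
    hence le: "p ^ card (K h \<inter> K f) \<le> p ^ 1" using p_bounds by (intro power_decreasing) auto
    have pos: "0 < p ^ card (K h \<inter> K f)" using p_pos by simp
    show "0 \<le> ?x h \<and> (1 - p) * (1 + ?x h) \<le> ?x h"
      using le pos p_lt_1 by (simp add: field_simps)
  qed (use B F p_bounds in auto)
  finally show ?thesis .
qed

text \<open>That \<open>U J\<close> has almost \<open>card J * (r choose 2)\<close> edges depends on
  \<open>J\<close> alone, so one \<open>w\<close> with \<open>J\<close> in its core proves it;
  without such a \<open>w\<close> the probability is 0.\<close>

lemma expec_sub_core:
  assumes J: "J \<subseteq> R"
  shows "prb (\<lambda>w. J \<subseteq> core (cl w)) \<le> (q / p) ^ card J"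
proof (cases "\<exists>w. J \<subseteq> core (cl w)")
  case False
  thus ?thesis using q_pos p_pos by (simp add: pr_def expec_const)
next
  case True
  then obtain w where "J \<subseteq> core (cl w)" by auto
  hence le: "card J * ((r choose 2) - 1) \<le> card (U J)" by (rule card_U_sub_core[OF cl_sub])
  have "1 \<le> r choose 2" using r_ge by (simp add: Suc_leI zero_less_binomial_iff)
  hence qp: "p ^ ((r choose 2) - 1) = q / p" using p_pos by (simp add: q_def power_diff)
  have "prb (\<lambda>w. J \<subseteq> core (cl w)) \<le> prb (\<lambda>w. J \<subseteq> cl w)"
    using core_sub by (intro pr_mono) blast
  also have "\<dots> = p ^ card (U J)" by (rule pr_sub_cl[OF J])
  also have "\<dots> \<le> p ^ (card J * ((r choose 2) - 1))" using le p_bounds by (intro power_decreasing) auto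
  also have "\<dots> = (q / p) ^ card J" by (simp only: qp[symmetric] power_mult[symmetric] mult.commute)
  finally show ?thesis .
qed

text \<open>A first-moment scheme. Whenever \<open>f\<close> is selected, at most \<open>k\<close>
  core hyperedges witness this; expanding only over families \<open>J\<close> that contain the
  witness costs \<open>(1 - p) ^ k\<close> and leaves good \<open>J\<close> only. The expected
  contribution of \<open>J\<close> is then at most the product of its weights
  \<open>y\<close>.\<close>

lemma expec_selected:
  assumes f: "f \<in> R"
    and sel: "\<And>F. F \<subseteq> R \<Longrightarrow> f \<notin> core F \<Longrightarrow> sel F \<Longrightarrow>
      \<exists>B. B \<subseteq> near f (core F) \<and> card B \<le> k \<and> (\<forall>J. B \<subseteq> J \<longrightarrow> J \<subseteq> near f R \<longrightarrow> Good J)"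
  shows "ex (\<lambda>w. of_bool (f \<notin> core (cl w) \<and> sel (cl w)) * (q / p ^ m f (U (core (cl w)))))
    \<le> q / (1 - p) ^ k * (\<Sum>J | J \<subseteq> near f R \<and> Good J. \<Prod>h\<in>J. y f h)"
proof -
  let ?x = "\<lambda>h. 1 / p ^ card (K h \<inter> K f) - 1"
  let ?J = "{J. J \<subseteq> near f R \<and> Good J}"
  have x0: "0 \<le> ?x h" for h using p_pos p_bounds by (simp add: power_le_one)
  have finJ: "finite ?J" using finite_near[of R f] by auto
  have q1: "0 < (1 - p) ^ k" using p_lt_1 by simp
  have pt: "of_bool (f \<notin> core F \<and> sel F) * (q / p ^ m f (U (core F)))
    \<le> q / (1 - p) ^ k * (\<Sum>J\<in>?J. of_bool (J \<subseteq> core F) * (\<Prod>h\<in>J. ?x h))" if F: "F \<subseteq> R" for F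
  proof (cases "f \<notin> core F \<and> sel F")
    case False
    have "0 \<le> (\<Sum>J\<in>?J. of_bool (J \<subseteq> core F) * (\<Prod>h\<in>J. ?x h))"
      using x0 by (intro sum_nonneg mult_nonneg_nonneg prod_nonneg) auto
    thus ?thesis using False q_pos q1 by auto
  next
    case True
    then obtain B where B: "B \<subseteq> near f (core F)" "card B \<le> k" "\<And>J. B \<subseteq> J \<Longrightarrow> J \<subseteq> near f R \<Longrightarrow> Good J"
      using sel[OF F] by blast
    have cR: "core F \<subseteq> R" using F core_sub by blast
    have nn: "near f (core F) \<subseteq> near f R" using cR by (auto simp: near_def)
    have "(1 - p) ^ k * (1 / p ^ m f (U (core F))) \<le> (1 - p) ^ card B * (1 / p ^ m f (U (core F)))"
      using B p_bounds p_pos by (intro mult_right_mono power_decreasing) auto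
    also have "\<dots> \<le> (\<Sum>J | B \<subseteq> J \<and> J \<subseteq> near f (core F). \<Prod>h\<in>J. ?x h)"
      using True by (intro inverse_power_m_le_sum f cR B(1)) auto
    also have "\<dots> = (\<Sum>J | B \<subseteq> J \<and> J \<subseteq> near f (core F). of_bool (J \<subseteq> core F) * (\<Prod>h\<in>J. ?x h))"
    proof (intro sum.cong refl)
      fix J assume "J \<in> {J. B \<subseteq> J \<and> J \<subseteq> near f (core F)}"
      hence "J \<subseteq> core F" by (auto simp: near_def)
      thus "(\<Prod>h\<in>J. ?x h) = of_bool (J \<subseteq> core F) * (\<Prod>h\<in>J. ?x h)" by simp
    qed
    also have "\<dots> \<le> (\<Sum>J\<in>?J. of_bool (J \<subseteq> core F) * (\<Prod>h\<in>J. ?x h))"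
      using finJ B(3) nn x0 by (intro sum_mono2 mult_nonneg_nonneg prod_nonneg) auto
    finally have "q * ((1 - p) ^ k * (1 / p ^ m f (U (core F))))
      \<le> q * (\<Sum>J\<in>?J. of_bool (J \<subseteq> core F) * (\<Prod>h\<in>J. ?x h))"
      using q_pos by (intro mult_left_mono) auto
    thus ?thesis using q1 True by (simp add: field_simps)
  qed
  have "ex (\<lambda>w. of_bool (f \<notin> core (cl w) \<and> sel (cl w)) * (q / p ^ m f (U (core (cl w)))))
    \<le> ex (\<lambda>w. q / (1 - p) ^ k * (\<Sum>J\<in>?J. (\<Prod>h\<in>J. ?x h) * of_bool (J \<subseteq> core (cl w))))"
    using p_bounds pt[OF cl_sub] by (intro expec_mono) (simp_all add: mult.commute)
  also have "\<dots> = q / (1 - p) ^ k * (\<Sum>J\<in>?J. (\<Prod>h\<in>J. ?x h) * prb (\<lambda>w. J \<subseteq> core (cl w)))"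
    unfolding pr_def expec_cmult expec_sum ..
  also have "\<dots> \<le> q / (1 - p) ^ k * (\<Sum>J\<in>?J. \<Prod>h\<in>J. y f h)"
  proof (intro mult_left_mono sum_mono)
    fix J assume J: "J \<in> ?J"
    hence JR: "J \<subseteq> R" and finite_J: "finite J"
      using near_sub[of f R] finite_near[of R f] finite_subset[of J "near f R"] by auto
    have "(\<Prod>h\<in>J. ?x h) * prb (\<lambda>w. J \<subseteq> core (cl w)) \<le> (\<Prod>h\<in>J. ?x h) * (q / p) ^ card J"
      using x0 by (intro mult_left_mono expec_sub_core JR prod_nonneg) auto
    also have "(\<Prod>h\<in>J. ?x h) * (q / p) ^ card J = (\<Prod>h\<in>J. ?x h) * (\<Prod>h\<in>J. q / p)"
      unfolding prod_constant ..
    also have "\<dots> = (\<Prod>h\<in>J. ?x h * (q / p))" by (rule prod.distrib[symmetric])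
    also have "\<dots> \<le> (\<Prod>h\<in>J. y f h)"
    proof (intro prod_mono conjI mult_nonneg_nonneg x0)
      fix h assume "h \<in> J"
      hence h: "h \<in> R" using JR by auto
      have c: "card (K h \<inter> K f) \<le> r choose 2"
        unfolding card_K[OF h, symmetric] using RD(2)[OF h] by (intro card_mono) auto
      have "card (K h - K f) = (r choose 2) - card (K h \<inter> K f)"
        using RD(2)[OF h] card_K[OF h] by (simp add: card_Diff_subset_Int)
      hence "y f h = q / p ^ card (K h \<inter> K f) / p"
        using c p_pos by (simp add: y_def q_def power_diff)
      also have "\<dots> \<ge> ?x h * (q / p)" using q_pos p_pos by (simp add: field_simps)
      finally show "?x h * (q / p) \<le> y f h" .
    qed (use q_pos p_pos in auto)
    finally show "(\<Prod>h\<in>J. ?x h) * prb (\<lambda>w. J \<subseteq> core (cl w)) \<le> (\<Prod>h\<in>J. y f h)" .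
  qed (use q_pos q1 in auto)
  finally show ?thesis .
qed

text \<open>The conditional expected number of cliques, given the edges of \<open>F\<close>, among
  the sets to which the Janson bounds are not applied.\<close>

definition bad_sum :: "nat set set \<Rightarrow> real" where
  "bad_sum F = (\<Sum>f | f \<in> R - F \<and> 2 \<le> m f (U F). q / p ^ m f (U F))"

text \<open>Sets forced to be cliques by the edges of \<open>F\<close>. If there is one,
  \<open>F\<close> has probability 0 of being the clique hypergraph.\<close>

definition covered :: "nat set set \<Rightarrow> nat set set" where
  "covered F = {f\<in>R - F. K f \<subseteq> U F}"

lemma exp_u_le: "0 \<le> u \<Longrightarrow> u \<le> 1 \<Longrightarrow> u ^ k * exp u \<le> 3 * u ^ k" for u :: real
proof -
  assume u: "0 \<le> u" "u \<le> 1"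
  hence "exp u \<le> exp 1" by simp
  hence "exp u \<le> 3" using exp_le by linarith
  thus ?thesis using mult_left_mono[of "exp u" 3 "u ^ k"] u by simp
qed

text \<open>The witness is one core hyperedge sharing three vertices with \<open>f\<close>, or two
  near ones. Accordingly the good families are singletons, which add up to \<open>d3 / p\<close>, or
  have at least two members and fall under \<open>sum_prod_card_ge\<close>.\<close>

lemma expec_bad_sum:
  assumes u: "d2 / p \<le> 1"
  shows "ex (\<lambda>w. bad_sum (core (cl w))) \<le> \<mu> / (1 - p)\<^sup>2 * (d3 / p + 3 * (d2 / p)\<^sup>2)"
proof -
  define Good where "Good f J \<longleftrightarrow> 2 \<le> card J \<or> (\<exists>h\<in>J. 3 \<le> card (f \<inter> h))" for f and J :: "nat set set"
  have u0: "0 \<le> d2 / p" using d2_nonneg p_pos by simp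
  have eq: "bad_sum F = (\<Sum>f\<in>R. of_bool (f \<notin> F \<and> 2 \<le> m f (U F)) * (q / p ^ m f (U F)))" for F
  proof -
    have "{f. f \<in> R - F \<and> 2 \<le> m f (U F)} = {f\<in>R. f \<notin> F \<and> 2 \<le> m f (U F)}" by blast
    thus ?thesis unfolding bad_sum_def by (simp only: sum.inter_filter[OF fin_R]) (intro sum.cong, auto)
  qed
  have good_sum: "(\<Sum>J | J \<subseteq> near f R \<and> Good f J. \<Prod>h\<in>J. y f h) \<le> d3 / p + 3 * (d2 / p)\<^sup>2"
    if f: "f \<in> R" for f
  proof -
    let ?X = "{J. J \<subseteq> near f R \<and> 2 \<le> card J}" and ?N = "{h. h \<in> near f R \<and> 3 \<le> card (f \<inter> h)}"
    have fin: "finite (near f R)" by simp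
    have sub: "{J. J \<subseteq> near f R \<and> Good f J} \<subseteq> ?X \<union> (\<lambda>h. {h}) ` ?N"
    proof
      fix J assume J: "J \<in> {J. J \<subseteq> near f R \<and> Good f J}"
      show "J \<in> ?X \<union> (\<lambda>h. {h}) ` ?N"
      proof (cases "2 \<le> card J")
        case False
        then obtain h where h: "h \<in> J" "3 \<le> card (f \<inter> h)" using J by (auto simp: Good_def)
        have "finite J" using J finite_subset[of J "near f R"] by simp
        hence "J = {h}" using False h(1) card_le_Suc0_iff_eq[of J] by auto
        thus ?thesis using h J by auto
      qed (use J in auto)
    qed
    have "(\<Sum>J | J \<subseteq> near f R \<and> Good f J. \<Prod>h\<in>J. y f h) \<le> (\<Sum>J\<in>?X \<union> (\<lambda>h. {h}) ` ?N. \<Prod>h\<in>J. y f h)"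
      using sub fin y_nonneg by (intro sum_mono2 prod_nonneg) auto
    also have "\<dots> = (\<Sum>J\<in>?X. \<Prod>h\<in>J. y f h) + (\<Sum>J\<in>(\<lambda>h. {h}) ` ?N. \<Prod>h\<in>J. y f h)"
      using fin by (intro sum.union_disjoint) auto
    also have "(\<Sum>J\<in>(\<lambda>h. {h}) ` ?N. \<Prod>h\<in>J. y f h) = (\<Sum>h\<in>?N. y f h)"
      by (subst sum.reindex) (auto simp: inj_on_def)
    also have "\<dots> = d3 / p"
      using near3_sum[OF f] by (simp add: y_def sum_divide_distrib[symmetric])
    also have "(\<Sum>J\<in>?X. \<Prod>h\<in>J. y f h) \<le> (d2 / p)\<^sup>2 * exp (d2 / p)"
      using sum_prod_card_ge[of "near f R" "y f" 2] y_nonneg y_sum[OF f] by simp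
    also have "\<dots> \<le> 3 * (d2 / p)\<^sup>2" using u u0 by (rule exp_u_le[rotated])
    finally show ?thesis by simp
  qed
  have "ex (\<lambda>w. bad_sum (core (cl w))) = (\<Sum>f\<in>R. ex (\<lambda>w.
      of_bool (f \<notin> core (cl w) \<and> 2 \<le> m f (U (core (cl w)))) * (q / p ^ m f (U (core (cl w))))))"
    unfolding eq expec_sum ..
  also have "\<dots> \<le> (\<Sum>f\<in>R. q / (1 - p)\<^sup>2 * (\<Sum>J | J \<subseteq> near f R \<and> Good f J. \<Prod>h\<in>J. y f h))"
  proof (intro sum_mono expec_selected)
    fix f F assume f: "f \<in> R" and F: "F \<subseteq> R" "f \<notin> core F" and two: "2 \<le> m f (U (core F))"
    have cR: "core F \<subseteq> R" using F core_sub by blast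
    have Good_up: "Good f J" if B: "Good f B" "B \<subseteq> J" "J \<subseteq> near f R" for B J
    proof -
      have "finite J" using finite_subset[OF B(3)] by simp
      show ?thesis
      proof (cases "2 \<le> card B")
        case True
        thus ?thesis using card_mono[OF \<open>finite J\<close> B(2)] by (simp add: Good_def)
      next
        case False
        then obtain h where "h \<in> B" "3 \<le> card (f \<inter> h)" using B(1) by (auto simp: Good_def)
        thus ?thesis using B(2) by (auto simp: Good_def)
      qed
    qed
    show "\<exists>B. B \<subseteq> near f (core F) \<and> card B \<le> 2 \<and> (\<forall>J. B \<subseteq> J \<longrightarrow> J \<subseteq> near f R \<longrightarrow> Good f J)"
    proof (rule two_edges_cases[OF f cR F(2) two[unfolded m_def]])
      fix h assume h: "h \<in> near f (core F)" "3 \<le> card (f \<inter> h)"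
      have "Good f {h}" using h by (simp add: Good_def)
      hence "\<forall>J. {h} \<subseteq> J \<longrightarrow> J \<subseteq> near f R \<longrightarrow> Good f J" using Good_up by blast
      moreover have "{h} \<subseteq> near f (core F)" "card {h} \<le> 2" using h by simp_all
      ultimately show ?thesis by (intro exI[of _ "{h}"] conjI)
    next
      fix h h' assume h: "h \<in> near f (core F)" "h' \<in> near f (core F)" "h \<noteq> h'"
      have "Good f {h, h'}" using h by (simp add: Good_def)
      hence "\<forall>J. {h, h'} \<subseteq> J \<longrightarrow> J \<subseteq> near f R \<longrightarrow> Good f J" using Good_up by blast
      moreover have "{h, h'} \<subseteq> near f (core F)" "card {h, h'} \<le> 2" using h by simp_all
      ultimately show ?thesis by (intro exI[of _ "{h, h'}"] conjI)
    qed
  qed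
  also have "\<dots> \<le> (\<Sum>f\<in>R. q / (1 - p)\<^sup>2 * (d3 / p + 3 * (d2 / p)\<^sup>2))"
    using q_pos by (intro sum_mono mult_left_mono good_sum) auto
  also have "\<dots> = \<mu> / (1 - p)\<^sup>2 * (d3 / p + 3 * (d2 / p)\<^sup>2)"
    by (simp add: card_R \<mu>_def)
  finally show ?thesis .
qed

text \<open>A complete graph is not the union of two proper complete subgraphs: take
  \<open>x\<close> outside the first and \<open>z\<close> outside the second. The edge between them,
  or any edge at \<open>x\<close> if they coincide, is missed.\<close>

lemma covered_three:
  assumes f: "f \<in> R" "f \<notin> F" and F: "F \<subseteq> R" and cov: "K f \<subseteq> U F"
  shows "3 \<le> card (near f F)"
proof (rule ccontr)
  assume "\<not> ?thesis"
  hence c: "card (near f F) \<le> 2" by simp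
  have fin: "finite (near f F)" using F by simp
  \<comment> \<open>With a single near hyperedge \<open>g\<close> and \<open>g'\<close> coincide;
    with none they are arbitrary, a case excluded below.\<close>
  obtain g g' where gg: "near f F \<subseteq> {g, g'}" "near f F \<noteq> {} \<longrightarrow> g \<in> near f F \<and> g' \<in> near f F"
  proof (cases "card (near f F) = 2")
    case True
    thus ?thesis using that by (auto simp: card_2_iff)
  next
    case False
    hence "card (near f F) \<le> Suc 0" using c by linarith
    hence one: "\<forall>a\<in>near f F. \<forall>b\<in>near f F. a = b" using card_le_Suc0_iff_eq[OF fin] by simp
    show ?thesis
    proof (cases "near f F = {}")
      case False
      then obtain a where "a \<in> near f F" by auto
      thus ?thesis using one that[of a a] by blast
    qed (use that in auto)
  qed
  have edge: "\<exists>h\<in>near f F. x \<in> h \<and> z \<in> h" if "x \<in> f" "z \<in> f" "x \<noteq> z" for x z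
  proof -
    have e: "{x, z} \<in> K f" using that by (simp add: K_def)
    then obtain h where h: "h \<in> F" "{x, z} \<in> K h" using cov by (auto simp: U_def)
    hence "h \<in> near f F" using mem_near[OF f(1) h(1) _ e h(2)] f(2) by auto
    thus ?thesis using h by (auto simp: K_def)
  qed
  have out: "\<exists>x\<in>f. x \<notin> h" if "h \<in> near f F" for h
  proof (rule ccontr)
    assume "\<not> ?thesis"
    hence "f \<subseteq> h" by auto
    moreover have "h \<in> R" "h \<noteq> f" using that F by (auto simp: near_def)
    ultimately show False using RD[OF f(1)] RD[of h] card_subset_eq[of h f] by auto
  qed
  have "3 \<le> card f" using RD(3)[OF f(1)] r_ge by simp
  have big: "\<exists>z\<in>f. z \<noteq> x" for x
  proof (rule ccontr)
    assume "\<not> ?thesis"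
    hence "f \<subseteq> {x}" by auto
    thus False using \<open>3 \<le> card f\<close> card_mono[of "{x}" f] by auto
  qed
  have "f \<noteq> {}" using \<open>3 \<le> card f\<close> by auto
  then obtain x0 where "x0 \<in> f" by auto
  then obtain z0 where "z0 \<in> f" "z0 \<noteq> x0" using big by auto
  hence "near f F \<noteq> {}" using edge \<open>x0 \<in> f\<close> by blast
  hence g: "g \<in> near f F" "g' \<in> near f F" using gg by auto
  obtain x where x: "x \<in> f" "x \<notin> g" using out g by auto
  obtain z where z: "z \<in> f" "z \<notin> g'" using out g by auto
  show False
  proof (cases "x = z")
    case True
    obtain t where "t \<in> f" "t \<noteq> x" using big by auto
    thus False using edge[of x t] x z True gg(1) by blast
  next
    case False
    thus False using edge[of x z] x z gg(1) by blast
  qed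
qed

text \<open>For a covered set the weight \<open>q / p ^ m\<close> equals 1, so the expected total
  weight bounds the probability. \<open>covered_three\<close> supplies three witnesses.\<close>

lemma pr_covered:
  assumes u: "d2 / p \<le> 1"
  shows "prb (\<lambda>w. covered (core (cl w)) \<noteq> {}) \<le> \<mu> / (1 - p) ^ 3 * (3 * (d2 / p) ^ 3)"
proof -
  have u0: "0 \<le> d2 / p" using d2_nonneg p_pos by simp
  have full: "q / p ^ m f (U F) = 1" if "f \<in> R" "K f \<subseteq> U F" for f F
    using that p_pos by (simp add: m_def Int_absorb2 card_K q_def)
  have "prb (\<lambda>w. covered (core (cl w)) \<noteq> {}) \<le> ex (\<lambda>w. \<Sum>f\<in>R.
      of_bool (f \<notin> core (cl w) \<and> K f \<subseteq> U (core (cl w))) * (q / p ^ m f (U (core (cl w)))))"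
    unfolding pr_def
  proof (rule expec_mono)
    fix w
    define g where "g f = of_bool (f \<notin> core (cl w) \<and> K f \<subseteq> U (core (cl w))) * (q / p ^ m f (U (core (cl w))))" for f
    have nn: "0 \<le> g f" for f unfolding g_def using q_pos p_pos by auto
    have "of_bool (covered (core (cl w)) \<noteq> {}) \<le> (\<Sum>f\<in>R. g f)"
    proof (cases "covered (core (cl w)) = {}")
      case True
      have "0 \<le> (\<Sum>f\<in>R. g f)" by (intro sum_nonneg nn)
      thus ?thesis unfolding True by simp
    next
      case False
      then obtain f where f: "f \<in> R" "f \<notin> core (cl w)" "K f \<subseteq> U (core (cl w))" by (auto simp: covered_def)
      have "g f = 1" unfolding g_def full[OF f(1,3)] using f by simp
      moreover have "g f \<le> (\<Sum>f\<in>R. g f)" using f nn by (intro member_le_sum) auto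
      ultimately show ?thesis by simp
    qed
    thus "of_bool (covered (core (cl w)) \<noteq> {}) \<le> (\<Sum>f\<in>R.
      of_bool (f \<notin> core (cl w) \<and> K f \<subseteq> U (core (cl w))) * (q / p ^ m f (U (core (cl w)))))"
      unfolding g_def .
  qed (use p_bounds in auto)
  also have "\<dots> = (\<Sum>f\<in>R. ex (\<lambda>w.
      of_bool (f \<notin> core (cl w) \<and> K f \<subseteq> U (core (cl w))) * (q / p ^ m f (U (core (cl w))))))"
    unfolding expec_sum ..
  also have "\<dots> \<le> (\<Sum>f\<in>R. q / (1 - p) ^ 3 * (\<Sum>J | J \<subseteq> near f R \<and> 3 \<le> card J. \<Prod>h\<in>J. y f h))"
  proof (rule sum_mono)
    fix f assume f: "f \<in> R"
    show "ex (\<lambda>w. of_bool (f \<notin> core (cl w) \<and> K f \<subseteq> U (core (cl w))) * (q / p ^ m f (U (core (cl w)))))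
      \<le> q / (1 - p) ^ 3 * (\<Sum>J | J \<subseteq> near f R \<and> 3 \<le> card J. \<Prod>h\<in>J. y f h)"
    proof (rule expec_selected[where sel = "\<lambda>F. K f \<subseteq> U (core F)" and Good = "\<lambda>J. 3 \<le> card J", OF f])
      fix F assume F: "F \<subseteq> R" "f \<notin> core F" and cov: "K f \<subseteq> U (core F)"
      have cR: "core F \<subseteq> R" using F core_sub by blast
      obtain B where B: "B \<subseteq> near f (core F)" "card B = 3" "finite B"
        by (rule obtain_subset_with_card_n[OF covered_three[OF f F(2) cR cov]])
      have "3 \<le> card J" if J: "B \<subseteq> J" "J \<subseteq> near f R" for J
      proof -
        have "finite J" using finite_subset[OF J(2)] by simp
        thus ?thesis using card_mono[OF _ J(1)] B(2) by simp
      qed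
      thus "\<exists>B. B \<subseteq> near f (core F) \<and> card B \<le> 3 \<and> (\<forall>J. B \<subseteq> J \<longrightarrow> J \<subseteq> near f R \<longrightarrow> 3 \<le> card J)"
        using B by (intro exI[of _ B] conjI allI impI) simp_all
    qed
  qed
  also have "\<dots> \<le> (\<Sum>f\<in>R. q / (1 - p) ^ 3 * (3 * (d2 / p) ^ 3))"
  proof (intro sum_mono mult_left_mono)
    fix f assume f: "f \<in> R"
    have "(\<Sum>J | J \<subseteq> near f R \<and> 3 \<le> card J. \<Prod>h\<in>J. y f h) \<le> (d2 / p) ^ 3 * exp (d2 / p)"
      using sum_prod_card_ge[of "near f R" "y f" 3] y_nonneg y_sum[OF f] by simp
    also have "\<dots> \<le> 3 * (d2 / p) ^ 3" using u u0 by (rule exp_u_le[rotated])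
    finally show "(\<Sum>J | J \<subseteq> near f R \<and> 3 \<le> card J. \<Prod>h\<in>J. y f h) \<le> 3 * (d2 / p) ^ 3" .
  qed (use q_pos p_bounds in auto)
  also have "\<dots> = \<mu> / (1 - p) ^ 3 * (3 * (d2 / p) ^ 3)" by (simp add: card_R \<mu>_def)
  finally show ?thesis .
qed

section \<open>The probability of a given clique hypergraph\<close>

definition PH :: "nat set set \<Rightarrow> real" where "PH F = prb (\<lambda>w. cl w = F)"

lemma PH_nonneg: "0 \<le> PH F" by (simp add: PH_def pr_nonneg)

lemma PH_eq:
  assumes F: "F \<subseteq> R"
  shows "PH F = p ^ card (U F) * prb (\<lambda>w. \<forall>f\<in>R - F. \<not> K f \<subseteq> w \<union> U F)"
proof -
  have "cl w = F \<longleftrightarrow> U F \<subseteq> w \<and> (\<forall>f\<in>R - F. \<not> K f \<subseteq> w)" for w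
    using F by (auto simp: cl_def U_def)
  thus ?thesis unfolding PH_def using pr_superset_conj[OF U_sub[OF F]] by simp
qed

lemma pr_cl: "prb (\<lambda>w. P (cl w)) = (\<Sum>F | F \<subseteq> R \<and> P F. PH F)"
proof -
  have "of_bool (P (cl w)) = (\<Sum>F | F \<subseteq> R \<and> P F. of_bool (cl w = F) :: real)" for w
  proof (cases "P (cl w)")
    case True
    have "(\<Sum>F | F \<subseteq> R \<and> P F. of_bool (cl w = F) :: real) = (\<Sum>F\<in>{cl w}. of_bool (cl w = F))"
      using True cl_sub by (intro sum.mono_neutral_right) auto
    thus ?thesis using True by simp
  next
    case False
    thus ?thesis by (auto intro!: sum.neutral[symmetric])
  qed
  thus ?thesis unfolding PH_def pr_def by (simp only: expec_sum)
qed

section \<open>Passing to the core\<close>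

lemma card_small_subsets:
  assumes "finite A"
  shows "card {B. B \<subseteq> A \<and> card B \<le> k} \<le> Suc (card A) ^ k"
proof (induction k)
  case 0
  have "{B. B \<subseteq> A \<and> card B \<le> 0} = {{}}"
    using assms by (auto simp: card_eq_0_iff dest: finite_subset)
  thus ?case by simp
next
  case (Suc k)
  \<comment> \<open>\<open>None\<close> stands for adding no element, so that one map also produces
    the smaller sets.\<close>
  let ?D = "insert None (Some ` A)"
  have fin: "finite {B. B \<subseteq> A \<and> card B \<le> k}" using assms by simp
  have "{B. B \<subseteq> A \<and> card B \<le> Suc k}
    \<subseteq> (\<lambda>(B, x). case x of None \<Rightarrow> B | Some a \<Rightarrow> insert a B) ` ({B. B \<subseteq> A \<and> card B \<le> k} \<times> ?D)"
  proof
    fix B assume B: "B \<in> {B. B \<subseteq> A \<and> card B \<le> Suc k}"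
    show "B \<in> (\<lambda>(B, x). case x of None \<Rightarrow> B | Some a \<Rightarrow> insert a B) ` ({B. B \<subseteq> A \<and> card B \<le> k} \<times> ?D)"
    proof (cases "card B \<le> k")
      case True
      thus ?thesis using B by (intro image_eqI[of _ _ "(B, None)"]) auto
    next
      case False
      then obtain a where a: "a \<in> B" by fastforce
      have "card (B - {a}) \<le> k" using B a assms finite_subset[of B A] by auto
      thus ?thesis using B a by (intro image_eqI[of _ _ "(B - {a}, Some a)"]) auto
    qed
  qed
  hence "card {B. B \<subseteq> A \<and> card B \<le> Suc k} \<le> card ({B. B \<subseteq> A \<and> card B \<le> k} \<times> ?D)"
    using fin assms by (intro surj_card_le) auto
  also have "\<dots> = card {B. B \<subseteq> A \<and> card B \<le> k} * Suc (card A)"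
    using assms by (simp add: card_cartesian_product card_image)
  also have "\<dots> \<le> Suc (card A) ^ k * Suc (card A)" using Suc by (rule mult_right_mono) simp
  finally show ?case by (simp add: mult.commute)
qed

text \<open>
  A hypergraph is determined by its core and by the at most \<open>k\<close> other hyperedges, so few hypergraphs
  have the same core. Summing over them, hypergraphs much less likely than their core have small total mass.
\<close>

lemma pr_core_drop:
  defines "N \<equiv> real (Suc (card R))"
  shows "prb (\<lambda>w. card (cl w - core (cl w)) \<le> k \<and> PH (cl w) < PH (core (cl w)) / N ^ (2 * k)) \<le> 1 / N"
proof -
  define P where "P F \<longleftrightarrow> card (F - core F) \<le> k \<and> PH F < PH (core F) / N ^ (2 * k)" for F
  have N: "1 \<le> N" by (simp add: N_def)
  have finP: "finite {F. F \<subseteq> R \<and> P F}" by simp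
  have tot: "(\<Sum>F\<in>Pow R. PH F) = 1"
    using pr_cl[of "\<lambda>_. True"] by (simp add: Pow_def)
  show ?thesis
  \<comment> \<open>For \<open>k = 0\<close> the final bound \<open>1 / N ^ k\<close> would say
    nothing, but then \<open>F\<close> is its own core and the event is empty.\<close>
  proof (cases "k = 0")
    case True
    have "{F. F \<subseteq> R \<and> P F} = {}"
    proof -
      have False if "F \<subseteq> R" "P F" for F
      proof -
        have "finite (F - core F)" using that finite_subset by blast
        hence "F = core F" using that True core_sub[of F] by (auto simp: P_def)
        thus False using that(2) True by (simp add: P_def)
      qed
      thus ?thesis by blast
    qed
    hence "prb (\<lambda>w. P (cl w)) = 0" unfolding pr_cl by (simp only: sum.empty)
    thus ?thesis using N by (simp add: P_def)
  next
    case False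
    have inj: "inj_on (\<lambda>F. (core F, F - core F)) {F. F \<subseteq> R \<and> P F}"
    proof (rule inj_onI)
      fix F G assume "(core F, F - core F) = (core G, G - core G)"
      hence "core F = core G \<and> F - core F = G - core G" by (rule prod.inject[THEN iffD1])
      thus "F = G" using core_sub[of F] core_sub[of G] by blast
    qed
    have "prb (\<lambda>w. P (cl w)) = (\<Sum>F | F \<subseteq> R \<and> P F. PH F)" by (rule pr_cl)
    also have "\<dots> \<le> (\<Sum>F | F \<subseteq> R \<and> P F. PH (core F) / N ^ (2 * k))"
      by (intro sum_mono) (auto simp: P_def)
    also have "\<dots> = (\<Sum>(F0, A)\<in>(\<lambda>F. (core F, F - core F)) ` {F. F \<subseteq> R \<and> P F}. PH F0 / N ^ (2 * k))"
      by (subst sum.reindex[OF inj]) simp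
    also have "\<dots> \<le> (\<Sum>(F0, A)\<in>Pow R \<times> {A. A \<subseteq> R \<and> card A \<le> k}. PH F0 / N ^ (2 * k))"
      using core_sub PH_nonneg N by (intro sum_mono2) (auto simp: P_def)
    also have "\<dots> = real (card {A. A \<subseteq> R \<and> card A \<le> k}) / N ^ (2 * k) * (\<Sum>F0\<in>Pow R. PH F0)"
      by (simp add: sum.cartesian_product[symmetric] sum_distrib_left)
    \<comment> \<open>One factor \<open>N ^ k\<close> pays for the number of hypergraphs with a
      given core, the other makes the total small.\<close>
    also have "\<dots> \<le> N ^ k / N ^ (2 * k)"
    proof -
      have "real (card {A. A \<subseteq> R \<and> card A \<le> k}) \<le> N ^ k"
        using card_small_subsets[OF fin_R, of k]
        unfolding N_def of_nat_power[symmetric] of_nat_le_iff .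
      thus ?thesis using N tot by (simp add: divide_right_mono)
    qed
    also have "\<dots> = 1 / N ^ k" using N by (simp add: mult_2 power_add)
    also have "\<dots> \<le> 1 / N ^ 1" using N False by (intro divide_left_mono power_increasing) auto
    finally show ?thesis by (simp add: P_def)
  qed
qed

end

section \<open>Approximating the probability of a clique hypergraph\<close>

text \<open>Pascal's rule is applied \<open>a\<close> times, each time with a correction no larger
  than the first one.\<close>

lemma choose_diff_le:
  assumes "a \<le> N" "0 < k"
  shows "N choose k \<le> ((N - a) choose k) + a * ((N - 1) choose (k - 1))"
  using assms(1)
proof (induction a)
  case (Suc a)
  obtain k' where k: "k = Suc k'" using assms(2) gr0_implies_Suc by blast
  have Na: "N - a = Suc (N - Suc a)" using Suc by simp
  have "(N - a) choose k = ((N - Suc a) choose k) + ((N - Suc a) choose (k - 1))"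
    unfolding Na k by simp
  moreover have "((N - Suc a) choose (k - 1)) \<le> ((N - 1) choose (k - 1))"
    by (rule binomial_right_mono) simp
  ultimately show ?case using Suc by simp
qed simp

context clique_model
begin

definition good :: "nat set set \<Rightarrow> nat set set" where "good M = {f\<in>R. m f M \<le> 1}"

text \<open>The increase of the expected number of cliques caused by revealing one edge.
  \<open>rate\<close> below is its multiple for the edges of a whole hyperedge, several edges in the
  same set being counted linearly.\<close>

definition edge_rate :: real where
  "edge_rate = q * (1/p - 1) * real ((n - 2) choose (r - 2))"

definition rate :: real where "rate = edge_rate * real (r choose 2)"

definition \<Lambda> :: real where
  "\<Lambda> = 1/2 * \<mu> * (real (r choose 2) * real ((n - r) choose (r - 2)) * q * (1/p - 1))"

lemma inv_p: "0 < 1/p - 1" using p_pos p_lt_1 by simp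

lemma edge_rate_nonneg: "0 \<le> edge_rate" using q_pos inv_p by (simp add: edge_rate_def)

lemma choose2_ge_1: "1 \<le> r choose 2"
  using r_ge by (simp add: Suc_leI zero_less_binomial_iff)

lemma rate_nonneg: "0 \<le> rate" and edge_rate_le: "edge_rate \<le> rate"
  using edge_rate_nonneg choose2_ge_1 mult_left_mono[of 1 "real (r choose 2)" edge_rate]
  by (auto simp: rate_def)

lemma power_Diff_m: "f \<in> R \<Longrightarrow> p ^ card (K f - M) = q / p ^ m f M"
proof -
  assume f: "f \<in> R"
  have "m f M \<le> r choose 2" unfolding m_def card_K[OF f, symmetric]
    using RD(2)[OF f] by (intro card_mono) auto
  moreover have "card (K f - M) = (r choose 2) - m f M"
    using RD(2)[OF f] by (simp add: card_Diff_subset_Int card_K[OF f] m_def)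
  ultimately show ?thesis using p_pos by (simp add: q_def power_diff)
qed

text \<open>A good \<open>g\<close> loses at most one edge to \<open>M\<close>, so its conditional
  probability grows by at most \<open>1 / p\<close>.\<close>

lemma power_Diff_Diff_le:
  assumes g: "g \<in> good M"
  shows "p ^ card ((K g - M) - (K f - M)) \<le> p ^ card (K g - K f) / p"
proof -
  have gR: "g \<in> R" using g by (simp add: good_def)
  have "card (K g - K f) \<le> card (((K g - M) - (K f - M)) \<union> (K g \<inter> M))"
    using RD(2)[OF gR] by (intro card_mono) auto
  also have "\<dots> \<le> card ((K g - M) - (K f - M)) + card (K g \<inter> M)" by (rule card_Un_le)
  also have "\<dots> \<le> Suc (card ((K g - M) - (K f - M)))" using g by (simp add: good_def m_def)
  finally have "p ^ Suc (card ((K g - M) - (K f - M))) \<le> p ^ card (K g - K f)"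
    using p_bounds by (intro power_decreasing) auto
  thus ?thesis using p_pos by (simp add: field_simps)
qed

text \<open>Once the edges in \<open>M\<close> are given, a set \<open>f\<close> needs only
  \<open>K f - M\<close>. Restricting to sets with at most one edge in \<open>M\<close> keeps all
  overlap sums within a factor \<open>1 / p\<close>.\<close>

lemma weakly_dependent_good:
  assumes M: "M \<subseteq> E" and small: "d2 / p \<le> 1/2" "q / p \<le> 1/2"
  shows "weakly_dependent_events p E (good M) (\<lambda>f. K f - M) (d2 / p) (d3 / p) (q / p)"
proof unfold_locales
  have gR: "good M \<subseteq> R" by (auto simp: good_def)
  show "finite (good M)" using gR finite_subset by auto
  show "K f - M \<subseteq> E" if "f \<in> good M" for f using K_sub that gR by auto
  fix f assume f: "f \<in> good M"
  hence fR: "f \<in> R" using gR by auto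
  have "(\<Sum>g | g \<in> good M - {f} \<and> (K g - M) \<inter> (K f - M) \<noteq> {}. p ^ card ((K g - M) - (K f - M)))
    \<le> (\<Sum>g | g \<in> good M - {f} \<and> (K g - M) \<inter> (K f - M) \<noteq> {}. p ^ card (K g - K f) / p)"
    by (intro sum_mono power_Diff_Diff_le) auto
  also have "\<dots> \<le> (\<Sum>g\<in>near f R. p ^ card (K g - K f) / p)"
  proof (rule sum_mono2)
    show "{g. g \<in> good M - {f} \<and> (K g - M) \<inter> (K f - M) \<noteq> {}} \<subseteq> near f R"
    proof
      fix g assume "g \<in> {g. g \<in> good M - {f} \<and> (K g - M) \<inter> (K f - M) \<noteq> {}}"
      then obtain e where "g \<in> R" "g \<noteq> f" "e \<in> K g" "e \<in> K f" using gR by auto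
      thus "g \<in> near f R" using mem_near[OF fR, of g R e] by auto
    qed
  qed (use p_pos in auto)
  also have "\<dots> = d2 / p" by (simp add: sum_divide_distrib[symmetric] near_sum[OF fR])
  finally show "(\<Sum>g | g \<in> good M - {f} \<and> (K g - M) \<inter> (K f - M) \<noteq> {}. p ^ card ((K g - M) - (K f - M))) \<le> d2 / p" .
  have "(\<Sum>g | g \<in> good M - {f} \<and> 2 \<le> card ((K g - M) \<inter> (K f - M)). p ^ card ((K g - M) - (K f - M)))
    \<le> (\<Sum>g | g \<in> good M - {f} \<and> 2 \<le> card ((K g - M) \<inter> (K f - M)). p ^ card (K g - K f) / p)"
    by (intro sum_mono power_Diff_Diff_le) auto
  also have "\<dots> \<le> (\<Sum>g | g \<in> near f R \<and> 3 \<le> card (f \<inter> g). p ^ card (K g - K f) / p)"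
  proof (rule sum_mono2)
    show "finite {g. g \<in> near f R \<and> 3 \<le> card (f \<inter> g)}" by simp
    show "{g. g \<in> good M - {f} \<and> 2 \<le> card ((K g - M) \<inter> (K f - M))} \<subseteq> {g. g \<in> near f R \<and> 3 \<le> card (f \<inter> g)}"
    proof
      fix g assume g: "g \<in> {g. g \<in> good M - {f} \<and> 2 \<le> card ((K g - M) \<inter> (K f - M))}"
      hence gR': "g \<in> R" using gR by auto
      have "card ((K g - M) \<inter> (K f - M)) \<le> card (K f \<inter> K g)"
        using RD(2)[OF fR] by (intro card_mono) auto
      hence ge: "2 \<le> card (f \<inter> g) choose 2" using g by (simp add: card_K_Int[OF fR])
      have "3 \<le> card (f \<inter> g)"
      proof (rule ccontr)
        assume "\<not> ?thesis"
        hence "card (f \<inter> g) choose 2 \<le> 2 choose 2" by (intro binomial_right_mono) simp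
        thus False using ge by simp
      qed
      thus "g \<in> {g. g \<in> near f R \<and> 3 \<le> card (f \<inter> g)}" using g gR' by (auto simp: near_def)
    qed
  qed (use p_pos in auto)
  also have "\<dots> = d3 / p" by (simp add: sum_divide_distrib[symmetric] near3_sum[OF fR])
  finally show "(\<Sum>g | g \<in> good M - {f} \<and> 2 \<le> card ((K g - M) \<inter> (K f - M)). p ^ card ((K g - M) - (K f - M))) \<le> d3 / p" .
  have "p ^ 1 \<le> p ^ m f M" using f p_bounds by (intro power_decreasing) (auto simp: good_def)
  hence "q / p ^ m f M \<le> q / p" using q_pos p_pos by (intro divide_left_mono) auto
  thus "p ^ card (K f - M) \<le> q / p" by (simp add: power_Diff_m[OF fR])
qed (use small in auto)

section \<open>Mean and covariances given a set of edges\<close>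

lemma sum_m:
  assumes M: "M \<subseteq> E"
  shows "(\<Sum>f\<in>R. m f M) = card M * ((n - 2) choose (r - 2))"
proof -
  have finM: "finite M" using M finite_subset fin_E by blast
  have "(\<Sum>f\<in>R. m f M) = (\<Sum>f\<in>R. \<Sum>e | e \<in> M \<and> e \<in> K f. 1)"
    by (intro sum.cong refl) (simp add: m_def Int_def conj_commute)
  also have "\<dots> = (\<Sum>e\<in>M. \<Sum>f | f \<in> R \<and> e \<in> K f. 1)"
    using finM by (rule sum.swap_restrict[OF fin_R])
  also have "\<dots> = (\<Sum>e\<in>M. (n - 2) choose (r - 2))"
    using M count_edge by (intro sum.cong refl) auto
  finally show ?thesis by simp
qed

text \<open>The weight \<open>1 / p ^ m\<close> is replaced by \<open>1 + m * (1 / p - 1)\<close>,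
  which agrees with it for \<open>m \<le> 1\<close> and whose sum over all sets follows from
  \<open>sum_m\<close>. For sets that are not good, Bernoulli's inequality bounds the surplus by
  \<open>bad_sum\<close>, except for the members of \<open>F\<close>, which are paid for one by
  one.\<close>

lemma good_first_sum:
  assumes F: "F \<subseteq> R"
  defines "M \<equiv> U F"
  shows "\<mu> + edge_rate * card M - bad_sum F - card F * (q * (1 + real (r choose 2) / p))
      \<le> (\<Sum>f\<in>good M. q / p ^ m f M)"
    and "(\<Sum>f\<in>good M. q / p ^ m f M) \<le> \<mu> + edge_rate * card M"
proof -
  have M: "M \<subseteq> E" using F by (simp add: M_def U_sub)
  have finF: "finite F" using F finite_subset by auto
  define t where "t f = q * (1 + real (m f M) * (1/p - 1))" for f
  have t0: "0 \<le> t f" for f using q_pos inv_p by (simp add: t_def)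
  have gR: "good M \<subseteq> R" by (auto simp: good_def)
  have tot: "(\<Sum>f\<in>R. t f) = \<mu> + edge_rate * card M"
  proof -
    have "(\<Sum>f\<in>R. t f) = q * real (card R) + q * (1/p - 1) * real (\<Sum>f\<in>R. m f M)"
      unfolding t_def distrib_left sum.distrib by (simp add: sum_distrib_left mult_ac)
    thus ?thesis unfolding sum_m[OF M] by (simp add: card_R \<mu>_def edge_rate_def mult_ac)
  qed
  have good: "(\<Sum>f\<in>good M. q / p ^ m f M) = (\<Sum>f\<in>good M. t f)"
  proof (intro sum.cong refl)
    fix f assume "f \<in> good M"
    hence "m f M = 0 \<or> m f M = 1" by (auto simp: good_def)
    thus "q / p ^ m f M = t f" by (auto simp: t_def)
  qed
  have split: "(\<Sum>f\<in>R. t f) = (\<Sum>f\<in>good M. t f) + (\<Sum>f\<in>R - good M. t f)"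
    using gR by (simp add: sum.subset_diff add.commute)
  have "0 \<le> (\<Sum>f\<in>R - good M. t f)" using t0 by (intro sum_nonneg)
  thus "(\<Sum>f\<in>good M. q / p ^ m f M) \<le> \<mu> + edge_rate * card M"
    using split good tot by linarith
  let ?B = "{f. f \<in> R - F \<and> 2 \<le> m f M}"
  have "(\<Sum>f\<in>R - good M. t f) \<le> (\<Sum>f\<in>?B \<union> F. t f)"
    using t0 F finF by (intro sum_mono2) (auto simp: good_def)
  also have "\<dots> = (\<Sum>f\<in>?B. t f) + (\<Sum>f\<in>F. t f)"
    using finF by (intro sum.union_disjoint) auto
  also have "(\<Sum>f\<in>?B. t f) \<le> bad_sum F"
    unfolding bad_sum_def M_def[symmetric]
  proof (rule sum_mono)
    fix f
    have "1 + real (m f M) * (1/p - 1) \<le> (1 + (1/p - 1)) ^ m f M"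
      using inv_p by (intro Bernoulli_inequality) linarith
    hence "q * (1 + real (m f M) * (1/p - 1)) \<le> q * (1/p) ^ m f M"
      using q_pos by (intro mult_left_mono) auto
    thus "t f \<le> q / p ^ m f M" by (simp add: t_def power_one_over)
  qed
  also have "(\<Sum>f\<in>F. t f) \<le> (\<Sum>f\<in>F. q * (1 + real (r choose 2) / p))"
    unfolding t_def
  proof (intro sum_mono mult_left_mono add_left_mono)
    fix f assume "f \<in> F"
    hence f: "f \<in> R" using F by auto
    have "m f M \<le> r choose 2" unfolding m_def card_K[OF f, symmetric]
      using RD(2)[OF f] by (intro card_mono) auto
    hence "real (m f M) * (1/p - 1) \<le> real (r choose 2) * (1/p)"
      using inv_p p_pos by (intro mult_mono) auto
    thus "real (m f M) * (1/p - 1) \<le> real (r choose 2) / p" by simp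
  qed (use q_pos in auto)
  finally show "\<mu> + edge_rate * card M - bad_sum F - card F * (q * (1 + real (r choose 2) / p))
      \<le> (\<Sum>f\<in>good M. q / p ^ m f M)"
    using split good tot by simp
qed

definition two :: "nat set \<Rightarrow> nat set set" where "two f = {g\<in>R. card (f \<inter> g) = 2}"

lemma card_two: "f \<in> R \<Longrightarrow> card (two f) = (r choose 2) * ((n - r) choose (r - 2))"
  using count_Int[of f 2] r_ge by (simp add: two_def)

text \<open>An edge of \<open>M\<close> lies in \<open>(n - 2) choose (r - 2)\<close> sets, each
  with the same number of partners sharing exactly two vertices; the factor 2 allows either member
  of the pair to be touched.\<close>

lemma two_sum_touched:
  assumes M: "M \<subseteq> E"
  shows "(\<Sum>f\<in>R. \<Sum>g\<in>two f. of_bool (1 \<le> m f M) + of_bool (1 \<le> m g M))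
    \<le> 2 * (card M * ((n - 2) choose (r - 2)) * ((r choose 2) * ((n - r) choose (r - 2))))"
proof -
  let ?D = "(r choose 2) * ((n - r) choose (r - 2))"
  have le: "(\<Sum>f\<in>R. of_bool (1 \<le> m f M) :: nat) \<le> card M * ((n - 2) choose (r - 2))"
    unfolding sum_m[OF M, symmetric] by (intro sum_mono) auto
  have 1: "(\<Sum>f\<in>R. \<Sum>g\<in>two f. of_bool (1 \<le> m f M) :: nat) = (\<Sum>f\<in>R. of_bool (1 \<le> m f M)) * ?D"
    unfolding sum_distrib_right by (intro sum.cong refl) (simp add: card_two)
  have 2: "(\<Sum>f\<in>R. \<Sum>g\<in>two f. of_bool (1 \<le> m g M) :: nat) = (\<Sum>f\<in>R. \<Sum>g\<in>two f. of_bool (1 \<le> m f M))"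
  proof -
    have "(\<Sum>f\<in>R. \<Sum>g | g \<in> R \<and> card (f \<inter> g) = 2. of_bool (1 \<le> m g M) :: nat)
      = (\<Sum>g\<in>R. \<Sum>f | f \<in> R \<and> card (f \<inter> g) = 2. of_bool (1 \<le> m g M))"
      by (rule sum.swap_restrict) auto
    thus ?thesis unfolding two_def by (simp only: Int_commute)
  qed
  have "(\<Sum>f\<in>R. \<Sum>g\<in>two f. of_bool (1 \<le> m f M) + of_bool (1 \<le> m g M) :: nat)
    = 2 * ((\<Sum>f\<in>R. of_bool (1 \<le> m f M)) * ?D)"
    unfolding sum.distrib 2 1 by simp
  also have "\<dots> \<le> 2 * (card M * ((n - 2) choose (r - 2)) * ?D)"
    using le by (intro mult_left_mono mult_right_mono) auto
  finally show ?thesis .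
qed

lemma T2_eq: "T 2 = real (r choose 2) * real ((n - r) choose (r - 2)) * (q / p)"
  using choose2_ge_1 p_pos by (simp add: T_def q_def power_diff)

lemma T2_le: "T 2 \<le> d2" using d2_eq d3_nonneg by simp

text \<open>Pairs untouched by \<open>M\<close> have weight exactly \<open>q\<^sup>2\<close> and,
  counted over all sets, account for \<open>\<Lambda>\<close>; touched pairs have weight at most
  \<open>(q / p)\<^sup>2\<close> and are few by \<open>two_sum_touched\<close>.\<close>

lemma good_second_sum:
  assumes M: "M \<subseteq> E" and small: "d2 / p \<le> 1/2" "q / p \<le> 1/2" and I: "I \<subseteq> good M"
  defines "S2 \<equiv> weakly_dependent_events.second_sum p (\<lambda>f. K f - M)"
  shows "S2 I \<le> \<Lambda> + edge_rate * card M * (d2 / p)"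
    and "\<Lambda> - edge_rate * card M * (d2 / p) \<le> S2 (good M)"
proof -
  interpret W: weakly_dependent_events p E "good M" "\<lambda>f. K f - M" "d2 / p" "d3 / p" "q / p"
    using M small by (rule weakly_dependent_good)
  have gR: "good M \<subseteq> R" by (auto simp: good_def)
  let ?c = "real (r choose 2) * real ((n - r) choose (r - 2))"
  define b :: "nat set \<Rightarrow> nat set \<Rightarrow> nat" where "b f g = of_bool (1 \<le> m f M) + of_bool (1 \<le> m g M)" for f g
  have fin2: "finite (two f)" for f by (simp add: two_def)
  have Wc: "(\<Sum>f\<in>R. \<Sum>g\<in>two f. q\<^sup>2) = \<mu> * (?c * q)"
    by (simp add: card_two card_R \<mu>_def power2_eq_square)
  have bsum: "(q / p)\<^sup>2 * (\<Sum>f\<in>R. \<Sum>g\<in>two f. real (b f g)) * (1/2 * (1/p - 1)) \<le> edge_rate * card M * (d2 / p)"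
  proof -
    have "real (\<Sum>f\<in>R. \<Sum>g\<in>two f. b f g) \<le> real (2 * (card M * ((n - 2) choose (r - 2)) * ((r choose 2) * ((n - r) choose (r - 2)))))"
      unfolding b_def using two_sum_touched[OF M] by (simp only: of_nat_le_iff)
    hence "(\<Sum>f\<in>R. \<Sum>g\<in>two f. real (b f g)) \<le> 2 * (card M * real ((n - 2) choose (r - 2)) * ?c)"
      by simp
    hence "(q / p)\<^sup>2 * (\<Sum>f\<in>R. \<Sum>g\<in>two f. real (b f g)) * (1/2 * (1/p - 1))
      \<le> (q / p)\<^sup>2 * (2 * (card M * real ((n - 2) choose (r - 2)) * ?c)) * (1/2 * (1/p - 1))"
      using inv_p by (intro mult_right_mono mult_left_mono) auto
    also have "\<dots> = edge_rate * card M * (T 2 / p)"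
      by (simp add: edge_rate_def T2_eq power2_eq_square)
    also have "\<dots> \<le> edge_rate * card M * (d2 / p)"
      using T2_le edge_rate_nonneg p_pos by (intro mult_left_mono divide_right_mono) auto
    finally show ?thesis .
  qed
  \<comment> \<open>Besides the one common edge outside \<open>M\<close> there is at most one
    inside, as the sets are good. Three common vertices would already give three common
    edges.\<close>
  have once_two: "W.once (I - {i}) i \<subseteq> two i" if i: "i \<in> I" for i
  proof
    fix j assume j: "j \<in> W.once (I - {i}) i"
    hence c: "card ((K j - M) \<inter> (K i - M)) = 1" and jg: "j \<in> good M" and ig: "i \<in> good M"
      using I i by (auto simp: W.once_def)
    have iR: "i \<in> R" and jR: "j \<in> R" using gR ig jg by auto
    have "card (K i \<inter> K j) \<le> card ((K j - M) \<inter> (K i - M) \<union> (K i \<inter> M))"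
      using RD(2)[OF iR] by (intro card_mono) auto
    also have "\<dots> \<le> card ((K j - M) \<inter> (K i - M)) + card (K i \<inter> M)" by (rule card_Un_le)
    also have "\<dots> \<le> 2" using c ig by (simp add: good_def m_def)
    finally have le2: "card (i \<inter> j) choose 2 \<le> 2" by (simp add: card_K_Int[OF iR])
    have "card ((K j - M) \<inter> (K i - M)) \<le> card (K i \<inter> K j)"
      using RD(2)[OF iR] by (intro card_mono) auto
    hence ge1: "1 \<le> card (i \<inter> j) choose 2" using c by (simp add: card_K_Int[OF iR])
    have "\<not> 3 \<le> card (i \<inter> j)"
    proof
      assume "3 \<le> card (i \<inter> j)"
      hence "3 choose 2 \<le> card (i \<inter> j) choose 2" by (rule binomial_right_mono)
      thus False using le2 by (simp add: numeral_eq_Suc)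
    qed
    moreover have "\<not> card (i \<inter> j) < 2" using ge1 by (auto simp: binomial_eq_0)
    ultimately show "j \<in> two i" using jR by (simp add: two_def)
  qed
  have "(\<Sum>i\<in>I. \<Sum>j\<in>W.once (I - {i}) i. p ^ card (K i - M) * p ^ card (K j - M))
    \<le> (\<Sum>i\<in>I. \<Sum>j\<in>W.once (I - {i}) i. q\<^sup>2 + (q / p)\<^sup>2 * real (b i j))"
  proof (intro sum_mono)
    fix i j assume i: "i \<in> I" and "j \<in> W.once (I - {i}) i"
    hence j: "j \<in> I" by (auto simp: W.once_def)
    have k: "p ^ card (K f - M) \<le> q / p" "0 \<le> p ^ card (K f - M)" if "f \<in> I" for f
      using W.kappa[of f] that I p_bounds by auto
    show "p ^ card (K i - M) * p ^ card (K j - M) \<le> q\<^sup>2 + (q / p)\<^sup>2 * real (b i j)"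
    proof (cases "m i M = 0 \<and> m j M = 0")
      case True
      have "i \<in> R" "j \<in> R" using i j I gR by auto
      thus ?thesis using True by (simp add: power_Diff_m power2_eq_square)
    next
      case False
      hence "1 \<le> real (b i j)" by (auto simp: b_def)
      hence "(q / p)\<^sup>2 * 1 \<le> (q / p)\<^sup>2 * real (b i j)" by (intro mult_left_mono) auto
      moreover have "p ^ card (K i - M) * p ^ card (K j - M) \<le> (q / p) * (q / p)"
        using k[OF i] k[OF j] by (intro mult_mono) auto
      ultimately have "p ^ card (K i - M) * p ^ card (K j - M) \<le> (q / p)\<^sup>2 * real (b i j)"
        by (simp add: power2_eq_square)
      thus ?thesis using zero_le_power2[of q] by linarith
    qed
  qed
  also have "\<dots> \<le> (\<Sum>i\<in>I. \<Sum>j\<in>two i. q\<^sup>2 + (q / p)\<^sup>2 * real (b i j))"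
    using once_two fin2 by (intro sum_mono sum_mono2) auto
  also have "\<dots> \<le> (\<Sum>i\<in>R. \<Sum>j\<in>two i. q\<^sup>2 + (q / p)\<^sup>2 * real (b i j))"
    using I gR by (intro sum_mono2 sum_nonneg) auto
  also have "\<dots> = \<mu> * (?c * q) + (q / p)\<^sup>2 * (\<Sum>f\<in>R. \<Sum>g\<in>two f. real (b f g))"
    unfolding sum.distrib Wc by (simp add: sum_distrib_left)
  finally have "S2 I \<le> 1/2 * (1/p - 1) * (\<mu> * (?c * q) + (q / p)\<^sup>2 * (\<Sum>f\<in>R. \<Sum>g\<in>two f. real (b f g)))"
    unfolding S2_def W.second_sum_def using inv_p by (intro mult_left_mono) auto
  also have "\<dots> = \<Lambda> + (q / p)\<^sup>2 * (\<Sum>f\<in>R. \<Sum>g\<in>two f. real (b f g)) * (1/2 * (1/p - 1))"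
    by (simp only: \<Lambda>_def distrib_left mult_ac)
  finally show "S2 I \<le> \<Lambda> + edge_rate * card M * (d2 / p)" using bsum by linarith
  \<comment> \<open>The terms on the left are \<open>q\<^sup>2\<close> for an untouched pair and at
    most 0 otherwise, so the lower bound may keep the untouched pairs only.\<close>
  have row: "(\<Sum>j\<in>two i. q\<^sup>2 - q\<^sup>2 * real (b i j))
      \<le> (if i \<in> good M then \<Sum>j\<in>W.once (good M - {i}) i. p ^ card (K i - M) * p ^ card (K j - M) else 0)"
    if i: "i \<in> R" for i
  proof (cases "m i M = 0")
    case False
    have "(\<Sum>j\<in>two i. q\<^sup>2 - q\<^sup>2 * real (b i j)) \<le> 0"
    proof (rule sum_nonpos)
      fix j
      have "q\<^sup>2 * 1 \<le> q\<^sup>2 * real (b i j)" using False by (intro mult_left_mono) (auto simp: b_def)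
      thus "q\<^sup>2 - q\<^sup>2 * real (b i j) \<le> 0" by simp
    qed
    also have "0 \<le> (if i \<in> good M then \<Sum>j\<in>W.once (good M - {i}) i. p ^ card (K i - M) * p ^ card (K j - M) else 0)"
      using p_bounds by (auto intro!: sum_nonneg)
    finally show ?thesis .
  next
    case True
    hence ig: "i \<in> good M" using i by (simp add: good_def)
    have "(\<Sum>j\<in>two i. q\<^sup>2 - q\<^sup>2 * real (b i j)) \<le> (\<Sum>j | j \<in> two i \<and> m j M = 0. q\<^sup>2)"
    proof -
      have "(\<Sum>j\<in>two i. q\<^sup>2 - q\<^sup>2 * real (b i j)) \<le> (\<Sum>j\<in>two i. if m j M = 0 then q\<^sup>2 else 0)"
        using True by (intro sum_mono) (auto simp: b_def)
      thus ?thesis by (simp only: sum.inter_filter[OF fin2])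
    qed
    also have "\<dots> = (\<Sum>j | j \<in> two i \<and> m j M = 0. p ^ card (K i - M) * p ^ card (K j - M))"
      using True i by (intro sum.cong refl) (auto simp: power_Diff_m two_def power2_eq_square)
    also have "\<dots> \<le> (\<Sum>j\<in>W.once (good M - {i}) i. p ^ card (K i - M) * p ^ card (K j - M))"
    proof (rule sum_mono2)
      show "finite (W.once (good M - {i}) i)" using W.fin_I by (simp add: W.once_def)
      show "{j. j \<in> two i \<and> m j M = 0} \<subseteq> W.once (good M - {i}) i"
      proof
        fix j assume j: "j \<in> {j. j \<in> two i \<and> m j M = 0}"
        hence jR: "j \<in> R" and c: "card (i \<inter> j) = 2" by (auto simp: two_def)
        have "i \<noteq> j" using c RD(3)[OF i] r_ge by auto
        have "K i \<inter> M = {}" using True RD(2)[OF i] by (simp add: m_def)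
        hence "(K j - M) \<inter> (K i - M) = K i \<inter> K j" by auto
        hence "card ((K j - M) \<inter> (K i - M)) = 1" using c by (simp add: card_K_Int[OF i])
        thus "j \<in> W.once (good M - {i}) i" using j jR \<open>i \<noteq> j\<close> by (auto simp: W.once_def good_def)
      qed
    qed (use p_bounds in auto)
    finally show ?thesis using ig by simp
  qed
  have "\<mu> * (?c * q) - q\<^sup>2 * (\<Sum>f\<in>R. \<Sum>g\<in>two f. real (b f g)) = (\<Sum>i\<in>R. \<Sum>j\<in>two i. q\<^sup>2 - q\<^sup>2 * real (b i j))"
    unfolding sum_subtractf Wc by (simp add: sum_distrib_left)
  also have "\<dots> \<le> (\<Sum>i\<in>R. if i \<in> good M then \<Sum>j\<in>W.once (good M - {i}) i. p ^ card (K i - M) * p ^ card (K j - M) else 0)"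
    by (intro sum_mono row)
  also have "\<dots> = (\<Sum>i\<in>good M. \<Sum>j\<in>W.once (good M - {i}) i. p ^ card (K i - M) * p ^ card (K j - M))"
    using gR by (subst sum.inter_filter[OF fin_R, symmetric]) (simp add: Int_absorb1 Collect_conj_eq)
  finally have "1/2 * (1/p - 1) * (\<mu> * (?c * q) - q\<^sup>2 * (\<Sum>f\<in>R. \<Sum>g\<in>two f. real (b f g))) \<le> S2 (good M)"
    unfolding S2_def W.second_sum_def using inv_p by (intro mult_left_mono) auto
  moreover have "1/2 * (1/p - 1) * (\<mu> * (?c * q) - q\<^sup>2 * (\<Sum>f\<in>R. \<Sum>g\<in>two f. real (b f g)))
    = \<Lambda> - q\<^sup>2 * (\<Sum>f\<in>R. \<Sum>g\<in>two f. real (b f g)) * (1/2 * (1/p - 1))"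
    by (simp only: \<Lambda>_def right_diff_distrib mult_ac)
  moreover have "q\<^sup>2 * (\<Sum>f\<in>R. \<Sum>g\<in>two f. real (b f g)) * (1/2 * (1/p - 1))
    \<le> (q / p)\<^sup>2 * (\<Sum>f\<in>R. \<Sum>g\<in>two f. real (b f g)) * (1/2 * (1/p - 1))"
  proof (intro mult_right_mono power_mono)
    show "q \<le> q / p" using q_pos p_pos p_lt_1 by (simp add: field_simps)
  qed (use q_pos inv_p in \<open>auto intro!: sum_nonneg\<close>)
  ultimately show "\<Lambda> - edge_rate * card M * (d2 / p) \<le> S2 (good M)" using bsum by linarith
qed

text \<open>\<open>s\<close> is the allowed deviation of the number of hyperedges from
  \<open>\<mu>\<close>, \<open>k\<close> bounds the number omitted from the core, \<open>P\<close>
  bounds \<open>pairs\<close> and \<open>B\<close> bounds \<open>bad_sum\<close>. The last term is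
  the price of recovering \<open>F\<close> from its core; the one before comes from
  \<open>rate_gap\<close>.\<close>

definition err :: "real \<Rightarrow> nat \<Rightarrow> real \<Rightarrow> real \<Rightarrow> real" where
  "err s k P B = rate * (s + k + P) + B / (1 - p) + 2 * \<mu> * (q * (1 + real (r choose 2) / p) + q / p)
     + 2 * \<mu> * rate * (d2 / p) + (\<mu> + 2 * \<mu> * rate) * (d3 / p + 6 * (d2 / p)\<^sup>2 / p + 2 * (q / p))
     + \<mu> * rate * (real r)\<^sup>2 / real (n - 2) + 2 * real k * ln (real (Suc (card R)))"

text \<open>The two products differ only by \<open>(n - 2) choose (r - 2)\<close> against
  \<open>(n - r) choose (r - 2)\<close>. By \<open>choose_diff_le\<close> and absorption the
  relative loss is at most \<open>r\<^sup>2 / (n - 2)\<close>.\<close>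

lemma rate_gap: "\<mu> * rate \<le> 2 * \<Lambda> + \<mu> * rate * (real r)\<^sup>2 / real (n - 2)"
proof -
  define a where "a = real ((n - 2) choose (r - 2))"
  define b where "b = real ((n - r) choose (r - 2))"
  have n2: "0 < n - 2" using r_ge r_le by simp
  have *: "(n - 2) choose (r - 2) \<le> ((n - 2 - (r - 2)) choose (r - 2)) + (r - 2) * ((n - 2 - 1) choose (r - 2 - 1))"
    using r_ge r_le by (intro choose_diff_le) auto
  have 1: "(n - 2) choose (r - 2) \<le> ((n - r) choose (r - 2)) + (r - 2) * ((n - 2 - 1) choose (r - 2 - 1))"
  proof -
    have eq: "n - 2 - (r - 2) = n - r" using r_ge by simp
    from * show ?thesis unfolding eq .
  qed
  have absorb: "(n - 2) * ((n - 2 - 1) choose (r - 2 - 1)) = (r - 2) * ((n - 2) choose (r - 2))"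
    using Suc_times_binomial_eq[of "n - 2 - 1" "r - 2 - 1"] n2 r_ge by (simp add: Suc_diff_Suc mult.commute numeral_eq_Suc)
  have "(n - 2) * ((n - 2) choose (r - 2)) \<le> (n - 2) * ((n - r) choose (r - 2)) + (r - 2) * ((n - 2) * ((n - 2 - 1) choose (r - 2 - 1)))"
    using mult_le_mono2[OF 1, of "n - 2"] by (simp only: add_mult_distrib2 mult_ac)
  also have "\<dots> = (n - 2) * ((n - r) choose (r - 2)) + (r - 2) * ((r - 2) * ((n - 2) choose (r - 2)))"
    unfolding absorb ..
  also have "\<dots> \<le> (n - 2) * ((n - r) choose (r - 2)) + r * (r * ((n - 2) choose (r - 2)))"
    by (intro add_left_mono mult_le_mono) auto
  finally have "real ((n - 2) * ((n - 2) choose (r - 2))) \<le> real ((n - 2) * ((n - r) choose (r - 2)) + r * (r * ((n - 2) choose (r - 2))))"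
    by (simp only: of_nat_le_iff)
  hence 2: "real (n - 2) * a \<le> real (n - 2) * b + (real r)\<^sup>2 * a"
    unfolding a_def b_def by (simp add: power2_eq_square)
  have "a \<le> b + (real r)\<^sup>2 * a / real (n - 2)"
  proof -
    have "a = real (n - 2) * a / real (n - 2)" using n2 by simp
    also have "\<dots> \<le> (real (n - 2) * b + (real r)\<^sup>2 * a) / real (n - 2)"
      using 2 by (rule divide_right_mono) simp
    also have "\<dots> = b + (real r)\<^sup>2 * a / real (n - 2)" using n2 by (simp add: add_divide_distrib)
    finally show ?thesis .
  qed
  define c where "c = \<mu> * (q * (1/p - 1) * real (r choose 2))"
  have "0 \<le> c" unfolding c_def using \<mu>_pos q_pos inv_p by (intro mult_nonneg_nonneg) auto
  hence "c * a \<le> c * (b + (real r)\<^sup>2 * a / real (n - 2))"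
    using \<open>a \<le> _\<close> by (intro mult_left_mono)
  moreover have "\<mu> * rate = c * a" "2 * \<Lambda> = c * b"
    by (simp_all add: rate_def edge_rate_def \<Lambda>_def a_def b_def c_def)
  ultimately show ?thesis by (simp add: distrib_left mult.left_commute mult.commute)
qed

text \<open>
  For the upper bound only the edges of the core are conditioned on, and only the sets meeting them in
  at most one edge are required not to be cliques.
\<close>

lemma PH_upper_aux:
  assumes F: "F \<subseteq> R" and small: "d2 / p \<le> 1/2" "q / p \<le> 1/2"
  defines "M \<equiv> U (core F)"
  shows "\<exists>S1 S2. PH F \<le> p ^ card (U F) * exp (- S1 + S2 + S1 * (d3 / p + 6 * (d2 / p)\<^sup>2))
    \<and> S1 \<le> \<mu> + edge_rate * card M
    \<and> \<mu> + edge_rate * card M - bad_sum (core F) - card F * (q * (1 + real (r choose 2) / p) + q / p) \<le> S1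
    \<and> S2 \<le> \<Lambda> + edge_rate * card M * (d2 / p)"
proof -
  have cR: "core F \<subseteq> R" using F core_sub by blast
  have finF: "finite F" using F finite_subset[OF _ fin_R] by blast
  have M: "M \<subseteq> E" using cR by (simp add: M_def U_sub)
  interpret W: weakly_dependent_events p E "good M" "\<lambda>f. K f - M" "d2 / p" "d3 / p" "q / p"
    using M small by (rule weakly_dependent_good)
  have gR: "good M \<subseteq> R" by (auto simp: good_def)
  define I where "I = good M - F"
  have I: "I \<subseteq> good M" by (auto simp: I_def)
  have first: "W.first_sum A = (\<Sum>f\<in>A. q / p ^ m f M)" if "A \<subseteq> good M" for A
    unfolding W.first_sum_def using that gR by (intro sum.cong refl power_Diff_m) auto
  have k: "0 \<le> q / p ^ m f M" for f using q_pos p_pos by simp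
  have MF: "M \<subseteq> U F" using core_sub[of F] by (auto simp: M_def U_def)
  have "prb (\<lambda>w. \<forall>f\<in>R - F. \<not> K f \<subseteq> w \<union> U F) \<le> prb (W.none I)"
  proof (rule pr_mono)
    fix w assume w: "\<forall>f\<in>R - F. \<not> K f \<subseteq> w \<union> U F"
    show "W.none I w" unfolding W.none_def
    proof
      fix f assume "f \<in> I"
      hence "f \<in> R - F" using gR by (auto simp: I_def)
      hence "\<not> K f \<subseteq> w \<union> U F" using w by blast
      thus "\<not> K f - M \<subseteq> w" using MF by blast
    qed
  qed
  also have "\<dots> \<le> exp (- W.first_sum I + W.second_sum I + W.first_sum I * (d3 / p + 6 * (d2 / p)\<^sup>2))"
    by (rule W.pr_none_upper[OF I])
  finally have "PH F \<le> p ^ card (U F) * exp (- W.first_sum I + W.second_sum I + W.first_sum I * (d3 / p + 6 * (d2 / p)\<^sup>2))"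
    unfolding PH_eq[OF F] using p_bounds by (intro mult_left_mono) auto
  moreover have "W.first_sum I \<le> \<mu> + edge_rate * card M"
  proof -
    have "W.first_sum I \<le> (\<Sum>f\<in>good M. q / p ^ m f M)"
      unfolding first[OF I] using I W.fin_I k by (intro sum_mono2) auto
    thus ?thesis using good_first_sum(2)[OF cR] by (simp add: M_def)
  qed
  moreover have "\<mu> + edge_rate * card M - bad_sum (core F) - card F * (q * (1 + real (r choose 2) / p) + q / p) \<le> W.first_sum I"
  proof -
    \<comment> \<open>Members of \<open>F\<close> outside the core may be good for \<open>M\<close>,
      but their being cliques is not to be avoided. They are taken out, and each weighs at most
      \<open>q / p\<close>.\<close>
    have "(\<Sum>f\<in>good M. q / p ^ m f M) = (\<Sum>f\<in>good M \<inter> F. q / p ^ m f M) + W.first_sum I"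
      unfolding first[OF I] unfolding I_def using W.fin_I by (rule sum.Int_Diff)
    moreover have "(\<Sum>f\<in>good M \<inter> F. q / p ^ m f M) \<le> card F * (q / p)"
    proof -
      have "(\<Sum>f\<in>good M \<inter> F. q / p ^ m f M) \<le> (\<Sum>f\<in>good M \<inter> F. q / p)"
        using W.kappa gR by (intro sum_mono) (auto simp: power_Diff_m[symmetric])
      also have "\<dots> \<le> (\<Sum>f\<in>F. q / p)" using finF q_pos p_pos by (intro sum_mono2) auto
      finally show ?thesis by simp
    qed
    moreover have "\<mu> + edge_rate * card M - bad_sum (core F) - card (core F) * (q * (1 + real (r choose 2) / p))
      \<le> (\<Sum>f\<in>good M. q / p ^ m f M)"
      using good_first_sum(1)[OF cR] by (simp add: M_def)
    moreover have "card (core F) * (q * (1 + real (r choose 2) / p)) \<le> card F * (q * (1 + real (r choose 2) / p))"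
      using card_mono[OF finF core_sub] q_pos p_pos by (intro mult_right_mono) auto
    ultimately show ?thesis by (simp add: distrib_left)
  qed
  moreover have "W.second_sum I \<le> \<Lambda> + edge_rate * card M * (d2 / p)"
    by (rule good_second_sum(1)[OF M small I])
  ultimately show ?thesis by blast
qed

text \<open>From \<open>1 / (1 - x) = 1 + x / (1 - x) \<le> exp (x / (1 - x))\<close> and
  \<open>1 - x \<ge> 1 - p\<close>.\<close>

lemma exp_le_one_minus: "0 \<le> x \<Longrightarrow> x \<le> p \<Longrightarrow> exp (- x / (1 - p)) \<le> 1 - x"
proof -
  assume x: "0 \<le> x" "x \<le> p"
  have "1 / (1 - x) = 1 + x / (1 - x)" using x p_lt_1 by (simp add: field_simps)
  also have "\<dots> \<le> exp (x / (1 - x))" using exp_ge_add_one_self by simp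
  also have "\<dots> \<le> exp (x / (1 - p))" using x p_lt_1 by (simp add: frac_le)
  finally have "1 \<le> (1 - x) * exp (x / (1 - p))" using x p_lt_1 by (simp add: field_simps)
  moreover have "exp (- x / (1 - p)) = 1 / exp (x / (1 - p))" by (simp add: exp_minus inverse_eq_divide)
  ultimately show ?thesis by (simp add: pos_divide_le_eq)
qed

text \<open>Harris' inequality, one set at a time. A set whose edges are not all in \<open>M\<close>
  lacks at least one edge, so its probability is at most \<open>p\<close>, as
  \<open>exp_le_one_minus\<close> requires.\<close>

lemma pr_avoid:
  assumes "finite A" "\<And>f. f \<in> A \<Longrightarrow> f \<in> R \<and> \<not> K f \<subseteq> M" and Q: "\<And>a b. a \<subseteq> b \<Longrightarrow> Q b \<Longrightarrow> Q a"
  shows "prb Q * exp (- (\<Sum>f\<in>A. q / p ^ m f M) / (1 - p)) \<le> prb (\<lambda>w. Q w \<and> (\<forall>f\<in>A. \<not> K f - M \<subseteq> w))"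
  using assms(1,2)
proof (induction A rule: finite_induct)
  case (insert f A)
  have f: "f \<in> R" "\<not> K f \<subseteq> M" using insert.prems by auto
  let ?x = "q / p ^ m f M"
  have px: "prb (\<lambda>w. K f - M \<subseteq> w) = ?x"
    using K_sub[OF f(1)] by (subst pr_superset) (auto simp: power_Diff_m[OF f(1)])
  have "K f - M \<noteq> {}" using f by auto
  hence "1 \<le> card (K f - M)" using RD(2)[OF f(1)] by (simp add: Suc_leI card_gt_0_iff)
  hence "p ^ card (K f - M) \<le> p ^ 1" using p_bounds by (intro power_decreasing) auto
  hence x: "0 \<le> ?x" "?x \<le> p" using q_pos p_pos by (auto simp: power_Diff_m[OF f(1)])
  have "prb Q * exp (- (\<Sum>f\<in>insert f A. q / p ^ m f M) / (1 - p))
    = (prb Q * exp (- (\<Sum>f\<in>A. q / p ^ m f M) / (1 - p))) * exp (- ?x / (1 - p))"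
    using insert.hyps by (simp add: exp_add[symmetric] diff_divide_distrib)
  also have "\<dots> \<le> prb (\<lambda>w. Q w \<and> (\<forall>f\<in>A. \<not> K f - M \<subseteq> w)) * (1 - ?x)"
    using insert.IH insert.prems exp_le_one_minus[OF x] by (intro mult_mono pr_nonneg) auto
  also have "1 - ?x = prb (\<lambda>w. \<not> K f - M \<subseteq> w)" by (simp add: pr_Not px)
  also have "prb (\<lambda>w. Q w \<and> (\<forall>f\<in>A. \<not> K f - M \<subseteq> w)) * prb (\<lambda>w. \<not> K f - M \<subseteq> w)
    \<le> prb (\<lambda>w. (Q w \<and> (\<forall>f\<in>A. \<not> K f - M \<subseteq> w)) \<and> \<not> K f - M \<subseteq> w)"
  proof (rule harris_dec)
    fix a b :: "nat set set" assume ab: "a \<subseteq> b"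
    show "Q a \<and> (\<forall>f\<in>A. \<not> K f - M \<subseteq> a)" if "Q b \<and> (\<forall>f\<in>A. \<not> K f - M \<subseteq> b)"
      using that Q[OF ab] ab by blast
    show "\<not> K f - M \<subseteq> a" if "\<not> K f - M \<subseteq> b" using that ab by blast
  qed
  also have "\<dots> = prb (\<lambda>w. Q w \<and> (\<forall>f\<in>insert f A. \<not> K f - M \<subseteq> w))"
    by (intro pr_cong) auto
  finally show ?case .
qed simp

text \<open>For a lower bound all sets outside \<open>F\<close> must be avoided: the good ones by
  the Janson bound, the rest by \<open>pr_avoid\<close>, which is applicable because no set is
  covered.\<close>

lemma PH_lower_aux:
  assumes F: "F \<subseteq> R" and small: "d2 / p \<le> 1/2" "q / p \<le> 1/2" and cov: "covered F = {}"
  defines "M \<equiv> U F"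
  shows "\<exists>S1 S2. p ^ card M * exp (- S1 + S2 - S1 * (d3 / p + 6 * (d2 / p)\<^sup>2 / p + 2 * (q / p)) - bad_sum F / (1 - p)) \<le> PH F
    \<and> S1 \<le> \<mu> + edge_rate * card M
    \<and> \<Lambda> - edge_rate * card M * (d2 / p) \<le> S2"
proof -
  have M: "M \<subseteq> E" using F by (simp add: M_def U_sub)
  interpret W: weakly_dependent_events p E "good M" "\<lambda>f. K f - M" "d2 / p" "d3 / p" "q / p"
    using M small by (rule weakly_dependent_good)
  have gR: "good M \<subseteq> R" by (auto simp: good_def)
  have first: "W.first_sum (good M) = (\<Sum>f\<in>good M. q / p ^ m f M)"
    unfolding W.first_sum_def using gR by (intro sum.cong refl power_Diff_m) auto
  define A where "A = {f. f \<in> R - F \<and> 2 \<le> m f M}"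
  have finA: "finite A" by (simp add: A_def)
  have "exp (- W.first_sum (good M) + W.second_sum (good M)
      - W.first_sum (good M) * (d3 / p + 6 * (d2 / p)\<^sup>2 / p + 2 * (q / p)) - bad_sum F / (1 - p))
    = exp (- W.first_sum (good M) + W.second_sum (good M)
      - W.first_sum (good M) * (d3 / p + 6 * (d2 / p)\<^sup>2 / p + 2 * (q / p))) * exp (- bad_sum F / (1 - p))"
    by (simp add: exp_add[symmetric])
  also have "\<dots> \<le> prb (W.none (good M)) * exp (- bad_sum F / (1 - p))"
    by (intro mult_right_mono W.pr_none_lower) auto
  also have "\<dots> \<le> prb (\<lambda>w. W.none (good M) w \<and> (\<forall>f\<in>A. \<not> K f - M \<subseteq> w))"
    unfolding bad_sum_def M_def[symmetric] A_def[symmetric]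
  proof (rule pr_avoid[OF finA])
    fix f assume "f \<in> A"
    thus "f \<in> R \<and> \<not> K f \<subseteq> M" using cov by (auto simp: A_def covered_def M_def)
  qed (rule W.none_dec)
  also have "\<dots> \<le> prb (\<lambda>w. \<forall>f\<in>R - F. \<not> K f \<subseteq> w \<union> M)"
  proof (rule pr_mono)
    fix w assume w: "W.none (good M) w \<and> (\<forall>f\<in>A. \<not> K f - M \<subseteq> w)"
    show "\<forall>f\<in>R - F. \<not> K f \<subseteq> w \<union> M"
    proof
      fix f assume f: "f \<in> R - F"
      have "f \<in> good M \<or> f \<in> A" using f by (auto simp: good_def A_def)
      hence "\<not> K f - M \<subseteq> w" using w unfolding W.none_def by blast
      thus "\<not> K f \<subseteq> w \<union> M" by blast
    qed
  qed
  finally have "p ^ card M * exp (- W.first_sum (good M) + W.second_sum (good M)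
      - W.first_sum (good M) * (d3 / p + 6 * (d2 / p)\<^sup>2 / p + 2 * (q / p)) - bad_sum F / (1 - p)) \<le> PH F"
    unfolding PH_eq[OF F] M_def[symmetric] using p_bounds by (intro mult_left_mono) auto
  moreover have "W.first_sum (good M) \<le> \<mu> + edge_rate * card M"
    unfolding first using good_first_sum(2)[OF F] by (simp add: M_def)
  moreover have "\<Lambda> - edge_rate * card M * (d2 / p) \<le> W.second_sum (good M)"
    using good_second_sum(2)[OF M small, of "good M"] by simp
  ultimately show ?thesis by blast
qed

text \<open>Everything hinges on \<open>X\<close>, the increase of the mean due to the core edges,
  being close to \<open>\<mu> * rate\<close> and so to \<open>2 * \<Lambda>\<close>; then
  \<open>- S1 + S2\<close> is about \<open>- \<mu> - \<Lambda>\<close>. The upper bound needs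
  \<open>X\<close> from below, the lower bound needs it from above. The latter is proved for the
  core and passed on to \<open>F\<close> by the last assumption.\<close>

theorem PH_bounds:
  assumes F: "F \<subseteq> R" and small: "d2 / p \<le> 1/2" "q / p \<le> 1/2"
    and s: "\<bar>real (card F) - \<mu>\<bar> \<le> s" "s \<le> \<mu>" and k: "card (F - core F) \<le> k"
    and P: "real (pairs F) \<le> P" and B: "bad_sum (core F) \<le> B" and cov: "covered (core F) = {}"
    and drop: "PH (core F) / real (Suc (card R)) ^ (2 * k) \<le> PH F"
  shows "p ^ card (U F) * exp (- \<mu> - \<Lambda> - err s k P B) \<le> PH F"
    and "PH F \<le> p ^ card (U F) * exp (- \<mu> - \<Lambda> + err s k P B)"
proof -
  define M where "M = U (core F)"
  have cR: "core F \<subseteq> R" using F core_sub by blast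
  have finF: "finite F" using F finite_subset[OF _ fin_R] by blast
  define X where "X = edge_rate * card M"
  define \<tau> where "\<tau> = q * (1 + real (r choose 2) / p) + q / p"
  define gap where "gap = \<mu> * rate * (real r)\<^sup>2 / real (n - 2)"
  define N where "N = real (Suc (card R))"
  define \<delta> where "\<delta> = d2 / p"
  define e where "e = d3 / p + 6 * \<delta>\<^sup>2 / p + 2 * (q / p)"
  have nn: "0 \<le> \<tau>" "0 \<le> gap" "0 \<le> \<delta>" "0 \<le> d3 / p" "0 \<le> q / p" "0 \<le> s" "0 \<le> P" "0 \<le> edge_rate" "0 \<le> rate" "0 \<le> B"
    using q_pos p_pos \<mu>_pos rate_nonneg d2_nonneg d3_nonneg s(1) P edge_rate_nonneg
    by (auto simp: \<tau>_def gap_def \<delta>_def bad_sum_def intro!: order_trans[OF sum_nonneg B[unfolded bad_sum_def]])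
  have \<delta>2: "\<delta>\<^sup>2 \<le> \<delta>\<^sup>2 / p"
    using p_pos p_lt_1 by (simp add: field_simps mult_left_le_one_le)
  have e0: "0 \<le> e" "d3 / p + 6 * \<delta>\<^sup>2 \<le> e" using nn \<delta>2 p_pos by (auto simp: e_def)
  have N1: "1 \<le> N" by (simp add: N_def)
  have cF: "real (card F) \<le> \<mu> + s" "\<mu> - s \<le> real (card F)" "real (card F) \<le> 2 * \<mu>" using s by auto
  have ccore: "card F = card (core F) + card (F - core F)"
    using card_Un_disjoint[of "core F" "F - core F"] finF core_sub[of F] finite_subset[OF core_sub finF]
    by (simp add: Un_absorb1)
  have X_le: "X \<le> rate * card F"
  proof -
    have "card M \<le> (r choose 2) * card F"
      using card_U_le[OF cR] card_mono[OF finF core_sub[of F]] by (auto simp: M_def intro: order_trans)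
    hence "real (card M) \<le> real (r choose 2) * real (card F)" by (simp flip: of_nat_mult)
    thus ?thesis unfolding X_def rate_def mult.assoc using nn by (intro mult_left_mono) auto
  qed
  have X_ge: "\<mu> * rate - rate * (s + k + P) \<le> X"
  proof -
    have "real ((r choose 2) * card (core F)) \<le> real (card M + pairs F)"
      using card_U_core_ge[OF F] by (simp only: of_nat_le_iff M_def)
    hence "edge_rate * (real (r choose 2) * card (core F)) \<le> edge_rate * (card M + P)"
      using nn P by (intro mult_left_mono) auto
    hence "rate * card (core F) \<le> X + edge_rate * P" by (simp add: rate_def X_def algebra_simps)
    also have "edge_rate * P \<le> rate * P" using edge_rate_le nn by (intro mult_right_mono) auto
    finally have 1: "rate * card (core F) \<le> X + rate * P" by simp
    have "\<mu> - s - k \<le> real (card (core F))" using cF ccore k by linarith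
    hence "rate * (\<mu> - s - k) \<le> rate * card (core F)" using nn by (intro mult_left_mono)
    thus ?thesis using 1 by (simp add: algebra_simps)
  qed
  have X0: "0 \<le> X" using nn by (simp add: X_def)
  have X_2: "X \<le> 2 * \<mu> * rate" using X_le mult_left_mono[OF cF(3), of rate] nn by (simp add: mult_ac)
  have X_s: "X \<le> \<mu> * rate + rate * s" using X_le mult_left_mono[OF cF(1), of rate] nn by (simp add: algebra_simps)
  have X\<delta>: "X * \<delta> \<le> 2 * \<mu> * rate * \<delta>" using X_2 nn by (intro mult_right_mono)
  have \<Lambda>_le: "2 * \<Lambda> \<le> \<mu> * rate"
  proof -
    have "real ((n - r) choose (r - 2)) \<le> real ((n - 2) choose (r - 2))"
      using r_ge by (intro of_nat_mono binomial_right_mono) auto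
    hence "\<mu> * (real (r choose 2) * q * (1/p - 1)) * real ((n - r) choose (r - 2))
      \<le> \<mu> * (real (r choose 2) * q * (1/p - 1)) * real ((n - 2) choose (r - 2))"
      using \<mu>_pos q_pos inv_p by (intro mult_left_mono) auto
    thus ?thesis by (simp add: \<Lambda>_def rate_def edge_rate_def mult_ac)
  qed
  have gap: "\<mu> * rate \<le> 2 * \<Lambda> + gap" using rate_gap by (simp add: gap_def)
  have F\<tau>: "card F * \<tau> \<le> 2 * \<mu> * \<tau>" using cF nn by (intro mult_right_mono)
  have BB: "B \<le> B / (1 - p)" using nn p_pos p_lt_1 by (simp add: field_simps mult_left_le)
  have \<mu>_rest: "0 \<le> 2 * \<mu> * \<tau>" "0 \<le> 2 * \<mu> * rate * \<delta>" using \<mu>_pos nn by simp_all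
  have lnN: "0 \<le> 2 * real k * ln N" using N1 by simp
  have err_eq: "err s k P B = rate * (s + k + P) + B / (1 - p) + 2 * \<mu> * \<tau> + 2 * \<mu> * rate * \<delta>
      + (\<mu> + 2 * \<mu> * rate) * e + gap + 2 * real k * ln N"
    by (simp add: err_def \<tau>_def gap_def \<delta>_def e_def N_def)
  have S1e: "S1 * e' \<le> (\<mu> + 2 * \<mu> * rate) * e" if "S1 \<le> \<mu> + X" "e' \<le> e" "0 \<le> e'" for S1 e'
  proof -
    have "S1 * e' \<le> (\<mu> + 2 * \<mu> * rate) * e'" using that X_2 by (intro mult_right_mono) auto
    also have "\<dots> \<le> (\<mu> + 2 * \<mu> * rate) * e" using that \<mu>_pos nn by (intro mult_left_mono) auto
    finally show ?thesis .
  qed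
  obtain S1 S2 where up: "PH F \<le> p ^ card (U F) * exp (- S1 + S2 + S1 * (d3 / p + 6 * \<delta>\<^sup>2))"
    "S1 \<le> \<mu> + X" "\<mu> + X - bad_sum (core F) - card F * \<tau> \<le> S1" "S2 \<le> \<Lambda> + X * \<delta>"
    using PH_upper_aux[OF F small] unfolding X_def \<tau>_def \<delta>_def M_def by blast
  have "- S1 + S2 + S1 * (d3 / p + 6 * \<delta>\<^sup>2) \<le> - \<mu> - \<Lambda> + err s k P B"
  proof -
    have "S1 * (d3 / p + 6 * \<delta>\<^sup>2) \<le> (\<mu> + 2 * \<mu> * rate) * e"
      using up(2) e0(2) nn by (intro S1e) auto
    thus ?thesis
      using up(3,4) X_ge X\<delta> \<Lambda>_le F\<tau> BB lnN nn B \<mu>_rest unfolding err_eq by linarith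
  qed
  hence "exp (- S1 + S2 + S1 * (d3 / p + 6 * \<delta>\<^sup>2)) \<le> exp (- \<mu> - \<Lambda> + err s k P B)" by simp
  thus "PH F \<le> p ^ card (U F) * exp (- \<mu> - \<Lambda> + err s k P B)"
    using up(1) p_bounds by (meson mult_left_mono order_trans zero_le_power)
  obtain T1 T2 where lo: "p ^ card M * exp (- T1 + T2 - T1 * e - bad_sum (core F) / (1 - p)) \<le> PH (core F)"
    "T1 \<le> \<mu> + X" "\<Lambda> - X * \<delta> \<le> T2"
    using PH_lower_aux[OF cR small cov] unfolding X_def e_def \<delta>_def M_def by blast
  have le: "- \<mu> - \<Lambda> - err s k P B \<le> - T1 + T2 - T1 * e - bad_sum (core F) / (1 - p) - 2 * real k * ln N"
  proof -
    have "T1 * e \<le> (\<mu> + 2 * \<mu> * rate) * e" using lo(2) e0 by (intro S1e) auto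
    moreover have "bad_sum (core F) / (1 - p) \<le> B / (1 - p)" using B p_lt_1 by (simp add: divide_right_mono)
    moreover have "rate * s \<le> rate * (s + k + P)" using nn by (intro mult_left_mono) auto
    moreover have "0 \<le> 2 * \<mu> * \<tau>" using \<mu>_pos nn by simp
    ultimately show ?thesis
      using lo(2,3) X_s X\<delta> gap lnN unfolding err_eq by linarith
  qed
  \<comment> \<open>\<open>F\<close> has at least the edges of its core, so for the lower bound the
    smaller power \<open>p ^ card (U F)\<close> can take the place of
    \<open>p ^ card M\<close>.\<close>
  have "card M \<le> card (U F)"
    using core_sub[of F] by (intro card_mono finite_U[OF F]) (auto simp: M_def U_def)
  hence pM: "p ^ card (U F) \<le> p ^ card M" using p_bounds by (intro power_decreasing) auto
  have "p ^ card (U F) * exp (- \<mu> - \<Lambda> - err s k P B)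
    \<le> p ^ card M * exp (- T1 + T2 - T1 * e - bad_sum (core F) / (1 - p) - 2 * real k * ln N)"
    using pM le p_bounds by (intro mult_mono) auto
  also have "\<dots> = p ^ card M * exp (- T1 + T2 - T1 * e - bad_sum (core F) / (1 - p)) / N ^ (2 * k)"
  proof -
    have "N ^ (2 * k) = exp (2 * real k * ln N)"
      using N1 exp_of_nat_mult[of "2 * k" "ln N"] by simp
    thus ?thesis by (simp add: exp_diff)
  qed
  also have "\<dots> \<le> PH (core F) / N ^ (2 * k)" using lo(1) N1 by (intro divide_right_mono) auto
  also have "\<dots> \<le> PH F" using drop by (simp add: N_def)
  finally show "p ^ card (U F) * exp (- \<mu> - \<Lambda> - err s k P B) \<le> PH F" .
qed

section \<open>The event that the approximation holds\<close>

lemma le_divide_p: "0 \<le> a \<Longrightarrow> a \<le> a / p"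
  using p_pos p_lt_1 mult_left_le[of p a] by (simp add: pos_le_divide_eq)

text \<open>The bound on \<open>card F\<close> is kept for \<open>no_clique_factor\<close>.\<close>

definition well_approximated :: "real \<Rightarrow> nat set set \<Rightarrow> bool" where
  "well_approximated e F \<longleftrightarrow> real (card F) \<le> 2 * \<mu> \<and> p ^ card (U F) * exp (- \<mu> - \<Lambda> - e) \<le> PH F
     \<and> PH F \<le> p ^ card (U F) * exp (- \<mu> - \<Lambda> + e)"

text \<open>Union bound over the ways in which the assumptions of \<open>PH_bounds\<close> can fail:
  Chebyshev's inequality for the number of hyperedges, Markov's for \<open>pairs\<close>, the
  omitted hyperedges and \<open>bad_sum\<close>, then \<open>pr_covered\<close> and
  \<open>pr_core_drop\<close>.\<close>

lemma pr_not_well_approximated: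
  assumes small: "d2 / p \<le> 1/2" "q / p \<le> 1/2" and s: "0 < s" "s \<le> \<mu>" and P: "0 < P" and B: "0 < B"
  shows "prb (\<lambda>w. \<not> well_approximated (err s k P B) (cl w))
    \<le> (\<mu> + \<mu> * d2) / s\<^sup>2 + \<mu> * d2 / P + \<mu> * (d3 + 2 * d2\<^sup>2 / p) / real (Suc k)
      + \<mu> / (1 - p)\<^sup>2 * (d3 / p + 3 * (d2 / p)\<^sup>2) / B + \<mu> / (1 - p) ^ 3 * (3 * (d2 / p) ^ 3)
      + 1 / real (Suc (card R))"
proof -
  define N where "N = real (Suc (card R))"
  define A1 where "A1 w \<longleftrightarrow> s\<^sup>2 \<le> (real (card (cl w)) - \<mu>)\<^sup>2" for w
  define A2 where "A2 w \<longleftrightarrow> P \<le> real (pairs (cl w))" for w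
  define A3 where "A3 w \<longleftrightarrow> real (Suc k) \<le> real (card (cl w - core (cl w)))" for w
  define A4 where "A4 w \<longleftrightarrow> B \<le> bad_sum (core (cl w))" for w
  define A5 where "A5 w \<longleftrightarrow> covered (core (cl w)) \<noteq> {}" for w
  define A6 where "A6 w \<longleftrightarrow> card (cl w - core (cl w)) \<le> k \<and> PH (cl w) < PH (core (cl w)) / N ^ (2 * k)" for w
  have u1: "d2 / p \<le> 1" using small(1) by linarith
  have "prb (\<lambda>w. \<not> well_approximated (err s k P B) (cl w)) \<le> prb (\<lambda>w. A1 w \<or> A2 w \<or> A3 w \<or> A4 w \<or> A5 w \<or> A6 w)"
  proof (rule pr_mono)
    fix w assume bad: "\<not> well_approximated (err s k P B) (cl w)"
    show "A1 w \<or> A2 w \<or> A3 w \<or> A4 w \<or> A5 w \<or> A6 w"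
    proof (rule ccontr)
      assume "\<not> ?thesis"
      hence c: "(real (card (cl w)) - \<mu>)\<^sup>2 < s\<^sup>2" "real (pairs (cl w)) < P"
        "card (cl w - core (cl w)) \<le> k" "bad_sum (core (cl w)) < B" "covered (core (cl w)) = {}"
        "PH (core (cl w)) / N ^ (2 * k) \<le> PH (cl w)"
        by (auto simp: A1_def A2_def A3_def A4_def A5_def A6_def)
      have "\<bar>real (card (cl w)) - \<mu>\<bar> \<le> s"
        using c(1) s(1) abs_le_square_iff[of "real (card (cl w)) - \<mu>" s] by simp
      moreover from this have "real (card (cl w)) \<le> 2 * \<mu>" using s by linarith
      ultimately have "well_approximated (err s k P B) (cl w)"
        unfolding well_approximated_def using c s small PH_bounds[OF cl_sub[of w] small, where s = s and k = k and P = P and B = B]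
        by (auto simp: N_def)
      thus False using bad by simp
    qed
  qed
  also have "\<dots> \<le> prb A1 + (prb A2 + (prb A3 + (prb A4 + (prb A5 + prb A6))))"
    by (intro order_trans[OF pr_disj_le] add_left_mono order_refl)
  also have "prb A1 \<le> (\<mu> + \<mu> * d2) / s\<^sup>2"
    unfolding A1_def using s by (intro markov second_moment) auto
  also have "prb A2 \<le> \<mu> * d2 / P"
    unfolding A2_def using P by (intro markov eq_refl[OF expec_pairs]) auto
  also have "prb A3 \<le> \<mu> * (d3 + 2 * d2\<^sup>2 / p) / real (Suc k)"
    unfolding A3_def by (intro markov expec_removed) auto
  also have "prb A4 \<le> \<mu> / (1 - p)\<^sup>2 * (d3 / p + 3 * (d2 / p)\<^sup>2) / B"
    unfolding A4_def using B q_pos p_pos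
    by (intro markov expec_bad_sum u1) (auto simp: bad_sum_def intro!: sum_nonneg)
  also have "prb A5 \<le> \<mu> / (1 - p) ^ 3 * (3 * (d2 / p) ^ 3)"
    unfolding A5_def by (rule pr_covered[OF u1])
  also have "prb A6 \<le> 1 / N"
    unfolding A6_def N_def by (rule pr_core_drop)
  finally show ?thesis by (simp add: N_def algebra_simps)
qed

lemma well_approximated_mono:
  assumes "well_approximated e F" "e \<le> e'" shows "well_approximated e' F"
proof -
  have "p ^ card (U F) * exp (- \<mu> - \<Lambda> - e') \<le> p ^ card (U F) * exp (- \<mu> - \<Lambda> - e)"
    "p ^ card (U F) * exp (- \<mu> - \<Lambda> + e) \<le> p ^ card (U F) * exp (- \<mu> - \<Lambda> + e')"
    using assms(2) p_bounds by (auto intro!: mult_left_mono)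
  thus ?thesis using assms(1) unfolding well_approximated_def by linarith
qed

text \<open>
  Here \<open>D\<close> plays the role of a power of \<open>ln n\<close> and \<open>x\<close> that of \<open>n\<close> to the power \<open>\<theta>\<close>.
\<close>

theorem typical:
  fixes D x :: real
  assumes D: "200 \<le> D" "D ^ 6 \<le> n" and x: "1 / n \<le> x" "x\<^sup>2 \<le> n" "x * (x + 1) ^ 3 * D ^ 11 \<le> (real n)\<^sup>2"
    and \<mu>: "D \<le> \<mu>" "\<mu> \<le> D * n * x"
    and d: "d3 \<le> D / n" "d2 \<le> D * (x + 1) / n" "rate \<le> D * x / n"
    and pD: "1 / p \<le> D" "1 / (1 - p) \<le> D" and rD: "real r \<le> D"
    and N: "ln (real (Suc (card R))) \<le> D\<^sup>2" "real n \<le> real (Suc (card R))"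
    and q: "q \<le> 1 / real n ^ 5"
  shows "prb (\<lambda>w. \<not> well_approximated (D ^ 10 * x) (cl w)) \<le> 29 / D"
proof -
  have D1: "1 \<le> D" "0 < D" "0 \<le> D" using D by auto
  have pw: "D ^ i \<le> D ^ j" if "i \<le> j" for i j using D1 that by (intro power_increasing)
  have nD: "D ^ 6 \<le> real n" using D by simp
  have "D ^ 1 \<le> D ^ 6" by (rule pw) simp
  hence n200: "200 \<le> real n" using nD D by simp
  hence n0: "0 < real n" "0 \<le> real n" by auto
  have "0 < 1 / real n" using n0 by simp
  hence x0: "0 < x" "0 \<le> x" using x(1) by linarith+
  have n1: "1 \<le> real n" using n200 by simp
  have xn: "x \<le> n"
  proof (cases "x \<le> 1")
    case False
    hence "x * 1 \<le> x * x" using x0 by (intro mult_left_mono) auto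
    thus ?thesis using x(2) by (simp add: power2_eq_square)
  qed (use n1 in simp)
  have xx: "x * (x + 1) \<le> 2 * n" using x(2) xn by (simp add: power2_eq_square algebra_simps)
  have "2 * x \<le> x\<^sup>2 + 1" using sum_squares_bound[of x 1] by simp
  hence x2: "(x + 1)\<^sup>2 \<le> 4 * n" using x(2) n200 by (simp add: power2_eq_square algebra_simps)
  have x2n: "(x + 1)\<^sup>2 / n \<le> 4" using x2 n0 by (simp add: field_simps)
  have xxn: "x * (x + 1) / n \<le> 2" using xx n0 by (simp add: field_simps)
  have xdn: "x / n \<le> 1" using xn n0 by simp
  have x2d: "x\<^sup>2 / n \<le> 1" using x(2) n0 by simp
  have p1: "0 \<le> 1/p" "0 \<le> 1/(1-p)" using p_pos p_lt_1 by auto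
  have dp: "d2 / p \<le> D ^ 2 * (x + 1) / n"
  proof -
    have "d2 * (1/p) \<le> (D * (x + 1) / n) * D" using d pD d2_nonneg p1 D1 x0 by (intro mult_mono) auto
    thus ?thesis by (simp add: power2_eq_square mult_ac)
  qed
  have dp0: "0 \<le> d2 / p" using d2_nonneg p_pos by simp
  have d3p: "d3 / p \<le> D ^ 2 / n"
  proof -
    have "d3 * (1/p) \<le> (D / n) * D" using d pD d3_nonneg p1 D1 by (intro mult_mono) auto
    thus ?thesis by (simp add: power2_eq_square mult_ac)
  qed
  have qp: "q / p \<le> D / real n ^ 5"
  proof -
    have "q * (1/p) \<le> (1 / real n ^ 5) * D" using q pD q_pos p1 by (intro mult_mono) auto
    thus ?thesis by simp
  qed
  have dp2: "(d2 / p)\<^sup>2 \<le> 4 * D ^ 4 / n"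
  proof -
    have "(d2 / p)\<^sup>2 \<le> (D ^ 2 * (x + 1) / n)\<^sup>2" using dp dp0 by (intro power_mono)
    also have "\<dots> = D ^ 4 / n * ((x + 1)\<^sup>2 / n)" by (simp add: power2_eq_square power4_eq_xxxx)
    also have "\<dots> \<le> D ^ 4 / n * 4" using x2n D1 n0 by (intro mult_left_mono) auto
    finally show ?thesis by (simp add: mult_ac)
  qed
  have n5: "real n \<le> real n ^ 5" using n1 by (intro self_le_power) auto
  have q_n: "q / p \<le> D / n"
    using qp n5 D1 n0 order_trans[OF qp divide_left_mono[of "real n" "real n ^ 5" D]] by simp
  have small: "d2 / p \<le> 1/2" "q / p \<le> 1/2"
  proof -
    have "4 * D ^ 4 * 4 \<le> D ^ 4 * D ^ 2"
      using mult_mono[of 200 D 200 D] D D1 by (simp add: power2_eq_square mult_left_mono mult_ac)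
    also have "\<dots> = D ^ 6" by (simp add: power_add[symmetric])
    also have "\<dots> \<le> n" by (rule nD)
    finally have "4 * D ^ 4 / n \<le> 1/4" using n0 by (simp add: field_simps)
    moreover have "(1/2 :: real)\<^sup>2 = 1/4" by (simp add: power2_eq_square)
    ultimately have "(d2 / p)\<^sup>2 \<le> (1/2)\<^sup>2" using dp2 by linarith
    thus "d2 / p \<le> 1/2" by (rule power2_le_imp_le) simp
    have "2 * D \<le> D ^ 2" using D by (simp add: power2_eq_square)
    also have "\<dots> \<le> D ^ 6" by (rule pw) simp
    finally have "D / n \<le> 1/2" using nD n0 by (simp add: field_simps)
    thus "q / p \<le> 1/2" using q_n by linarith
  qed
  have d2d: "d2 \<le> d2 / p" using d2_nonneg by (rule le_divide_p)
  \<comment> \<open>Each threshold lies a factor of about \<open>D\<close> above the bound for the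
    mean of its quantity (for \<open>s\<close>, its square above the variance), so each failure has
    probability of order \<open>1 / D\<close>.\<close>
  define s where "s = sqrt (\<mu> * D)"
  define P where "P = D ^ 3 * (x * (x + 1))"
  define k where "k = nat \<lfloor>D ^ 6 * x\<rfloor>"
  define B where "B = D ^ 8 * x"
  have s2: "s\<^sup>2 = \<mu> * D" using \<mu>_pos D1 by (simp add: s_def)
  have s: "0 < s" "s \<le> \<mu>"
  proof -
    show "0 < s" using \<mu>_pos D1 by (simp add: s_def)
    have "\<mu> * D \<le> \<mu> * \<mu>" using \<mu>(1) \<mu>_pos by (intro mult_left_mono) auto
    hence "s\<^sup>2 \<le> \<mu>\<^sup>2" by (simp only: s2) (simp only: power2_eq_square)
    thus "s \<le> \<mu>" by (rule power2_le_imp_le) (use \<mu>_pos in simp)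
  qed
  have P: "0 < P" "0 < B" using D1 x0 by (auto simp: P_def B_def)
  have D6x: "0 \<le> D ^ 6 * x" using D1 x0 by simp
  have k: "D ^ 6 * x \<le> real (Suc k)" "real k \<le> D ^ 6 * x"
  proof -
    have "real k = of_int \<lfloor>D ^ 6 * x\<rfloor>" using D6x by (simp add: k_def)
    thus "D ^ 6 * x \<le> real (Suc k)" "real k \<le> D ^ 6 * x"
      using real_of_int_floor_add_one_ge[of "D ^ 6 * x"] of_int_floor_le[of "D ^ 6 * x"] by linarith+
  qed
  have \<mu>n: "\<mu> / n \<le> D * x" using \<mu>(2) n0 by (simp add: field_simps)
  have f1: "(\<mu> + \<mu> * d2) / s\<^sup>2 \<le> 2 / D"
  proof -
    have "d2 \<le> 1" using d2d small(1) by linarith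
    hence "\<mu> * d2 \<le> \<mu> * 1" using \<mu>_pos by (intro mult_left_mono) auto
    hence "(\<mu> + \<mu> * d2) / s\<^sup>2 \<le> (2 * \<mu>) / s\<^sup>2" by (intro divide_right_mono) auto
    thus ?thesis unfolding s2 using \<mu>_pos D1 by simp
  qed
  have f2: "\<mu> * d2 / P \<le> 1 / D"
  proof -
    have "\<mu> * d2 \<le> (D * n * x) * (D * (x + 1) / n)"
      by (rule mult_mono) (use \<mu> d d2_nonneg D1 n0 x0 in auto)
    also have "\<dots> = P / D" using n0 D1 by (simp add: P_def power3_eq_cube field_simps)
    finally show ?thesis using P(1) D1 by (simp add: field_simps)
  qed
  have \<mu>d3: "\<mu> * (d3 / p) \<le> D ^ 3 * x"
  proof -
    have "\<mu> * (d3 / p) \<le> \<mu> * (D ^ 2 / n)" using d3p \<mu>_pos by (intro mult_left_mono) auto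
    also have "\<dots> = \<mu> / n * D ^ 2" by simp
    also have "\<dots> \<le> D * x * D ^ 2" using \<mu>n D1 by (intro mult_right_mono) auto
    finally show ?thesis by (simp add: power2_eq_square power3_eq_cube mult_ac)
  qed
  have \<mu>d2: "\<mu> * (d2 / p)\<^sup>2 \<le> 4 * D ^ 5 * x"
  proof -
    have "\<mu> * (d2 / p)\<^sup>2 \<le> \<mu> * (4 * D ^ 4 / n)" using dp2 \<mu>_pos by (intro mult_left_mono) auto
    also have "\<dots> = \<mu> / n * (4 * D ^ 4)" by simp
    also have "\<dots> \<le> D * x * (4 * D ^ 4)" using \<mu>n D1 by (intro mult_right_mono) auto
    also have "\<dots> = 4 * D ^ 5 * x" by (simp add: eval_nat_numeral mult_ac)
    finally show ?thesis .
  qed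
  have D53: "D ^ 3 * x \<le> D ^ 5 * x" using pw[of 3 5] x0 by (intro mult_right_mono) auto
  have f3: "\<mu> * (d3 + 2 * d2\<^sup>2 / p) / real (Suc k) \<le> 9 / D"
  proof -
    have "d3 \<le> d3 / p" using d3_nonneg by (rule le_divide_p)
    moreover have "d2\<^sup>2 / p \<le> (d2 / p)\<^sup>2"
      using le_divide_p[of "d2\<^sup>2 / p"] p_pos by (simp add: power_divide power2_eq_square)
    ultimately have "\<mu> * (d3 + 2 * d2\<^sup>2 / p) \<le> \<mu> * (d3 / p + 2 * (d2 / p)\<^sup>2)"
      using \<mu>_pos by (intro mult_left_mono) auto
    also have "\<dots> \<le> 9 * (D ^ 5 * x)" using \<mu>d3 \<mu>d2 D53 by (simp add: distrib_left)
    finally have "\<mu> * (d3 + 2 * d2\<^sup>2 / p) / real (Suc k) \<le> 9 * (D ^ 5 * x) / (D ^ 6 * x)"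
      using k(1) D1 x0 by (intro frac_le) auto
    also have "\<dots> = 9 / D" using D1 x0 by (simp add: eval_nat_numeral)
    finally show ?thesis .
  qed
  have D2: "1 / (1 - p)\<^sup>2 \<le> D\<^sup>2" "1 / (1 - p) ^ 3 \<le> D ^ 3"
    using power_mono[OF pD(2) p1(2), of 2] power_mono[OF pD(2) p1(2), of 3] by (simp_all add: power_one_over)
  have f4: "\<mu> / (1 - p)\<^sup>2 * (d3 / p + 3 * (d2 / p)\<^sup>2) / B \<le> 13 / D"
  proof -
    have g: "\<mu> * (d3 / p + 3 * (d2 / p)\<^sup>2) \<le> 13 * (D ^ 5 * x)" using \<mu>d3 \<mu>d2 D53 by (simp add: distrib_left)
    have "1 / (1 - p)\<^sup>2 * (\<mu> * (d3 / p + 3 * (d2 / p)\<^sup>2)) \<le> D\<^sup>2 * (13 * (D ^ 5 * x))"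
      by (rule mult_mono[OF D2(1) g]) (use \<mu>_pos d3_nonneg p_pos in auto)
    also have "\<dots> = 13 / D * B" using D1 by (simp add: B_def eval_nat_numeral)
    finally have "1 / (1 - p)\<^sup>2 * (\<mu> * (d3 / p + 3 * (d2 / p)\<^sup>2)) / B \<le> 13 / D * B / B"
      using P by (intro divide_right_mono) auto
    thus ?thesis using P(2) by simp
  qed
  have f5: "\<mu> / (1 - p) ^ 3 * (3 * (d2 / p) ^ 3) \<le> 3 / D"
  proof -
    have "(d2 / p) ^ 3 \<le> (D ^ 2 * (x + 1) / n) ^ 3" using dp dp0 by (intro power_mono)
    hence g: "3 * (d2 / p) ^ 3 \<le> 3 * (D ^ 2 * (x + 1) / n) ^ 3" by simp
    have "\<mu> * (1 / (1 - p) ^ 3) * (3 * (d2 / p) ^ 3) \<le> (D * n * x) * D ^ 3 * (3 * (D ^ 2 * (x + 1) / n) ^ 3)"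
    proof (rule mult_mono[OF _ g])
      show "\<mu> * (1 / (1 - p) ^ 3) \<le> (D * n * x) * D ^ 3"
        by (rule mult_mono) (use \<mu> D2 D1 n0 x0 p_lt_1 in auto)
      show "0 \<le> 3 * (d2 / p) ^ 3" using dp0 by simp
      show "0 \<le> D * n * x * D ^ 3" using D1 n0 x0 by simp
    qed
    \<comment> \<open>This is where the condition
      \<open>x * (x + 1) ^ 3 * D ^ 11 \<le> n\<^sup>2\<close> comes from: it makes covered sets
      unlikely.\<close>
    also have "\<dots> = 3 / D * (x * (x + 1) ^ 3 * D ^ 11 / (real n)\<^sup>2)"
    proof -
      have "D * n * x * D ^ 3 * (3 * (D ^ 2 * y / n) ^ 3) = 3 / D * (x * y ^ 3 * D ^ 11 / (real n)\<^sup>2)" for y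
        using D1 n0 by (simp add: eval_nat_numeral)
      thus ?thesis .
    qed
    also have "\<dots> \<le> 3 / D * 1" using x(3) n0 D1 by (intro mult_left_mono) auto
    finally show ?thesis by simp
  qed
  have f6: "1 / real (Suc (card R)) \<le> 1 / D"
  proof (rule divide_left_mono)
    have "D \<le> n" using nD pw[of 1 6] by simp
    thus "D \<le> real (Suc (card R))" using N(2) by linarith
  qed (use D1 in auto)
  have err: "err s k P B \<le> D ^ 10 * x"
  proof -
    have sle: "s \<le> D * n"
    proof (rule power2_le_imp_le)
      have "s\<^sup>2 \<le> (D * n * x) * D" unfolding s2 using \<mu>(2) D1 by (intro mult_right_mono) auto
      also have "\<dots> \<le> (D * n * n) * D" using xn D1 by (intro mult_right_mono mult_left_mono) auto
      finally show "s\<^sup>2 \<le> (D * n)\<^sup>2" by (simp add: power2_eq_square mult_ac)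
    qed (use D1 in simp)
    have r0: "0 \<le> D * x / n" using D1 x0 by simp
    have 1: "rate * s \<le> D ^ 2 * x"
    proof -
      have "rate * s \<le> (D * x / n) * (D * n)" using d sle s r0 rate_nonneg by (intro mult_mono) auto
      thus ?thesis using n0 by (simp add: power2_eq_square mult_ac)
    qed
    have 2: "rate * k \<le> D ^ 7 * x"
    proof -
      have "rate * k \<le> (D * x / n) * (D ^ 6 * x)" using d k r0 rate_nonneg by (intro mult_mono) auto
      also have "\<dots> = D ^ 7 * x * (x / n)" by (simp add: eval_nat_numeral mult_ac)
      also have "\<dots> \<le> D ^ 7 * x * 1" using xdn D1 x0 by (intro mult_left_mono) auto
      finally show ?thesis by simp
    qed
    have 3: "rate * P \<le> 2 * D ^ 4 * x"
    proof -
      have "rate * P \<le> (D * x / n) * P" using d P by (intro mult_right_mono) auto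
      also have "\<dots> = D ^ 4 * x * (x * (x + 1) / n)" by (simp add: P_def eval_nat_numeral mult_ac)
      also have "\<dots> \<le> D ^ 4 * x * 2" using xxn D1 x0 by (intro mult_left_mono) auto
      finally show ?thesis by simp
    qed
    have 4: "B / (1 - p) \<le> D ^ 9 * x"
    proof -
      have "B * (1 / (1 - p)) \<le> B * D" using pD P by (intro mult_left_mono) auto
      thus ?thesis by (simp add: B_def eval_nat_numeral mult_ac)
    qed
    have \<mu>q: "\<mu> * q \<le> D * x / n"
    proof -
      have "\<mu> * q \<le> (D * n * x) * (1 / real n ^ 5)" using \<mu> q q_pos D1 n0 x0 by (intro mult_mono) auto
      also have "\<dots> \<le> (D * n * x) * (1 / real n ^ 2)"
        using n1 n0 D1 x0 by (intro mult_left_mono divide_left_mono power_increasing) auto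
      also have "\<dots> = D * x / n" using n0 by (simp add: power2_eq_square)
      finally show ?thesis .
    qed
    have \<mu>q2: "\<mu> * q \<le> D * x"
      using \<mu>q divide_left_mono[of 1 "real n" "D * x"] n1 D1 x0 by (simp add: order_trans)
    have 5: "2 * \<mu> * (q * (1 + real (r choose 2) / p) + q / p) \<le> 6 * D ^ 4 * x"
    proof -
      have "r choose 2 \<le> r ^ 2" by (rule binomial_le_pow) (use r_ge in simp)
      hence "real (r choose 2) \<le> real r ^ 2" by (simp flip: of_nat_power)
      also have "\<dots> \<le> D ^ 2" using rD by (intro power_mono) auto
      finally have c: "real (r choose 2) \<le> D ^ 2" .
      have "real (r choose 2) * (1 / p) \<le> D ^ 2 * D" using c pD p1 by (intro mult_mono) auto
      hence "1 + real (r choose 2) / p + 1 / p \<le> 1 + D ^ 3 + D" using pD by (simp add: eval_nat_numeral)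
      also have "\<dots> \<le> 3 * D ^ 3" using pw[of 0 3] pw[of 1 3] by simp
      finally have g: "1 + real (r choose 2) / p + 1 / p \<le> 3 * D ^ 3" .
      have "2 * (\<mu> * q) * (1 + real (r choose 2) / p + 1 / p) \<le> 2 * (D * x) * (3 * D ^ 3)"
        by (rule mult_mono[OF _ g]) (use \<mu>q2 \<mu>_pos q_pos p_pos D1 x0 in auto)
      moreover have "2 * \<mu> * (q * (1 + real (r choose 2) / p) + q / p) = 2 * (\<mu> * q) * (1 + real (r choose 2) / p + 1 / p)"
        by (simp add: algebra_simps)
      moreover have "2 * (D * x) * (3 * D ^ 3) = 6 * D ^ 4 * x" by (simp add: eval_nat_numeral mult_ac)
      ultimately show ?thesis by linarith
    qed
    have \<mu>r: "\<mu> * rate \<le> D ^ 2 * x\<^sup>2"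
    proof -
      have "\<mu> * rate \<le> (D * n * x) * (D * x / n)" using \<mu> d rate_nonneg D1 n0 x0 by (intro mult_mono) auto
      thus ?thesis using n0 by (simp add: power2_eq_square mult_ac)
    qed
    have 6: "2 * \<mu> * rate * (d2 / p) \<le> 4 * D ^ 4 * x"
    proof -
      have "(\<mu> * rate) * (d2 / p) \<le> (D ^ 2 * x\<^sup>2) * (D ^ 2 * (x + 1) / n)"
        by (rule mult_mono[OF \<mu>r dp]) (use dp0 D1 x0 in auto)
      also have "\<dots> = D ^ 4 * x * (x * (x + 1) / n)" by (simp add: eval_nat_numeral mult_ac)
      also have "\<dots> \<le> D ^ 4 * x * 2" using xxn D1 x0 by (intro mult_left_mono) auto
      finally show ?thesis by simp
    qed
    have 7: "(\<mu> + 2 * \<mu> * rate) * (d3 / p + 6 * (d2 / p)\<^sup>2 / p + 2 * (q / p)) \<le> 81 * D ^ 7 * x"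
    proof -
      have "rate \<le> D" using d(3) mult_left_mono[OF xdn, of D] D1 by simp
      hence "\<mu> + 2 * \<mu> * rate \<le> \<mu> * (3 * D)"
        using mult_left_mono[of "1 + 2 * rate" "3 * D" \<mu>] D1 \<mu>_pos by (simp add: algebra_simps)
      also have "\<dots> \<le> D * n * x * (3 * D)" using \<mu> D1 by (intro mult_right_mono) auto
      finally have a: "\<mu> + 2 * \<mu> * rate \<le> n * (3 * D ^ 2 * x)" by (simp add: power2_eq_square mult_ac)
      have "(d2 / p)\<^sup>2 * (1 / p) \<le> 4 * D ^ 4 / n * D" using dp2 pD p1 D1 n0 by (intro mult_mono) auto
      moreover have "4 * D ^ 4 / n * D = 4 * (D ^ 5 / n)" by (simp add: eval_nat_numeral)
      moreover have "6 * (d2 / p)\<^sup>2 / p = 6 * ((d2 / p)\<^sup>2 * (1 / p))" by simp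
      moreover have "D ^ 2 / n \<le> D ^ 5 / n" using pw[of 2 5] n0 by (intro divide_right_mono) auto
      moreover have "D / n \<le> D ^ 5 / n" using pw[of 1 5] n0 by (intro divide_right_mono) auto
      ultimately have b: "d3 / p + 6 * (d2 / p)\<^sup>2 / p + 2 * (q / p) \<le> 27 * (D ^ 5 / n)"
        using d3p q_n by linarith
      have "(\<mu> + 2 * \<mu> * rate) * (d3 / p + 6 * (d2 / p)\<^sup>2 / p + 2 * (q / p))
        \<le> (n * (3 * D ^ 2 * x)) * (27 * (D ^ 5 / n))"
        by (rule mult_mono) (use a b D1 n0 x0 d3_nonneg p_pos q_pos in auto)
      also have "\<dots> = 81 * D ^ 7 * x" using n0 by (simp add: eval_nat_numeral)
      finally show ?thesis .
    qed
    have 8: "\<mu> * rate * (real r)\<^sup>2 / real (n - 2) \<le> 2 * D ^ 4 * x"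
    proof -
      have n2: "real (n - 2) = real n - 2" using n200 by (simp add: of_nat_diff)
      have "\<mu> * rate * (real r)\<^sup>2 \<le> (D ^ 2 * x\<^sup>2) * D\<^sup>2"
        by (rule mult_mono) (use \<mu>r rD D1 \<mu>_pos rate_nonneg in \<open>auto intro: power_mono\<close>)
      also have "\<dots> = D ^ 4 * x * x" by (simp add: eval_nat_numeral mult_ac)
      also have "\<dots> \<le> D ^ 4 * x * (2 * (real n - 2))" using xn n200 D1 x0 by (intro mult_left_mono) auto
      also have "\<dots> = 2 * D ^ 4 * x * (real n - 2)" by simp
      finally show ?thesis unfolding n2 using n200 by (subst pos_divide_le_eq) auto
    qed
    have 9: "2 * real k * ln (real (Suc (card R))) \<le> 2 * D ^ 8 * x"
    proof -
      have "real k * ln (real (Suc (card R))) \<le> (D ^ 6 * x) * D\<^sup>2"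
        using k N D6x by (intro mult_mono) auto
      also have "\<dots> = D ^ 8 * x" by (simp add: eval_nat_numeral mult_ac)
      finally show ?thesis by simp
    qed
    have up: "D ^ i * x \<le> D ^ 9 * x" if "i \<le> 9" for i using pw[OF that] x0 by (intro mult_right_mono) auto
    have D9: "0 \<le> D ^ 9 * x" using D1 x0 by simp
    have ups: "D ^ 2 * x \<le> D ^ 9 * x" "D ^ 7 * x \<le> D ^ 9 * x" "D ^ 4 * x \<le> D ^ 9 * x" "D ^ 8 * x \<le> D ^ 9 * x"
      by (intro up; simp)+
    \<comment> \<open>The coefficients add up to 100. Since \<open>D\<close> is at least 200, one
      more factor \<open>D\<close> will absorb them.\<close>
    have gen: "a + b + c + d + e + f + g \<le> 110 * (D ^ 9 * x)"
      if "a = a1 + a2 + a3" "a1 \<le> D ^ 2 * x" "a2 \<le> D ^ 7 * x" "a3 \<le> 2 * D ^ 4 * x" "b \<le> D ^ 9 * x"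
        "c \<le> 6 * D ^ 4 * x" "d \<le> 4 * D ^ 4 * x" "e \<le> 81 * D ^ 7 * x" "f \<le> 2 * D ^ 4 * x"
        "g \<le> 2 * D ^ 8 * x" for a a1 a2 a3 b c d e f g :: real
      using that ups D9 by linarith
    have "rate * (s + real k + P) = rate * s + rate * k + rate * P" by (simp only: distrib_left)
    hence "err s k P B \<le> 110 * (D ^ 9 * x)"
      unfolding err_def using 1 2 3 4 5 6 7 8 9 by (rule gen)
    also have "\<dots> \<le> D * (D ^ 9 * x)" using D x0 D1 by (intro mult_right_mono) auto
    also have "\<dots> = D ^ 10 * x" by (simp add: eval_nat_numeral)
    finally show ?thesis .
  qed
  have "prb (\<lambda>w. \<not> well_approximated (D ^ 10 * x) (cl w)) \<le> prb (\<lambda>w. \<not> well_approximated (err s k P B) (cl w))"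
    using well_approximated_mono[OF _ err] by (intro pr_mono) blast
  also have "\<dots> \<le> 2 / D + 1 / D + 9 / D + 13 / D + 3 / D + 1 / D"
    using pr_not_well_approximated[OF small s P, of k] f1 f2 f3 f4 f5 f6 by linarith
  also have "\<dots> = 29 / D" by (simp add: add_divide_distrib[symmetric])
  finally show ?thesis using D by simp
qed

section \<open>Estimates for overlaps\<close>

lemma nat_two_choose: "2 * (s choose 2) = s * (s - 1)"
  by (induction s) (auto simp: choose_two)

lemma two_choose_two: "2 * real (s choose 2) = real s * (real s - 1)"
proof -
  have "real (2 * (s choose 2)) = real (s * (s - 1))" by (simp only: nat_two_choose)
  thus ?thesis by (cases s) (auto simp: algebra_simps)
qed

text \<open>\<open>s choose 2\<close> is half of \<open>s * (s - 1)\<close>; after squaring, bounds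
  on \<open>\<mu>\<close> become bounds on an \<open>r\<close>-th power, whose root can be taken.
  The estimates below are squared for this reason.\<close>

lemma power_choose_two: "(a ^ (s choose 2))\<^sup>2 = (a ^ (s - 1)) ^ s" for a :: real
proof -
  have "(s choose 2) * 2 = (s - 1) * s" using nat_two_choose[of s] by (simp add: mult.commute)
  thus ?thesis by (simp only: power_mult[symmetric])
qed

lemma r_n_pos: "0 < real r" "0 < real n" "1 \<le> real r" "1 \<le> real n" "real r \<le> real n"
  using r_ge r_le by auto

lemma power_base_le:
  fixes a b :: real
  assumes "a ^ k \<le> b ^ k" "0 \<le> b" "0 < k" shows "a \<le> b"
  using assms power_mono_iff[of a b k] power_le_imp_le_base[of a "k - 1" b] by simp

text \<open>\<open>\<mu>\<^sup>2\<close> is at most the \<open>r\<close>-th power of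
  \<open>n\<^sup>2 * p ^ (r - 1)\<close>; take the root.\<close>

lemma edge_power_lower:
  assumes "1 \<le> \<mu>" shows "1 / (real n)\<^sup>2 \<le> p ^ (r - 1)"
proof -
  have "(1::real) ^ r \<le> \<mu>\<^sup>2" using assms by simp
  also have "\<dots> = (real (n choose r))\<^sup>2 * (p ^ (r - 1)) ^ r"
    by (simp add: \<mu>_def q_def power_mult_distrib power_choose_two)
  also have "\<dots> \<le> (real n ^ r)\<^sup>2 * (p ^ (r - 1)) ^ r"
    using binomial_le_pow[OF r_le] p_bounds by (intro mult_right_mono power_mono) (auto simp flip: of_nat_power)
  also have "\<dots> = ((real n)\<^sup>2 * p ^ (r - 1)) ^ r"
    by (simp add: power_mult_distrib power_mult[symmetric] mult.commute)
  finally have "1 \<le> (real n)\<^sup>2 * p ^ (r - 1)"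
    using r_ge p_bounds by (intro power_base_le[of 1 r]) auto
  thus ?thesis using r_n_pos by (simp add: field_simps)
qed

text \<open>The counterpart of \<open>edge_power_lower\<close>, from
  \<open>n choose r \<ge> (n / r) ^ r\<close>. The number \<open>\<kappa>\<close> dominates the
  \<open>r\<close>-th root of \<open>n ^ 3\<close>; it can be a constant because \<open>r\<close>
  grows like a logarithm.\<close>

lemma edge_power_upper:
  assumes "\<mu>\<^sup>2 \<le> (real n)^3" "(real n) ^ 3 \<le> \<kappa> ^ r" "0 \<le> \<kappa>"
  shows "p ^ (r - 1) \<le> \<kappa> * (real r)\<^sup>2 / (real n)\<^sup>2"
proof -
  have "((real n / real r)\<^sup>2 * p ^ (r - 1)) ^ r = ((real n / real r) ^ r)\<^sup>2 * (p ^ (r - 1)) ^ r"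
    by (simp add: power_mult_distrib power_mult[symmetric] mult.commute)
  also have "\<dots> \<le> (real (n choose r))\<^sup>2 * (p ^ (r - 1)) ^ r"
    using binomial_ge_n_over_k_pow_k[OF r_le, where 'a = real] p_bounds by (intro mult_right_mono power_mono) auto
  also have "\<dots> = \<mu>\<^sup>2" by (simp add: \<mu>_def q_def power_mult_distrib power_choose_two)
  also have "\<dots> \<le> \<kappa> ^ r" using assms by linarith
  finally have "(real n / real r)\<^sup>2 * p ^ (r - 1) \<le> \<kappa>"
    by (rule power_base_le) (use assms r_ge in auto)
  thus ?thesis using r_n_pos by (simp add: field_simps power_divide)
qed

text \<open>Counting pairs of an \<open>r\<close>-set and an \<open>s\<close>-subset in two ways,
  \<open>(n - s) choose (r - s)\<close> equals
  \<open>(n choose r) * (r choose s) / (n choose s)\<close>. Then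
  \<open>r choose s \<le> r ^ s\<close> and \<open>n choose s \<ge> (n / r) ^ s\<close>.\<close>

lemma choose_product_le:
  assumes s: "1 \<le> s" "s \<le> r"
  shows "real (r choose s) * real ((n - r) choose (r - s)) \<le> real (n choose r) * (real r ^ 3 / real n) ^ s"
proof -
  have "((n - r) choose (r - s)) \<le> (n - s) choose (r - s)" using s by (intro binomial_right_mono) auto
  hence "(r choose s) * ((n - r) choose (r - s)) * (n choose s) \<le> (r choose s) * ((n - s) choose (r - s)) * (n choose s)"
    by (intro mult_right_mono mult_left_mono) auto
  also have "\<dots> = (r choose s) * (r choose s) * (n choose r)"
    using choose_mult[of s r n] s r_le by (simp add: mult_ac)
  also have "\<dots> \<le> r ^ s * r ^ s * (n choose r)"
    using binomial_le_pow[OF s(2)] by (intro mult_right_mono mult_mono) auto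
  finally have "real ((r choose s) * ((n - r) choose (r - s)) * (n choose s)) \<le> real (r ^ s * r ^ s * (n choose r))"
    by (simp only: of_nat_le_iff)
  hence 1: "real (r choose s) * real ((n - r) choose (r - s)) * real (n choose s) \<le> (real r ^ s)\<^sup>2 * real (n choose r)"
    by (simp add: power2_eq_square)
  have "(real n / real r) ^ s \<le> (real n / real s) ^ s"
    using s r_n_pos by (intro power_mono divide_left_mono) auto
  also have "\<dots> \<le> real (n choose s)"
    using s r_le by (intro binomial_ge_n_over_k_pow_k) auto
  finally have "real (r choose s) * real ((n - r) choose (r - s)) * (real n / real r) ^ s
    \<le> real (r choose s) * real ((n - r) choose (r - s)) * real (n choose s)"
    by (intro mult_left_mono) auto
  also note 1
  finally have "real (r choose s) * real ((n - r) choose (r - s)) * (real n / real r) ^ s \<le> (real r ^ s)\<^sup>2 * real (n choose r)" .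
  hence "real (r choose s) * real ((n - r) choose (r - s)) \<le> (real r ^ s)\<^sup>2 * real (n choose r) / (real n / real r) ^ s"
    using r_n_pos by (subst pos_le_divide_eq) auto
  also have "\<dots> = real (n choose r) * (real r ^ 3 / real n) ^ s"
    using r_n_pos by (simp add: power_divide power_mult_distrib power2_eq_square power3_eq_cube)
  finally show ?thesis .
qed

lemma T_le_mean:
  assumes s: "1 \<le> s" "s \<le> r"
  shows "T s \<le> \<mu> * (real r ^ 3 / real n) ^ s / p ^ (s choose 2)"
proof -
  have le: "s choose 2 \<le> r choose 2" using s by (intro binomial_right_mono)
  have "T s = real (r choose s) * real ((n - r) choose (r - s)) * (q / p ^ (s choose 2))"
    using le p_pos by (simp add: T_def q_def power_diff)
  also have "\<dots> \<le> real (n choose r) * (real r ^ 3 / real n) ^ s * (q / p ^ (s choose 2))"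
    using choose_product_le[OF s] q_pos p_pos by (intro mult_right_mono) auto
  finally show ?thesis by (simp add: \<mu>_def mult_ac)
qed

text \<open>The square root of \<open>edge_power_lower\<close>: half the exponent costs only one
  factor \<open>n\<close>.\<close>

lemma small_power_ge:
  assumes "1 \<le> \<mu>" "2 * j \<le> r - 1" shows "1 / real n \<le> p ^ j"
proof -
  have "(1 / real n)\<^sup>2 \<le> p ^ (r - 1)" using edge_power_lower[OF assms(1)] by (simp add: power_one_over)
  also have "\<dots> \<le> p ^ (2 * j)" using assms(2) p_bounds by (intro power_decreasing) auto
  also have "\<dots> = (p ^ j)\<^sup>2" by (simp add: power_mult[symmetric] mult.commute)
  finally show ?thesis by (rule power2_le_imp_le) (use p_bounds in auto)
qed

text \<open>For overlaps up to about half of \<open>r\<close>. By \<open>T_le_mean\<close> the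
  square of \<open>T s\<close> is at most \<open>n ^ 3 * b ^ s\<close>, which has to be brought down
  to about n to the power -2.\<close>

lemma T_small_overlap:
  assumes \<mu>: "1 \<le> \<mu>" "\<mu>\<^sup>2 \<le> (real n)^3" and s: "3 \<le> s" "2 * (s - 1) \<le> r - 1"
    and big: "real r ^ 6 \<le> p ^ 3 * n"
  shows "T s \<le> real r ^ 15 / p ^ 5 / n"
proof -
  have sr: "s \<le> r" using s by simp
  have n1: "1 \<le> real n" using r_n_pos by simp
  have p1: "p ^ i \<le> 1" for i using p_bounds by (simp add: power_le_one)
  define b where "b = real r ^ 6 / ((real n)\<^sup>2 * p ^ (s - 1))"
  have b0: "0 \<le> b" using p_pos by (simp add: b_def)
  have "(T s)\<^sup>2 \<le> (\<mu> * (real r ^ 3 / real n) ^ s / p ^ (s choose 2))\<^sup>2"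
    using T_le_mean[of s] T_nonneg s sr by (intro power_mono) auto
  also have "\<dots> = \<mu>\<^sup>2 * b ^ s"
    by (simp add: b_def power_divide power_mult_distrib power_mult[symmetric] nat_two_choose mult.commute)
  also have "\<dots> \<le> (real n)^3 * b ^ s" using \<mu>(2) b0 by (intro mult_right_mono) auto
  also have "\<dots> \<le> (real r ^ 15 / p ^ 5 / n)\<^sup>2"
  \<comment> \<open>In general \<open>b\<close> is only known to be about \<open>1 / n\<close>, so
    five factors are needed against \<open>n ^ 3\<close>. For \<open>s\<close> equal to 3 or 4 the
    power of \<open>p\<close> in \<open>b\<close> is constant, \<open>b\<close> is about n to the
    power -2, and three factors suffice.\<close>
  proof (cases "5 \<le> s")
    case True
    have pn: "1 / real n \<le> p ^ (s - 1)" by (rule small_power_ge[OF \<mu>(1) s(2)])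
    hence "real n \<le> (real n)\<^sup>2 * p ^ (s - 1)"
      using mult_left_mono[OF pn, of "(real n)\<^sup>2"] n1 by (simp add: power2_eq_square)
    hence bn: "b \<le> real r ^ 6 / real n" unfolding b_def using n1 by (intro divide_left_mono) auto
    have "p ^ 3 * real n \<le> 1 * real n" by (intro mult_right_mono p1) auto
    hence "real r ^ 6 \<le> real n" using big by linarith
    hence b1: "real r ^ 6 / real n \<le> 1" using n1 by (subst pos_divide_le_eq) auto
    have "b ^ s \<le> (real r ^ 6 / real n) ^ s" using bn b0 by (intro power_mono)
    also have "\<dots> \<le> (real r ^ 6 / real n) ^ 5" using b1 True by (intro power_decreasing) auto
    finally have "(real n)^3 * b ^ s \<le> (real n)^3 * (real r ^ 6 / real n) ^ 5"
      by (intro mult_left_mono) auto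
    also have "\<dots> = (real r ^ 15 / 1 / n)\<^sup>2"
      using n1 by (simp add: power_divide power_mult[symmetric] field_simps eval_nat_numeral)
    also have "\<dots> \<le> (real r ^ 15 / p ^ 5 / n)\<^sup>2"
      using p1[of 5] p_pos by (intro power_mono divide_right_mono divide_left_mono) auto
    finally show ?thesis .
  next
    case False
    hence "s - 1 \<le> 3" by simp
    hence "p ^ 3 \<le> p ^ (s - 1)" using p_bounds by (intro power_decreasing) auto
    hence bn: "b \<le> real r ^ 6 / ((real n)\<^sup>2 * p ^ 3)" (is "_ \<le> ?c")
      unfolding b_def using n1 p_pos by (intro divide_left_mono mult_left_mono) auto
    have "real r ^ 6 \<le> p ^ 3 * (real n)\<^sup>2"
    proof -
      have "real n \<le> (real n)\<^sup>2" using n1 by (intro self_le_power) auto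
      hence "p ^ 3 * real n \<le> p ^ 3 * (real n)\<^sup>2" using p_pos by (intro mult_left_mono) auto
      thus ?thesis using big by linarith
    qed
    hence c1: "?c \<le> 1" using n1 p_pos by (simp add: mult.commute)
    have "b ^ s \<le> ?c ^ s" using bn b0 by (intro power_mono)
    also have "\<dots> \<le> ?c ^ 3" using c1 s p_pos by (intro power_decreasing) auto
    finally have "(real n)^3 * b ^ s \<le> (real n)^3 * ?c ^ 3" by (intro mult_left_mono) auto
    also have "\<dots> = (real r ^ 9)\<^sup>2 / ((real n) ^ 3 * p ^ 9)"
    proof -
      have "c ^ 3 * (A ^ 6 / (c\<^sup>2 * d ^ 3)) ^ 3 = (A ^ 9)\<^sup>2 / (c ^ 3 * d ^ 9)" if "c \<noteq> 0" for A c d :: real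
      proof -
        have "c ^ 3 * (A ^ 6 / (c\<^sup>2 * d ^ 3)) ^ 3 = c ^ 3 * A ^ 18 / (c ^ 6 * d ^ 9)"
          by (simp add: power_divide power_mult_distrib power_mult[symmetric])
        also have "c ^ 6 * d ^ 9 = c ^ 3 * (c ^ 3 * d ^ 9)"
          by (simp add: power_add[symmetric] mult.assoc[symmetric])
        also have "c ^ 3 * A ^ 18 / (c ^ 3 * (c ^ 3 * d ^ 9)) = A ^ 18 / (c ^ 3 * d ^ 9)"
          by (rule mult_divide_mult_cancel_left) (use that in simp)
        finally show ?thesis by (simp add: power_mult[symmetric])
      qed
      thus ?thesis using n1 by simp
    qed
    also have "\<dots> \<le> (real r ^ 15)\<^sup>2 / ((real n)\<^sup>2 * (p ^ 5)\<^sup>2)"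
    proof (intro frac_le power_mono mult_mono power_increasing)
      have "p ^ 10 \<le> p ^ 9" using p_bounds by (intro power_decreasing) auto
      thus "(p ^ 5)\<^sup>2 \<le> p ^ 9" by (simp add: power_mult[symmetric])
    qed (use r_n_pos p_pos in auto)
    also have "\<dots> = (real r ^ 15 / p ^ 5 / n)\<^sup>2" by (simp add: power_divide power_mult_distrib mult.commute)
    finally show ?thesis .
  qed
  finally show ?thesis by (rule power2_le_imp_le) (use p_pos in auto)
qed

text \<open>For overlaps above about half of \<open>r\<close>, with \<open>k\<close> vertices not
  shared. The square of \<open>T (r - k)\<close> is at most the \<open>k\<close>-th power of
  \<open>r\<^sup>2 * n\<^sup>2 * p ^ (2 * r - k - 1)\<close>, and \<open>p ^ (r - 1)\<close> is
  about n to the power -2.\<close>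

lemma T_large_overlap:
  assumes \<mu>: "1 \<le> \<mu>" "\<mu>\<^sup>2 \<le> (real n)^3" and \<kappa>: "1 \<le> \<kappa>" "(real n) ^ 3 \<le> \<kappa> ^ r"
    and k: "1 \<le> k" "k < r" "2 * (k - 1) \<le> r - 1" and big: "\<kappa>\<^sup>2 * real r ^ 6 \<le> n"
  shows "T (r - k) \<le> \<kappa>\<^sup>2 * real r ^ 6 / n"
proof -
  have up: "p ^ (r - 1) \<le> \<kappa> * (real r)\<^sup>2 / (real n)\<^sup>2" using edge_power_upper \<mu> \<kappa> by simp
  have n1: "1 \<le> real n" using r_n_pos by simp
  have bin: "real (r choose (r - k)) \<le> real r ^ k" "real ((n - r) choose k) \<le> real n ^ k"
  proof -
    have "r choose (r - k) = r choose k" using k binomial_symmetric[of k r] by simp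
    thus "real (r choose (r - k)) \<le> real r ^ k"
      using binomial_le_pow[of k r] k by (simp flip: of_nat_power)
    show "real ((n - r) choose k) \<le> real n ^ k"
    proof (cases "k \<le> n - r")
      case True
      hence "(n - r) choose k \<le> (n - r) ^ k" by (rule binomial_le_pow)
      also have "\<dots> \<le> n ^ k" by (intro power_mono) auto
      finally show ?thesis by (simp flip: of_nat_power)
    qed (simp add: binomial_eq_0)
  qed
  have T: "T (r - k) \<le> real r ^ k * real n ^ k * p ^ ((r choose 2) - ((r - k) choose 2))"
    using bin k p_bounds unfolding T_def by (intro mult_right_mono mult_mono) auto
  have ex: "((r choose 2) - ((r - k) choose 2)) * 2 = (2 * r - k - 1) * k"
  proof -
    have le: "(r - k) choose 2 \<le> r choose 2" by (intro binomial_right_mono) simp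
    have "real (((r choose 2) - ((r - k) choose 2)) * 2) = 2 * real (r choose 2) - 2 * real ((r - k) choose 2)"
      using le by (simp add: of_nat_diff)
    also have "\<dots> = real r * (real r - 1) - (real r - real k) * (real r - real k - 1)"
      unfolding two_choose_two using k by (simp add: of_nat_diff)
    also have "\<dots> = (2 * real r - real k - 1) * real k" by (simp add: algebra_simps)
    also have "2 * real r - real k - 1 = real (2 * r - k - 1)" using k by (simp add: of_nat_diff)
    also have "\<dots> * real k = real ((2 * r - k - 1) * k)" by simp
    finally show ?thesis by (simp only: of_nat_eq_iff)
  qed
  have sq: "(T (r - k))\<^sup>2 \<le> ((real r)\<^sup>2 * (real n)\<^sup>2 * p ^ (2 * r - k - 1)) ^ k"
  proof -
    have "(T (r - k))\<^sup>2 \<le> (real r ^ k * real n ^ k * p ^ ((r choose 2) - ((r - k) choose 2)))\<^sup>2"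
      using T T_nonneg by (intro power_mono)
    also have "\<dots> = (real r ^ k * real n ^ k)\<^sup>2 * p ^ (((r choose 2) - ((r - k) choose 2)) * 2)"
      by (simp only: power_mult_distrib power_mult)
    also have "\<dots> = ((real r)\<^sup>2 * (real n)\<^sup>2 * p ^ (2 * r - k - 1)) ^ k"
      unfolding ex by (simp add: power_mult_distrib power_mult[symmetric] mult.commute)
    finally show ?thesis .
  qed
  have base: "(real r)\<^sup>2 * (real n)\<^sup>2 * (\<kappa> * (real r)\<^sup>2 / (real n)\<^sup>2)\<^sup>2 * real n = \<kappa>\<^sup>2 * real r ^ 6 / n"
    using n1 by (simp add: power_divide power_mult_distrib power_mult[symmetric] eval_nat_numeral)
  show ?thesis
  \<comment> \<open>For \<open>k = 1\<close> the base is about n to the power -2. For larger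
    \<open>k\<close> it is only about \<open>1 / n\<close>, since dividing by
    \<open>p ^ (k - 1)\<close> may cost a factor \<open>n\<close>, but at least two factors are
    present.\<close>
  proof (cases "k = 1")
    case True
    have "(T (r - k))\<^sup>2 \<le> (real r)\<^sup>2 * (real n)\<^sup>2 * (p ^ (r - 1))\<^sup>2"
    proof -
      have e: "2 * r - k - 1 = (r - 1) * 2" using True by simp
      show ?thesis using sq[unfolded e] unfolding True power_one_right power_mult .
    qed
    also have "\<dots> \<le> (real r)\<^sup>2 * (real n)\<^sup>2 * (\<kappa> * (real r)\<^sup>2 / (real n)\<^sup>2)\<^sup>2"
      using up p_bounds by (intro mult_left_mono power_mono) auto
    also have "\<dots> = \<kappa>\<^sup>2 * real r ^ 6 / (real n)\<^sup>2"
      using n1 by (simp add: power_divide power_mult_distrib power_mult[symmetric] eval_nat_numeral)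
    also have "\<dots> \<le> (\<kappa>\<^sup>2)\<^sup>2 * (real r ^ 6)\<^sup>2 / (real n)\<^sup>2"
    proof (intro divide_right_mono mult_mono)
      show "\<kappa>\<^sup>2 \<le> (\<kappa>\<^sup>2)\<^sup>2" using \<kappa> by (intro self_le_power) (auto simp: one_le_power)
      show "real r ^ 6 \<le> (real r ^ 6)\<^sup>2" using r_n_pos by (intro self_le_power) (auto simp: one_le_power)
    qed auto
    also have "\<dots> = (\<kappa>\<^sup>2 * real r ^ 6 / n)\<^sup>2" by (simp add: power_divide power_mult_distrib)
    finally show ?thesis by (rule power2_le_imp_le) simp
  next
    case False
    hence k2: "2 \<le> k" using k by simp
    have pn: "1 / real n \<le> p ^ (k - 1)" by (rule small_power_ge[OF \<mu>(1) k(3)])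
    have "p ^ (2 * r - k - 1) * (1 / real n) \<le> p ^ (2 * r - k - 1) * p ^ (k - 1)"
      using pn p_bounds by (intro mult_left_mono) auto
    also have "\<dots> = p ^ ((r - 1) * 2)"
      unfolding power_add[symmetric] using k by (intro arg_cong[where f = "power p"]) auto
    also have "\<dots> = (p ^ (r - 1))\<^sup>2" by (simp add: power_mult)
    also have "\<dots> \<le> (\<kappa> * (real r)\<^sup>2 / (real n)\<^sup>2)\<^sup>2" using up p_bounds by (intro power_mono) auto
    finally have "p ^ (2 * r - k - 1) \<le> (\<kappa> * (real r)\<^sup>2 / (real n)\<^sup>2)\<^sup>2 * real n"
      using n1 by (simp add: pos_divide_le_eq)
    hence "(real r)\<^sup>2 * (real n)\<^sup>2 * p ^ (2 * r - k - 1) \<le> (real r)\<^sup>2 * (real n)\<^sup>2 * ((\<kappa> * (real r)\<^sup>2 / (real n)\<^sup>2)\<^sup>2 * real n)"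
      by (intro mult_left_mono) auto
    hence bb: "(real r)\<^sup>2 * (real n)\<^sup>2 * p ^ (2 * r - k - 1) \<le> \<kappa>\<^sup>2 * real r ^ 6 / n"
      using base by (simp only: mult.assoc)
    have c1: "\<kappa>\<^sup>2 * real r ^ 6 / n \<le> 1" using big n1 by simp
    have "(T (r - k))\<^sup>2 \<le> ((real r)\<^sup>2 * (real n)\<^sup>2 * p ^ (2 * r - k - 1)) ^ k" by (rule sq)
    also have "\<dots> \<le> (\<kappa>\<^sup>2 * real r ^ 6 / n) ^ k" using bb p_bounds by (intro power_mono) auto
    also have "\<dots> \<le> (\<kappa>\<^sup>2 * real r ^ 6 / n)\<^sup>2" using c1 k2 by (intro power_decreasing) auto
    finally show ?thesis by (rule power2_le_imp_le) simp
  qed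
qed

text \<open>Derives the overlap estimates assumed by \<open>typical\<close> from the sizes of
  \<open>\<mu>\<close>, \<open>r\<close> and \<open>p\<close>. Here \<open>a\<close> is the constant
  in the upper bound for \<open>\<mu>\<close>, and \<open>big\<close> lets \<open>D\<close> dominate
  the powers of \<open>r\<close> that occur.\<close>

theorem typical':
  fixes D x \<kappa> a :: real
  assumes D: "200 \<le> D" "D ^ 6 \<le> n" and x: "1 / n \<le> x" "x\<^sup>2 \<le> n" "x * (x + 1) ^ 3 * D ^ 11 \<le> (real n)\<^sup>2"
    and \<mu>: "D \<le> \<mu>" "\<mu> \<le> a * n * x" "\<mu>\<^sup>2 \<le> (real n)^3"
    and \<kappa>: "1 \<le> \<kappa>" "(real n) ^ 3 \<le> \<kappa> ^ r" and r10: "10 \<le> r"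
    and big: "\<kappa>\<^sup>2 * real r ^ 16 / p ^ 5 + 4 * a * real r ^ 6 / p + a \<le> D"
    and pD: "1 / (1 - p) \<le> D" and rn: "(real r + 1) * ln n \<le> D\<^sup>2"
  shows "prb (\<lambda>w. \<not> well_approximated (D ^ 10 * x) (cl w)) \<le> 29 / D"
    and "2 * (q * \<mu>) \<le> x" and "q \<le> 1 / 2"
proof -
  have n1: "1 \<le> real n" "0 < real n" using r_n_pos by auto
  have D1: "1 \<le> D" using D by simp
  have x0: "0 < x" using x(1) n1 by (smt (verit) divide_pos_pos)
  have \<mu>1: "1 \<le> \<mu>" using \<mu> D1 by simp
  have a0: "0 < a"
  proof (rule ccontr)
    assume "\<not> ?thesis"
    hence "a * (n * x) \<le> 0" using n1 x0 by (intro mult_nonpos_nonneg) auto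
    thus False using \<mu>(2) \<mu>1 by (simp add: mult.assoc)
  qed
  have r1: "1 \<le> real r ^ i" for i using r_n_pos by (simp add: one_le_power)
  have p1: "p ^ i \<le> 1" "0 < p ^ i" for i using p_bounds p_pos by (auto simp: power_le_one)
  have K2: "1 \<le> \<kappa>\<^sup>2" using \<kappa> by (simp add: one_le_power)
  \<comment> \<open>A common bound for \<open>n * T s\<close> over \<open>3 \<le> s < r\<close>,
    valid in the ranges of both overlap lemmas.\<close>
  define W where "W = \<kappa>\<^sup>2 * real r ^ 15 / p ^ 5"
  have rW: "real r * W = \<kappa>\<^sup>2 * real r ^ 16 / p ^ 5" by (simp add: W_def eval_nat_numeral)
  have t0: "0 \<le> 4 * a * real r ^ 6 / p" using a0 p_pos by simp
  have rWD: "real r * W \<le> D" "4 * a * real r ^ 6 / p \<le> D" "a \<le> D" "real r * W + 4 * a * real r ^ 6 / p \<le> D"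
  proof -
    have "0 \<le> \<kappa>\<^sup>2 * real r ^ 16 / p ^ 5" using p1 by (intro divide_nonneg_pos) (auto simp: p_pos)
    thus "real r * W \<le> D" "4 * a * real r ^ 6 / p \<le> D" "a \<le> D" "real r * W + 4 * a * real r ^ 6 / p \<le> D"
      using big t0 a0 unfolding rW by linarith+
  qed
  have Dn: "D \<le> n"
  proof -
    have "D ^ 1 \<le> D ^ 6" using D1 by (intro power_increasing) auto
    thus ?thesis using D by simp
  qed
  have W1: "\<kappa>\<^sup>2 * real r ^ i \<le> W" if "i \<le> 15" for i
  proof -
    have "\<kappa>\<^sup>2 * real r ^ i \<le> \<kappa>\<^sup>2 * real r ^ 15"
      using that r_n_pos by (intro mult_left_mono power_increasing) auto
    also have "\<dots> \<le> W" unfolding W_def using p1[of 5] K2 mult_left_le[of "p ^ 5" "\<kappa>\<^sup>2 * real r ^ 15"]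
      by (simp add: pos_le_divide_eq)
    finally show ?thesis .
  qed
  have W0: "0 \<le> W" using W1[of 0] K2 by simp
  have WD: "W \<le> D" using rWD(1) mult_right_mono[of 1 "real r" W] W0 r_n_pos by simp
  have big1: "\<kappa>\<^sup>2 * real r ^ 6 \<le> n" using W1[of 6] WD Dn by simp
  have big2: "real r ^ 6 \<le> p ^ 3 * n"
  proof -
    have "real r ^ 6 / p ^ 3 \<le> \<kappa>\<^sup>2 * real r ^ 15 / p ^ 5"
    proof (intro frac_le)
      have "real r ^ 6 \<le> real r ^ 15" using r_n_pos by (intro power_increasing) auto
      also have "\<dots> \<le> \<kappa>\<^sup>2 * real r ^ 15" using K2 r1[of 15] mult_right_mono[of 1 "\<kappa>\<^sup>2" "real r ^ 15"] by simp
      finally show "real r ^ 6 \<le> \<kappa>\<^sup>2 * real r ^ 15" .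
      show "p ^ 5 \<le> p ^ 3" using p_bounds by (intro power_decreasing) auto
    qed (use p1 p_pos in auto)
    also have "\<dots> \<le> n" using WD Dn by (simp add: W_def)
    finally show ?thesis using p1(2)[of 3] by (simp add: pos_divide_le_eq mult.commute)
  qed
  have Ts: "T s \<le> W / n" if s: "3 \<le> s" "s < r" for s
  proof (cases "2 * (s - 1) \<le> r - 1")
    case True
    have "T s \<le> real r ^ 15 / p ^ 5 / n" by (rule T_small_overlap[OF \<mu>1 \<mu>(3) s(1) True big2])
    also have "\<dots> \<le> W / n"
      unfolding W_def using K2 p1 p_pos n1 r1[of 15] mult_right_mono[of 1 "\<kappa>\<^sup>2" "real r ^ 15"]
      by (intro divide_right_mono) auto
    finally show ?thesis .
  next
    case False
    have "T (r - (r - s)) \<le> \<kappa>\<^sup>2 * real r ^ 6 / n"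
      using False s by (intro T_large_overlap[OF \<mu>1 \<mu>(3) \<kappa> _ _ _ big1]) auto
    also have "\<dots> \<le> W / n" using W1[of 6] by (intro divide_right_mono) auto
    finally show ?thesis using s by simp
  qed
  have d3: "d3 \<le> real r * W / n"
  proof -
    have "d3 \<le> (\<Sum>s\<in>{3..<r}. W / n)" unfolding d3_def by (intro sum_mono Ts) auto
    also have "\<dots> = real (r - 3) * (W / n)" by simp
    also have "\<dots> \<le> real r * (W / n)" using W0 n1 by (intro mult_right_mono) auto
    finally show ?thesis by simp
  qed
  have \<mu>n: "\<mu> / (real n)\<^sup>2 \<le> a * x / n"
  proof -
    have "\<mu> / (real n)\<^sup>2 \<le> (a * n * x) / (real n)\<^sup>2" using \<mu>(2) by (intro divide_right_mono) auto
    also have "\<dots> = a * x / n" using n1 by (simp add: power2_eq_square)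
    finally show ?thesis .
  qed
  have T2: "T 2 \<le> (4 * a * real r ^ 6 / p) * x / n"
  proof -
    have "T 2 \<le> \<mu> * (real r ^ 3 / real n) ^ 2 / p ^ (2 choose 2)"
      using r_ge by (intro T_le_mean) auto
    also have "\<dots> = (\<mu> / (real n)\<^sup>2) * (real r ^ 6 / p)" by (simp add: power_divide power_mult[symmetric])
    also have "\<dots> \<le> (a * x / n) * (real r ^ 6 / p)" using \<mu>n p_pos by (intro mult_right_mono) auto
    also have "\<dots> = a * real r ^ 6 / p * x / n" by (simp add: mult_ac)
    also have "\<dots> \<le> 4 * (a * real r ^ 6 / p * x / n)"
    proof -
      have "t \<le> 4 * t" if "0 \<le> t" for t :: real using that by simp
      thus ?thesis using a0 p_pos x0 by (simp del: times_divide_eq_right times_divide_eq_left)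
    qed
    finally show ?thesis by simp
  qed
  have d2: "d2 \<le> D * (x + 1) / n"
  proof -
    have "d2 \<le> (4 * a * real r ^ 6 / p) * x / n + real r * W / n" using d2_eq T2 d3 by simp
    also have "\<dots> \<le> D * x / n + D / n"
      using rWD x0 n1 by (intro add_mono divide_right_mono mult_right_mono) auto
    finally show ?thesis by (simp add: distrib_left add_divide_distrib)
  qed
  have rate: "rate \<le> D * x / n"
  proof -
    have "(n choose r) * (r choose 2) = (n choose 2) * ((n - 2) choose (r - 2))"
      using r_ge r_le by (intro choose_mult) auto
    hence eq: "real (n choose r) * real (r choose 2) = real (n choose 2) * real ((n - 2) choose (r - 2))"
      by (simp flip: of_nat_mult)
    have n2: "(real n)\<^sup>2 / 4 \<le> real (n choose 2)"
      using binomial_ge_n_over_k_pow_k[of 2 n, where 'a = real] r_ge r_le by (simp add: power_divide)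
    have "(real n)\<^sup>2 / 4 * real ((n - 2) choose (r - 2)) \<le> real (n choose 2) * real ((n - 2) choose (r - 2))"
      using n2 by (intro mult_right_mono) auto
    hence "real ((n - 2) choose (r - 2)) \<le> 4 * (real (n choose r) * real (r choose 2)) / (real n)\<^sup>2"
      using n1 unfolding eq[symmetric] by (simp add: field_simps)
    hence "real (r choose 2) * (1/p - 1) * q * real ((n - 2) choose (r - 2))
      \<le> real (r choose 2) * (1/p - 1) * q * (4 * (real (n choose r) * real (r choose 2)) / (real n)\<^sup>2)"
      using inv_p q_pos by (intro mult_left_mono) auto
    hence "rate \<le> real (r choose 2) * (1/p - 1) * q * (4 * (real (n choose r) * real (r choose 2)) / (real n)\<^sup>2)"
      by (simp only: rate_def edge_rate_def mult_ac)
    also have "\<dots> = 4 * (\<mu> / (real n)\<^sup>2) * ((real (r choose 2))\<^sup>2 * (1/p - 1))"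
      by (simp add: \<mu>_def power2_eq_square)
    also have "\<dots> \<le> 4 * (a * x / n) * (real r ^ 6 * (1/p))"
    proof (intro mult_mono)
      have "r choose 2 \<le> r ^ 2" by (rule binomial_le_pow) (use r_ge in simp)
      hence "real (r choose 2) \<le> real r ^ 2" by (simp flip: of_nat_power)
      hence "(real (r choose 2))\<^sup>2 \<le> (real r ^ 2)\<^sup>2" by (intro power_mono) auto
      also have "\<dots> = real r ^ 4" by (simp add: power_mult[symmetric])
      also have "\<dots> \<le> real r ^ 6" using r_n_pos by (intro power_increasing) auto
      finally show "(real (r choose 2))\<^sup>2 \<le> real r ^ 6" .
    qed (use \<mu>n inv_p a0 x0 \<mu>_pos in auto)
    also have "\<dots> = (4 * a * real r ^ 6 / p) * x / n" by (simp add: mult_ac)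
    also have "\<dots> \<le> D * x / n" using rWD x0 n1 by (intro divide_right_mono mult_right_mono) auto
    finally show ?thesis .
  qed
  have q5: "q \<le> 1 / real n ^ 5"
  proof (rule power2_le_imp_le)
    \<comment> \<open>Each of the \<open>r\<close> factors is at most \<open>1 / n\<close>, and
      there are at least ten of them.\<close>
    have "q\<^sup>2 = (p ^ (r - 1)) ^ r" by (simp add: q_def power_choose_two)
    also have "\<dots> \<le> (1 / real n) ^ r"
    proof (intro power_mono)
      have "p ^ (r - 1) \<le> \<kappa> * (real r)\<^sup>2 / (real n)\<^sup>2" using edge_power_upper \<mu> \<kappa> by simp
      also have "\<dots> \<le> real n / (real n)\<^sup>2"
      proof (intro divide_right_mono)
        have "\<kappa> * (real r)\<^sup>2 \<le> \<kappa>\<^sup>2 * (real r)\<^sup>2"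
          using \<kappa> self_le_power[of \<kappa> 2] by (intro mult_right_mono) auto
        also have "\<dots> \<le> W" using W1[of 2] by simp
        also have "\<dots> \<le> n" using WD Dn by simp
        finally show "\<kappa> * (real r)\<^sup>2 \<le> n" .
      qed auto
      also have "\<dots> = 1 / real n" using n1 by (simp add: power2_eq_square)
      finally show "p ^ (r - 1) \<le> 1 / real n" .
    qed (use p_bounds in auto)
    also have "\<dots> \<le> (1 / real n) ^ 10" using n1 r10 by (intro power_decreasing) auto
    also have "\<dots> = (1 / real n ^ 5)\<^sup>2" by (simp add: power_divide power_mult[symmetric])
    finally show "q\<^sup>2 \<le> (1 / real n ^ 5)\<^sup>2" .
  qed auto
  have q1: "q \<le> 1 / n"
  proof -
    have "1 / real n ^ 5 \<le> 1 / real n ^ 1" using n1 by (intro divide_left_mono power_increasing) auto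
    thus ?thesis using q5 by simp
  qed
  have card_ge: "real n \<le> real (n choose r)"
  proof -
    have "1 \<le> real (n choose r) * q" using \<mu>1 by (simp add: \<mu>_def)
    also have "\<dots> \<le> real (n choose r) * (1 / n)" using q1 by (intro mult_left_mono) auto
    finally show ?thesis using n1 by (simp add: field_simps)
  qed
  have lnN: "ln (real (Suc (card R))) \<le> D\<^sup>2"
  proof -
    have n2: "2 \<le> n" using r_ge r_le by simp
    have "Suc (n choose r) \<le> 2 * n ^ r" using binomial_le_pow[OF r_le] n2 one_le_power[of n r] by linarith
    also have "\<dots> \<le> n * n ^ r" using n2 by simp
    finally have "real (Suc (n choose r)) \<le> real (n ^ (r + 1))" by (simp only: of_nat_le_iff power_add power_one_right mult.commute)
    hence "ln (real (Suc (n choose r))) \<le> ln (real n ^ (r + 1))"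
      using n1 by (subst ln_le_cancel_iff) (auto simp del: of_nat_Suc)
    also have "\<dots> = (real r + 1) * ln n" using n1 by (subst ln_realpow) (auto simp: add.commute)
    finally show ?thesis using rn by (simp add: card_R)
  qed
  have pinv: "1 / p \<le> D"
  proof -
    have "1 / p \<le> 1 / p ^ 5" using p_pos p_bounds power_decreasing[of 1 5 p] p1 by (intro divide_left_mono) auto
    also have "\<dots> \<le> (\<kappa>\<^sup>2 * real r ^ 15) / p ^ 5"
      using K2 r1[of 15] p1 p_pos mult_mono[of 1 "\<kappa>\<^sup>2" 1 "real r ^ 15"] by (intro divide_right_mono) auto
    also have "\<dots> \<le> D" using WD by (simp add: W_def)
    finally show ?thesis .
  qed
  have rD: "real r \<le> D"
    using W1[of 1] WD mult_right_mono[of 1 "\<kappa>\<^sup>2" "real r"] K2 by simp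
  show "prb (\<lambda>w. \<not> well_approximated (D ^ 10 * x) (cl w)) \<le> 29 / D"
  proof (rule typical[OF D x \<mu>(1) _ _ d2 rate pinv pD rD lnN _ q5])
    show "\<mu> \<le> D * n * x" using \<mu>(2) mult_right_mono[OF rWD(3), of "n * x"] x0 by (simp add: mult.assoc)
    show "d3 \<le> D / n" using d3 divide_right_mono[OF rWD(1), of n] by simp
    show "real n \<le> real (Suc (card R))" using card_ge by (simp add: card_R)
  qed
  show "2 * (q * \<mu>) \<le> x"
  proof -
    have "q * \<mu> \<le> (1 / real n ^ 5) * (a * n * x)" using q5 \<mu> \<mu>_pos by (intro mult_mono) auto
    also have "\<dots> \<le> (1 / real n ^ 5) * (n * n * x)" using rWD(3) Dn n1 x0 by (intro mult_left_mono mult_right_mono) auto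
    also have "\<dots> = x / real n ^ 3" using n1 by (simp add: eval_nat_numeral)
    finally have 1: "q * \<mu> \<le> x / real n ^ 3" .
    have "2 \<le> real n" using r_ge r_le by simp
    also have "\<dots> \<le> real n ^ 3" using n1 by (intro self_le_power) auto
    finally have "x / real n ^ 3 \<le> x / 2" using x0 n1 by (intro divide_left_mono) auto
    thus ?thesis using 1 by linarith
  qed
  have "1 / real n \<le> 1 / 2" using r_ge r_le by (intro divide_left_mono) auto
  thus "q \<le> 1 / 2" using q1 by linarith
qed

end

section \<open>The binomial random graph\<close>

lemma gnp_eq_map:
  "gnp n p = map_pmf (\<lambda>w. ({..<n}, w))
     (map_pmf (\<lambda>b. {e \<in> nsets {..<n} 2. b e}) (Pi_pmf (nsets {..<n} 2) False (\<lambda>_. bernoulli_pmf p)))"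
  by (simp add: gnp_def pmf.map_comp comp_def)

lemma pmf_random_subset:
  assumes fin: "finite E" and w: "w \<subseteq> E" and p: "0 \<le> p" "p \<le> 1"
  shows "pmf (map_pmf (\<lambda>b. {e\<in>E. b e}) (Pi_pmf E False (\<lambda>_. bernoulli_pmf p))) w
    = p ^ card w * (1 - p) ^ card (E - w)"
proof -
  let ?P = "Pi_pmf E False (\<lambda>_. bernoulli_pmf p)"
  have "pmf (map_pmf (\<lambda>b. {e\<in>E. b e}) ?P) w = measure ?P ((\<lambda>b. {e\<in>E. b e}) -` {w})"
    by (rule pmf_map)
  \<comment> \<open>The preimage also contains functions that are true somewhere outside
    \<open>E\<close>; the product measure fixes the value \<open>False\<close> there, so they have
    probability 0.\<close>
  also have "\<dots> = measure ?P {\<lambda>e. e \<in> w}"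
  proof (rule measure_prob_cong_0)
    fix b assume b: "b \<in> (\<lambda>b. {e\<in>E. b e}) -` {w} - {\<lambda>e. e \<in> w}"
    show "pmf ?P b = 0"
    proof (rule pmf_Pi_outside[OF fin])
      show "\<exists>x. x \<notin> E \<and> b x \<noteq> False"
      proof (rule ccontr)
        assume "\<not> ?thesis"
        hence "b = (\<lambda>e. e \<in> w)" using b by auto
        thus False using b by simp
      qed
    qed
  next
    fix b assume "b \<in> {\<lambda>e. e \<in> w} - (\<lambda>b. {e\<in>E. b e}) -` {w}"
    thus "pmf ?P b = 0" using w by auto
  qed
  also have "\<dots> = pmf ?P (\<lambda>e. e \<in> w)" by (simp add: pmf.rep_eq)
  also have "\<dots> = (\<Prod>e\<in>E. pmf (bernoulli_pmf p) (e \<in> w))"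
    using w by (intro pmf_Pi'[OF fin]) auto
  also have "\<dots> = (\<Prod>e\<in>E. if e \<in> w then p else 1 - p)"
    using p by (intro prod.cong) auto
  also have "\<dots> = p ^ card w * (1 - p) ^ card (E - w)"
    using fin w by (simp add: prod.If_cases Int_absorb1 Diff_eq[symmetric])
  finally show ?thesis .
qed

context clique_model
begin

lemma gnp_prob: "measure_pmf.prob (gnp n p) {G. Q G} = prb (\<lambda>w. Q (V, w))"
proof -
  let ?M = "map_pmf (\<lambda>b. {e\<in>E. b e}) (Pi_pmf E False (\<lambda>_. bernoulli_pmf p))"
  have "measure_pmf.prob (gnp n p) {G. Q G} = measure ?M {w. Q (V, w)}"
    by (simp add: gnp_eq_map vimage_def)
  also have "\<dots> = measure ?M {w\<in>Pow E. Q (V, w)}"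
  proof (rule measure_prob_cong_0)
    fix w assume "w \<in> {w. Q (V, w)} - {w\<in>Pow E. Q (V, w)}"
    hence "\<not> w \<subseteq> E" by auto
    thus "pmf ?M w = 0" by (intro pmf_eq_0_set_pmf[THEN iffD2]) auto
  qed auto
  also have "\<dots> = (\<Sum>w\<in>{w\<in>Pow E. Q (V, w)}. pmf ?M w)"
    by (rule measure_measure_pmf_finite) simp
  also have "\<dots> = (\<Sum>w\<in>{w\<in>Pow E. Q (V, w)}. p ^ card w * (1 - p) ^ card (E - w))"
    using p_bounds by (intro sum.cong refl pmf_random_subset) auto
  also have "\<dots> = (\<Sum>w\<in>Pow E. p ^ card w * (1 - p) ^ card (E - w) * of_bool (Q (V, w)))"
    by (intro sum.mono_neutral_cong_left) auto
  finally show ?thesis by (simp add: pr_def expec_def)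
qed

text \<open>An isomorphism to the complete graph carries every pair to the image of an edge;
  injectivity on subsets of \<open>S\<close> pulls this back. Conversely any bijection onto
  \<open>{..<r}\<close> will do.\<close>

lemma isomorphic_complete_iff:
  assumes S: "S \<in> R" and w: "w \<subseteq> E"
  shows "isomorphic (induced (V, w) S) (complete_graph {..<r}) \<longleftrightarrow> K S \<subseteq> w"
proof
  assume "isomorphic (induced (V, w) S) (complete_graph {..<r})"
  then obtain f where f: "bij_betw f S {..<r}" "nsets {..<r} 2 = (`) f ` {e\<in>w. e \<subseteq> S}"
    by (auto simp: isomorphic_def induced_def complete_graph_def)
  show "K S \<subseteq> w"
  proof
    fix e assume e: "e \<in> K S"
    have "bij_betw (\<lambda>X. f ` X) (nsets S 2) (nsets {..<r} 2)" by (rule bij_betw_nsets[OF f(1)])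
    hence "f ` e \<in> nsets {..<r} 2" using e unfolding K_def bij_betw_def by blast
    then obtain e' where e': "e' \<in> w" "e' \<subseteq> S" "f ` e = f ` e'" unfolding f(2) by blast
    have "e \<subseteq> S" using e by (auto simp: K_def nsets_def)
    hence "e = e'" using e' f(1) inj_on_image_eq_iff[of f S e e'] by (auto simp: bij_betw_def)
    thus "e \<in> w" using e' by simp
  qed
next
  assume K: "K S \<subseteq> w"
  have eq: "{e\<in>w. e \<subseteq> S} = nsets S 2"
    using K w by (auto simp: K_def nsets_def)
  obtain f where f: "bij_betw f S {..<r}"
    using finite_same_card_bij[of S "{..<r}"] RD[OF S] by auto
  have "(`) f ` nsets S 2 = nsets {..<r} 2"
    using bij_betw_nsets[OF f, of 2] by (simp add: bij_betw_def)
  thus "isomorphic (induced (V, w) S) (complete_graph {..<r})"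
    using f by (auto simp: isomorphic_def induced_def complete_graph_def eq)
qed

lemma clique_hypergraph_eq: "w \<subseteq> E \<Longrightarrow> clique_hypergraph r (V, w) = (V, cl w)"
  by (simp add: clique_hypergraph_def cl_def R_def[symmetric] isomorphic_complete_iff cong: conj_cong)

lemma gnp_clique_prob:
  "measure_pmf.prob (gnp n p) {G. Q (clique_hypergraph r G)} = prb (\<lambda>w. Q (V, cl w))"
  unfolding gnp_prob by (intro pr_cong) (simp add: clique_hypergraph_eq)

lemma gnp_clique_prob_eq:
  "measure_pmf.prob (gnp n p) {G. clique_hypergraph r G = (V, F)} = PH F"
  using gnp_clique_prob[of "\<lambda>H. H = (V, F)"] by (simp add: PH_def)

lemma shadow_edges: "F \<subseteq> R \<Longrightarrow> num_edges (shadow_graph (V, F)) = card (U F)"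
proof -
  assume F: "F \<subseteq> R"
  have "{e \<in> nsets V 2. \<exists>h\<in>F. e \<subseteq> h} = U F"
  proof (intro equalityI subsetI)
    fix e assume "e \<in> {e \<in> nsets V 2. \<exists>h\<in>F. e \<subseteq> h}"
    thus "e \<in> U F" by (auto simp: U_def K_def nsets_def)
  next
    fix e assume e: "e \<in> U F"
    then obtain h where h: "h \<in> F" "e \<in> K h" by (auto simp: U_def)
    have "e \<in> nsets V 2" using e U_sub[OF F] by blast
    moreover have "e \<subseteq> h" using h(2) by (simp add: K_def nsets_def)
    ultimately show "e \<in> {e \<in> nsets V 2. \<exists>h\<in>F. e \<subseteq> h}" using h(1) by blast
  qed
  thus ?thesis by (simp add: num_edges_def shadow_graph_def)
qed

section \<open>Matching the formula of the theorem\<close>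

lemma Lambda'_eq: "Lambda' n p r = \<Lambda>"
  by (simp add: Lambda'_def \<Lambda>_def \<mu>_def q_def mult_2 power_add inverse_eq_divide)

lemma clique_mean_eq: "clique_mean n p r = \<mu>"
  by (simp add: clique_mean_def \<mu>_def q_def)

text \<open>By its definition \<open>t(H)\<close> is the number of edges that the power of \<pi>
  counts in excess, so the powers of \<open>p\<close> combine to that of the shadow graph.\<close>

lemma overlap_power:
  assumes F: "F \<subseteq> R"
  shows "clique_prob p r ^ num_edges (V, F) * p powi (- overlap r (V, F)) = p ^ card (U F)"
proof -
  have "clique_prob p r ^ num_edges (V, F) = p powi (int (r choose 2) * int (card F))"
    by (simp add: clique_prob_def num_edges_def power_mult power_int_mult)
  moreover have "- overlap r (V, F) = int (card (U F)) - int (r choose 2) * int (card F)"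
    using shadow_edges[OF F] by (simp add: overlap_def num_edges_def)
  ultimately have "clique_prob p r ^ num_edges (V, F) * p powi (- overlap r (V, F))
    = p powi (int (r choose 2) * int (card F) + (int (card (U F)) - int (r choose 2) * int (card F)))"
    using p_pos by (simp only:) (rule power_int_add[symmetric], simp)
  thus ?thesis by simp
qed

text \<open>The power of 1 - \<pi> in the theorem supplies \<open>exp (- \<mu>)\<close>, up to
  \<open>q * card F\<close> from its exponent and \<open>2 * q\<^sup>2\<close> per set from the
  logarithm.\<close>

lemma no_clique_factor:
  assumes F: "F \<subseteq> R" "real (card F) \<le> 2 * \<mu>" and q: "q \<le> 1/2"
  shows "\<bar>real ((n choose r) - card F) * ln (1 - q) + \<mu>\<bar> \<le> 2 * (q * \<mu>)"
proof -
  have le: "card F \<le> n choose r" using F(1) card_mono[OF fin_R F(1)] by (simp add: card_R)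
  have ln: "- q - 2 * q\<^sup>2 \<le> ln (1 - q)" "ln (1 - q) \<le> - q"
    using ln_one_minus_pos_lower_bound[of q] ln_add_one_self_le_self2[of "- q"] q q_pos by auto
  let ?c = "real ((n choose r) - card F)"
  have c: "?c = real (n choose r) - real (card F)" using le by (simp add: of_nat_diff)
  have "?c * ln (1 - q) \<le> ?c * (- q)" using ln by (intro mult_left_mono) auto
  also have "\<dots> = - \<mu> + q * card F" by (simp add: c \<mu>_def algebra_simps)
  also have "q * card F \<le> q * (2 * \<mu>)" using F q_pos by (intro mult_left_mono) auto
  finally have 1: "?c * ln (1 - q) + \<mu> \<le> 2 * (q * \<mu>)" by simp
  have "- ?c * ln (1 - q) \<le> ?c * (q + 2 * q\<^sup>2)"
    using mult_left_mono[OF ln(1), of ?c] by (simp add: algebra_simps)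
  also have "\<dots> \<le> real (n choose r) * (q + 2 * q\<^sup>2)" using q_pos by (intro mult_right_mono) (auto simp: c)
  also have "\<dots> = \<mu> + 2 * (q * \<mu>)" by (simp add: \<mu>_def power2_eq_square algebra_simps)
  finally show ?thesis using 1 by simp
qed

text \<open>The error is defined as the logarithm of the quotient of both sides; the two bounds in
  \<open>well_approximated\<close> and \<open>no_clique_factor\<close> then limit it.\<close>

theorem approximation:
  assumes F: "F \<subseteq> R" and good: "well_approximated b F" and q: "q \<le> 1/2"
  shows "\<exists>e. \<bar>e\<bar> \<le> b + 2 * (q * \<mu>) \<and>
    measure_pmf.prob (gnp n p) {G. clique_hypergraph r G = (V, F)} =
      clique_prob p r ^ num_edges (V, F) * (1 - clique_prob p r) ^ ((n choose r) - num_edges (V, F))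
      * p powi (- overlap r (V, F)) * exp (- Lambda' n p r + e)"
proof -
  define Z where "Z = p ^ card (U F) * (1 - q) ^ ((n choose r) - card F) * exp (- \<Lambda>)"
  define l where "l = real ((n choose r) - card F) * ln (1 - q)"
  have pU: "0 < p ^ card (U F)" using p_pos by simp
  have g: "real (card F) \<le> 2 * \<mu>" "p ^ card (U F) * exp (- \<mu> - \<Lambda> - b) \<le> PH F"
    "PH F \<le> p ^ card (U F) * exp (- \<mu> - \<Lambda> + b)"
    using good by (auto simp: well_approximated_def)
  have pos: "0 < PH F" by (rule less_le_trans[OF mult_pos_pos[OF pU exp_gt_zero] g(2)])
  have pw: "(1 - q) ^ ((n choose r) - card F) = exp l"
    using q unfolding l_def by (subst exp_of_nat_mult) auto
  have Z: "Z = p ^ card (U F) * exp (l - \<Lambda>)" unfolding Z_def pw by (simp add: exp_diff exp_minus field_simps)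
  have Zpos: "0 < Z" using pU by (simp add: Z)
  define e where "e = ln (PH F / Z)"
  have PH: "PH F = Z * exp e" using pos Zpos by (simp add: e_def)
  have l: "\<bar>l + \<mu>\<bar> \<le> 2 * (q * \<mu>)" unfolding l_def by (rule no_clique_factor[OF F g(1) q])
  have PH': "PH F = p ^ card (U F) * exp (l - \<Lambda> + e)" by (simp add: PH Z exp_add)
  have "exp (- \<mu> - \<Lambda> - b) \<le> exp (l - \<Lambda> + e)" "exp (l - \<Lambda> + e) \<le> exp (- \<mu> - \<Lambda> + b)"
    using g(2,3) pU unfolding PH' by auto
  hence "\<bar>e\<bar> \<le> b + 2 * (q * \<mu>)" using l by auto
  moreover have "PH F = clique_prob p r ^ num_edges (V, F) * (1 - clique_prob p r) ^ ((n choose r) - num_edges (V, F))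
      * p powi (- overlap r (V, F)) * exp (- Lambda' n p r + e)"
  proof -
    have "1 - clique_prob p r = 1 - q" "num_edges (V, F) = card F"
      by (simp_all add: clique_prob_def q_def num_edges_def)
    hence "clique_prob p r ^ num_edges (V, F) * (1 - clique_prob p r) ^ ((n choose r) - num_edges (V, F))
      * p powi (- overlap r (V, F)) * exp (- Lambda' n p r + e)
      = (clique_prob p r ^ num_edges (V, F) * p powi (- overlap r (V, F))) * (1 - q) ^ ((n choose r) - card F)
        * exp (- \<Lambda> + e)"
      by (simp only: Lambda'_eq mult_ac)
    also have "\<dots> = Z * exp e" unfolding overlap_power[OF F] exp_add by (simp add: Z_def)
    finally show ?thesis using PH by simp
  qed
  ultimately show ?thesis unfolding gnp_clique_prob_eq by blast
qed

end

section \<open>Asymptotics\<close>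

text \<open>The exponent 20 leaves room above 16, the largest power of \<open>r\<close> in the
  overlap estimates, when \<open>r\<close> is of the order of \<open>ln n\<close>.\<close>

lemma ln_power_bounds:
  fixes \<epsilon> a0 a c c' \<kappa> :: real
  assumes "\<epsilon> > 0" "a0 > 0" "c' > 0" "c > 0" "a > 0"
  shows "\<forall>\<^sub>F n :: nat in at_top. 200 \<le> ln n ^ 20 \<and> (ln n ^ 20) ^ 6 \<le> real n
     \<and> 8 * (ln n ^ 20) ^ 11 \<le> real n powr (4 * \<epsilon>) \<and> ln n ^ 20 \<le> a0 * real n powr \<epsilon>
     \<and> a\<^sup>2 \<le> real n powr (2 * \<epsilon>) \<and> 10 \<le> c' * ln n
     \<and> \<kappa>\<^sup>2 * (c * ln n) ^ 16 / \<epsilon> ^ 5 + 4 * a * (c * ln n) ^ 6 / \<epsilon> + a \<le> ln n ^ 20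
     \<and> 1 / \<epsilon> \<le> ln n ^ 20 \<and> (c * ln n + 1) * ln n \<le> (ln n ^ 20)\<^sup>2 \<and> c * ln n \<le> real n \<and> 1 \<le> ln n"
  (is "eventually ?P _")
proof -
  have "\<forall>\<^sub>F n :: nat in at_top. 200 \<le> ln (real n) ^ 20" by real_asymp
  moreover have "\<forall>\<^sub>F n :: nat in at_top. (ln (real n) ^ 20) ^ 6 \<le> real n" by real_asymp
  moreover have "\<forall>\<^sub>F n :: nat in at_top. 8 * (ln (real n) ^ 20) ^ 11 \<le> real n powr (4 * \<epsilon>)"
    using assms by real_asymp
  moreover have "\<forall>\<^sub>F n :: nat in at_top. ln (real n) ^ 20 \<le> a0 * real n powr \<epsilon>"
    using assms by real_asymp
  moreover have "\<forall>\<^sub>F n :: nat in at_top. a\<^sup>2 \<le> real n powr (2 * \<epsilon>)"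
    using assms by real_asymp
  moreover have "\<forall>\<^sub>F n :: nat in at_top. 10 \<le> c' * ln (real n)"
    using assms by real_asymp
  moreover have "\<forall>\<^sub>F n :: nat in at_top. \<kappa>\<^sup>2 * (c * ln (real n)) ^ 16 / \<epsilon> ^ 5 + 4 * a * (c * ln (real n)) ^ 6 / \<epsilon> + a \<le> ln (real n) ^ 20"
  proof -
    \<comment> \<open>The constants are first dominated by \<open>ln n\<close> itself, which leaves
      a comparison of pure powers.\<close>
    define b1 where "b1 = \<kappa>\<^sup>2 * c ^ 16 / \<epsilon> ^ 5"
    define b2 where "b2 = 4 * a * c ^ 6 / \<epsilon>"
    have "\<forall>\<^sub>F n :: nat in at_top. \<bar>b1\<bar> \<le> ln (real n)" by real_asymp
    moreover have "\<forall>\<^sub>F n :: nat in at_top. \<bar>b2\<bar> \<le> ln (real n)" by real_asymp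
    moreover have "\<forall>\<^sub>F n :: nat in at_top. \<bar>a\<bar> \<le> ln (real n)" by real_asymp
    moreover have "\<forall>\<^sub>F n :: nat in at_top. 3 \<le> ln (real n)" by real_asymp
    ultimately show ?thesis
    proof eventually_elim
      case (elim n)
      define L where "L = ln (real n)"
      have L: "\<bar>b1\<bar> \<le> L" "\<bar>b2\<bar> \<le> L" "\<bar>a\<bar> \<le> L" "3 \<le> L" using elim by (auto simp: L_def)
      have pw: "L ^ i \<le> L ^ j" if "i \<le> j" for i j using that L by (intro power_increasing) auto
      have "\<kappa>\<^sup>2 * (c * L) ^ 16 / \<epsilon> ^ 5 + 4 * a * (c * L) ^ 6 / \<epsilon> + a = b1 * L ^ 16 + b2 * L ^ 6 + a"
        by (simp add: b1_def b2_def power_mult_distrib)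
      also have "\<dots> \<le> L * L ^ 16 + L * L ^ 6 + L"
        using L by (intro add_mono mult_right_mono) auto
      also have "\<dots> = L ^ 17 + L ^ 7 + L ^ 1" by (simp add: power_Suc[symmetric])
      also have "\<dots> \<le> L ^ 19 + L ^ 19 + L ^ 19" by (intro add_mono pw) auto
      also have "\<dots> = 3 * L ^ 19" by simp
      also have "\<dots> \<le> L * L ^ 19" using L by (intro mult_right_mono) auto
      also have "\<dots> = L ^ 20" by (simp add: power_Suc[symmetric])
      finally show ?case by (simp add: L_def)
    qed
  qed
  moreover have "\<forall>\<^sub>F n :: nat in at_top. 1 / \<epsilon> \<le> ln (real n) ^ 20" by real_asymp
  moreover have "\<forall>\<^sub>F n :: nat in at_top. (c * ln (real n) + 1) * ln (real n) \<le> (ln (real n) ^ 20)\<^sup>2"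
    using assms by real_asymp
  moreover have "\<forall>\<^sub>F n :: nat in at_top. c * ln (real n) \<le> real n" using assms by real_asymp
  moreover have "\<forall>\<^sub>F n :: nat in at_top. 1 \<le> ln (real n)" by real_asymp
  ultimately show ?thesis by eventually_elim blast
qed

lemma cube_bound:
  fixes n x \<epsilon> :: real
  assumes n: "1 \<le> n" and x: "0 < x" "x \<le> n powr (1/2 - \<epsilon>)" and \<epsilon>: "\<epsilon> \<le> 1/2"
  shows "x * (x + 1) ^ 3 \<le> 8 * n powr (2 - 4 * \<epsilon>)"
proof -
  define z where "z = n powr (1/2 - \<epsilon>)"
  have z1: "1 \<le> z" unfolding z_def using n \<epsilon> by (simp add: ge_one_powr_ge_zero)
  have z4: "z ^ 4 = n powr (2 - 4 * \<epsilon>)"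
    unfolding z_def using n by (simp add: powr_power algebra_simps)
  have "x * (x + 1) ^ 3 \<le> z * (2 * z) ^ 3"
    using x z1 by (intro mult_mono power_mono) (auto simp: z_def)
  also have "\<dots> = 8 * z ^ 4" by (simp add: eval_nat_numeral)
  finally show ?thesis by (simp add: z4)
qed

text \<open>The quotient of \<open>r\<close> and \<open>2 * log (1 / p) n\<close> eventually lies
  between 1/2 and 3/2. As \<open>p\<close> stays between \<open>\<epsilon>\<close> and
  \<open>1 - \<epsilon>\<close>, the base of the logarithm matters only up to constants.\<close>

lemma clique_size_bounds:
  fixes r :: "nat \<Rightarrow> nat" and p :: "nat \<Rightarrow> real"
  assumes \<epsilon>: "0 < \<epsilon>" and p: "\<And>n. n \<in> N \<Longrightarrow> \<epsilon> < p n \<and> p n < 1 - \<epsilon>"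
    and r: "(\<lambda>n. real (r n)) \<sim>[at_top_through N] (\<lambda>n. 2 * log (1 / p n) (real n))"
  shows "\<forall>\<^sub>F n in at_top_through N. n \<in> N \<and> ln n / ln (1 / \<epsilon>) \<le> r n \<and> r n \<le> 3 / ln (1 / (1 - \<epsilon>)) * ln n"
proof -
  let ?g = "\<lambda>n. 2 * log (1 / p n) (real n)"
  have "((\<lambda>n. if real (r n) = 0 \<and> ?g n = 0 then 1 else real (r n) / ?g n) \<longlongrightarrow> 1) (at_top_through N)"
    using r by (simp add: asymp_equiv_def)
  hence "\<forall>\<^sub>F n in at_top_through N. dist (if real (r n) = 0 \<and> ?g n = 0 then 1 else real (r n) / ?g n) 1 < 1/2"
    by (rule tendstoD) simp
  moreover have "\<forall>\<^sub>F n in at_top_through N. n \<in> N"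
    by (simp add: eventually_inf_principal)
  moreover have "\<forall>\<^sub>F n in at_top_through N. n > (1::nat)"
    by (intro filter_leD[OF inf_le1] eventually_gt_at_top)
  ultimately show ?thesis
  proof eventually_elim
    case (elim n)
    have p': "\<epsilon> < p n" "p n < 1 - \<epsilon>" "0 < p n" using p[OF elim(2)] \<epsilon> by auto
    have n: "0 < ln (real n)" using elim by simp
    have lp: "ln (1 / p n) \<le> ln (1 / \<epsilon>)" "ln (1 / (1 - \<epsilon>)) \<le> ln (1 / p n)" "0 < ln (1 / (1 - \<epsilon>))"
      using p' \<epsilon> by (auto simp: field_simps)
    have g: "?g n = 2 * ln n / ln (1 / p n)" by (simp add: log_def)
    \<comment> \<open>This excludes the case in which asymptotic equivalence counts 0 divided by 0
      as 1.\<close>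
    have gpos: "0 < ?g n" unfolding g using n lp by (intro divide_pos_pos) auto
    have "\<bar>real (r n) / ?g n - 1\<bar> < 1/2" using elim(1) gpos by (simp add: dist_real_def)
    hence "1/2 < real (r n) / ?g n" "real (r n) / ?g n < 3/2" by linarith+
    hence b: "?g n / 2 < real (r n)" "real (r n) < 3/2 * ?g n"
      using gpos by (simp_all add: pos_less_divide_eq pos_divide_less_eq)
    have "ln n / ln (1 / \<epsilon>) \<le> ln n / ln (1 / p n)" using n lp by (intro divide_left_mono) auto
    also have "\<dots> = ?g n / 2" unfolding g by simp
    finally have lo: "ln n / ln (1 / \<epsilon>) \<le> r n" using b by simp
    have "real (r n) \<le> 3 * ln n / ln (1 / p n)" using b(2) unfolding g by simp
    also have "\<dots> \<le> 3 * ln n / ln (1 / (1 - \<epsilon>))" using n lp by (intro divide_left_mono) auto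
    finally show ?case using lo elim by simp
  qed
qed

theorem theorem1p4:
  fixes \<epsilon> :: real and N :: "nat set"
    and \<theta> p :: "nat \<Rightarrow> real" and r :: "nat \<Rightarrow> nat"
  assumes "\<epsilon> > 0"
    and "infinite N"
    and "\<And>n. n \<in> N \<Longrightarrow> -1 + \<epsilon> \<le> \<theta> n \<and> \<theta> n \<le> 1 / 2 - \<epsilon>"
    and "\<And>n. n \<in> N \<Longrightarrow> \<epsilon> < p n \<and> p n < 1 - \<epsilon>"
    and "(\<lambda>n. real (r n)) \<sim>[at_top_through N] (\<lambda>n. 2 * log (1 / p n) (real n))"
    and "(\<lambda>n. clique_mean n (p n) (r n)) \<in> \<Theta>[at_top_through N](\<lambda>n. real n powr (1 + \<theta> n))"
  shows "\<exists>(\<G> :: nat \<Rightarrow> nat hypergraph set)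
           (err1 :: nat \<Rightarrow> nat hypergraph \<Rightarrow> real) (err2 :: nat \<Rightarrow> nat hypergraph \<Rightarrow> real).
      (\<forall>n\<in>N. \<G> n \<subseteq> uniform_hypergraphs {..<n} (r n)) \<and>
      ((\<lambda>n. measure_pmf.prob (gnp n (p n)) {G. clique_hypergraph (r n) G \<in> \<G> n})
         \<longlongrightarrow> 1) (at_top_through N) \<and>
      (\<exists>B \<in> bigo_star (at_top_through N) (\<lambda>n. real n powr \<theta> n).
         \<forall>n\<in>N. \<forall>H\<in>\<G> n. \<bar>err1 n H\<bar> \<le> B n) \<and>
      (\<exists>c>0. \<forall>\<^sub>F n in at_top_through N. \<forall>H\<in>\<G> n. \<bar>err2 n H\<bar> \<le> real n powr (- c)) \<and>
      (\<forall>n\<in>N. \<forall>H\<in>\<G> n.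
         measure_pmf.prob (gnp n (p n)) {G. clique_hypergraph (r n) G = H} =
           clique_prob (p n) (r n) ^ num_edges H
           * (1 - clique_prob (p n) (r n)) ^ ((n choose r n) - num_edges H)
           * p n powi (- overlap (r n) H)
           * exp (- Lambda' n (p n) (r n) + err1 n H + err2 n H))"
proof -
  let ?Fil = "at_top_through N"
  \<comment> \<open>The exponent 200 comes from \<open>D ^ 10\<close> with \<open>D\<close> the 20th
    power of the logarithm; the factor 2 leaves room for the error of
    \<open>no_clique_factor\<close>.\<close>
  define B where "B n = 2 * (real n powr \<theta> n * ln (real n) ^ 200)" for n
  define prH where "prH n H = measure_pmf.prob (gnp n (p n)) {G. clique_hypergraph (r n) G = H}" for n H
  define base where "base n H e = clique_prob (p n) (r n) ^ num_edges H
           * (1 - clique_prob (p n) (r n)) ^ ((n choose r n) - num_edges H)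
           * p n powi (- overlap (r n) H) * exp (- Lambda' n (p n) (r n) + e)"
    for n and H :: "nat hypergraph" and e
  \<comment> \<open>The family is defined by the desired formula itself, so that the work lies in
    showing that its probability tends to 1.\<close>
  define \<G> where "\<G> n = {H \<in> uniform_hypergraphs {..<n} (r n). \<exists>e. \<bar>e\<bar> \<le> B n \<and> prH n H = base n H e}" for n
  define err1 where "err1 n H = (SOME e. \<bar>e\<bar> \<le> B n \<and> prH n H = base n H e)" for n H
  have err1: "\<bar>err1 n H\<bar> \<le> B n \<and> prH n H = base n H (err1 n H)" if "H \<in> \<G> n" for n H
    unfolding err1_def by (rule someI_ex) (use that in \<open>simp add: \<G>_def\<close>)
  have Bstar: "B \<in> bigo_star ?Fil (\<lambda>n. real n powr \<theta> n)"
    unfolding bigo_star_def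
  proof (intro CollectI exI)
    have "\<forall>\<^sub>F n in ?Fil. n > (1::nat)" by (intro filter_leD[OF inf_le1] eventually_gt_at_top)
    hence "\<forall>\<^sub>F n in ?Fil. norm (B n) \<le> 2 * norm (real n powr \<theta> n * ln (real n) powr 200)"
    proof eventually_elim
      case (elim n)
      hence "ln (real n) powr 200 = ln (real n) ^ 200"
        using powr_realpow[of "ln (real n)" 200] by simp
      thus ?case using elim by (simp add: B_def abs_mult)
    qed
    thus "B \<in> O[?Fil](\<lambda>n. real n powr \<theta> n * ln (real n) powr 200)" by (rule landau_o.bigI[rotated]) simp
  qed
  obtain a0 where a0: "a0 > 0" "\<forall>\<^sub>F n in ?Fil. a0 * norm (real n powr (1 + \<theta> n)) \<le> norm (clique_mean n (p n) (r n))"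
    using assms(6) unfolding bigtheta_def by (elim IntE landau_omega.bigE) auto
  obtain a where a: "a > 0" "\<forall>\<^sub>F n in ?Fil. norm (clique_mean n (p n) (r n)) \<le> a * norm (real n powr (1 + \<theta> n))"
    using assms(6) unfolding bigtheta_def by (elim IntE landau_o.bigE) auto
  \<comment> \<open>As \<open>N\<close> is not empty, the bounds on \<open>p\<close> force
    \<open>\<epsilon> < 1/2\<close>, which makes the logarithms below positive.\<close>
  obtain n0 where "n0 \<in> N" using infinite_imp_nonempty[OF assms(2)] by auto
  hence \<epsilon>: "\<epsilon> < 1/2" using assms(4)[of n0] by linarith
  \<comment> \<open>This is \<epsilon> to the power -3: as \<open>r\<close> is at least
    \<open>ln n / ln (1 / \<epsilon>)\<close>, its \<open>r\<close>-th power is at least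
    \<open>n ^ 3\<close>.\<close>
  define \<kappa> where "\<kappa> = exp (3 * ln (1 / \<epsilon>))"
  define c where "c = 3 / ln (1 / (1 - \<epsilon>))"
  define c' where "c' = 1 / ln (1 / \<epsilon>)"
  have lne: "0 < ln (1 / \<epsilon>)" "0 < ln (1 / (1 - \<epsilon>))" using \<epsilon> assms(1) by (auto simp: field_simps)
  have cc: "0 < c" "0 < c'" using lne by (auto simp: c_def c'_def)
  have \<kappa>1: "1 \<le> \<kappa>" using lne by (simp add: \<kappa>_def)
  have size: "\<forall>\<^sub>F n in ?Fil. n \<in> N \<and> ln n / ln (1 / \<epsilon>) \<le> r n \<and> r n \<le> 3 / ln (1 / (1 - \<epsilon>)) * ln n"
    by (rule clique_size_bounds[OF assms(1) _ assms(5)]) (rule assms(4))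
  have ev: "\<forall>\<^sub>F n in ?Fil. 1 - 29 / ln n ^ 20
      \<le> measure_pmf.prob (gnp n (p n)) {G. clique_hypergraph (r n) G \<in> \<G> n}"
    using a0(2) a(2) size
      filter_leD[OF inf_le1 ln_power_bounds[OF assms(1) a0(1) cc(2,1) a(1), of \<kappa>]]
  proof eventually_elim
    case (elim n)
    define x where "x = real n powr \<theta> n"
    define D where "D = ln (real n) ^ 20"
    define pn where "pn = p n"
    define rn where "rn = r n"
    have nN: "n \<in> N" and rlo: "ln n / ln (1 / \<epsilon>) \<le> rn" and rup: "rn \<le> c * ln n"
      using elim by (auto simp: c_def rn_def)
    have L: "200 \<le> D" "D ^ 6 \<le> n" "8 * D ^ 11 \<le> real n powr (4 * \<epsilon>)" "D \<le> a0 * real n powr \<epsilon>"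
      "a\<^sup>2 \<le> real n powr (2 * \<epsilon>)" "10 \<le> c' * ln n"
      "\<kappa>\<^sup>2 * (c * ln n) ^ 16 / \<epsilon> ^ 5 + 4 * a * (c * ln n) ^ 6 / \<epsilon> + a \<le> D"
      "1 / \<epsilon> \<le> D" "(c * ln n + 1) * ln n \<le> D\<^sup>2" "c * ln n \<le> n" "1 \<le> ln n"
      using elim unfolding D_def by auto
    have "n \<noteq> 0" using L(11) by (intro notI) simp
    hence n1: "1 \<le> real n" by simp
    have r10: "10 \<le> rn" using L(6) rlo by (simp add: c'_def)
    have rn_n: "rn \<le> n" using rup L(10) by simp
    have pb: "\<epsilon> < pn" "pn < 1 - \<epsilon>" "0 < pn" "pn < 1" using assms(1) assms(4)[OF nN] by (auto simp: pn_def)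
    interpret C: clique_model pn n rn
      using pb r10 rn_n by unfold_locales (auto simp: finite_nsets)
    have \<theta>: "-1 + \<epsilon> \<le> \<theta> n" "\<theta> n \<le> 1/2 - \<epsilon>" using assms(3)[OF nN] by auto
    have nx: "real n powr (1 + \<theta> n) = n * x" using n1 by (simp add: x_def powr_add)
    have mean: "a0 * (n * x) \<le> C.\<mu>" "C.\<mu> \<le> a * (n * x)"
    proof -
      have "clique_mean n (p n) (r n) = C.\<mu>" using C.clique_mean_eq by (simp add: pn_def rn_def)
      moreover have "0 \<le> real n * x" by (simp add: x_def)
      ultimately show "a0 * (n * x) \<le> C.\<mu>" "C.\<mu> \<le> a * (n * x)"
        using elim(1,2) C.\<mu>_pos unfolding nx by simp_all
    qed
    have x0: "0 < x" using n1 by (simp add: x_def)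
    have x_lo: "real n powr (-1 + \<epsilon>) \<le> x" unfolding x_def using \<theta> n1 by (intro powr_mono) auto
    have x_up: "x \<le> real n powr (1/2 - \<epsilon>)" unfolding x_def using \<theta> n1 by (intro powr_mono) auto
    have nxlo: "real n powr \<epsilon> \<le> n * x"
    proof -
      have "real n powr \<epsilon> = n * real n powr (-1 + \<epsilon>)"
        using n1 powr_add[of "real n" 1 "-1 + \<epsilon>"] by simp
      thus ?thesis using x_lo by (simp add: mult_left_mono)
    qed
    have x2: "x\<^sup>2 \<le> real n powr (1 - 2 * \<epsilon>)"
    proof -
      have "x\<^sup>2 \<le> (real n powr (1/2 - \<epsilon>))\<^sup>2" using x_up x0 by (intro power_mono) auto
      also have "\<dots> = real n powr (1 - 2 * \<epsilon>)" using n1 by (simp add: powr_power algebra_simps)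
      finally show ?thesis .
    qed
    have h1: "1 / real n \<le> x"
    proof -
      have "1 / real n = real n powr (-1)" using n1 by (simp add: powr_minus_divide)
      also have "\<dots> \<le> real n powr (-1 + \<epsilon>)" using n1 assms(1) by (intro powr_mono) auto
      finally show ?thesis using x_lo by simp
    qed
    have h2: "x\<^sup>2 \<le> n"
    proof -
      have "real n powr (1 - 2 * \<epsilon>) \<le> real n powr 1" using n1 assms(1) by (intro powr_mono) auto
      thus ?thesis using x2 n1 by simp
    qed
    \<comment> \<open>Here \<open>\<theta> \<le> 1/2 - \<epsilon>\<close> leaves a factor
      \<open>n powr (4 * \<epsilon>)\<close>, which absorbs \<open>8 * D ^ 11\<close>.\<close>
    have h3: "x * (x + 1) ^ 3 * D ^ 11 \<le> (real n)\<^sup>2"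
    proof -
      have "x * (x + 1) ^ 3 * D ^ 11 \<le> 8 * real n powr (2 - 4 * \<epsilon>) * D ^ 11"
        using cube_bound[OF n1 x0 x_up] \<epsilon> L(1) by (intro mult_right_mono) auto
      also have "\<dots> = real n powr (2 - 4 * \<epsilon>) * (8 * D ^ 11)" by simp
      also have "\<dots> \<le> real n powr (2 - 4 * \<epsilon>) * real n powr (4 * \<epsilon>)" using L(3) by (intro mult_left_mono) auto
      also have "\<dots> = (real n)\<^sup>2" using n1 by (simp add: powr_add[symmetric])
      finally show ?thesis .
    qed
    \<comment> \<open>The lower bound on \<open>\<theta>\<close> makes \<open>\<mu>\<close> at least
      a constant times \<open>n powr \<epsilon>\<close>, more than any power of the
      logarithm.\<close>
    have h4: "D \<le> C.\<mu>"
      using L(4) mult_left_mono[OF nxlo, of a0] a0(1) mean(1) by linarith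
    have h5: "C.\<mu>\<^sup>2 \<le> (real n) ^ 3"
    proof -
      have "C.\<mu>\<^sup>2 \<le> (a * (n * x))\<^sup>2" using mean(2) C.\<mu>_pos by (intro power_mono) auto
      also have "\<dots> = (real n)\<^sup>2 * (a\<^sup>2 * x\<^sup>2)" by (simp add: power_mult_distrib)
      also have "\<dots> \<le> (real n)\<^sup>2 * (real n powr (2 * \<epsilon>) * real n powr (1 - 2 * \<epsilon>))"
        using L(5) x2 by (intro mult_left_mono mult_mono) auto
      also have "real n powr (2 * \<epsilon>) * real n powr (1 - 2 * \<epsilon>) = n" using n1 by (simp add: powr_add[symmetric])
      finally show ?thesis by (simp add: power2_eq_square power3_eq_cube)
    qed
    have h6: "(real n) ^ 3 \<le> \<kappa> ^ rn"
    proof -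
      have "ln n \<le> rn * ln (1 / \<epsilon>)" using rlo lne by (simp add: pos_divide_le_eq)
      hence "exp (3 * ln n) \<le> exp (rn * (3 * ln (1 / \<epsilon>)))" by simp
      moreover have "exp (3 * ln n) = real n ^ 3" using n1 exp_of_nat_mult[of 3 "ln (real n)"] by simp
      ultimately show ?thesis unfolding \<kappa>_def by (simp add: exp_of_nat_mult)
    qed
    have h7: "\<kappa>\<^sup>2 * real rn ^ 16 / pn ^ 5 + 4 * a * real rn ^ 6 / pn + a \<le> D"
    proof -
      have "\<kappa>\<^sup>2 * real rn ^ 16 / pn ^ 5 + 4 * a * real rn ^ 6 / pn + a
        \<le> \<kappa>\<^sup>2 * (c * ln n) ^ 16 / \<epsilon> ^ 5 + 4 * a * (c * ln n) ^ 6 / \<epsilon> + a"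
        using rup pb assms(1) a(1) cc L(11) by (intro add_mono frac_le mult_left_mono power_mono mult_nonneg_nonneg) auto
      thus ?thesis using L(7) by linarith
    qed
    have h8: "1 / (1 - pn) \<le> D"
    proof -
      have "1 / (1 - pn) \<le> 1 / \<epsilon>" using pb assms(1) by (intro divide_left_mono) auto
      thus ?thesis using L(8) by linarith
    qed
    have h9: "(real rn + 1) * ln n \<le> D\<^sup>2"
    proof -
      have "(real rn + 1) * ln n \<le> (c * ln n + 1) * ln n" using rup L(11) by (intro mult_right_mono) auto
      thus ?thesis using L(9) by linarith
    qed
    note hyps = L(1,2) h1 h2 h3 h4 mean(2)[folded mult.assoc] h5 \<kappa>1 h6 r10 h7 h8 h9
    have fail: "C.prb (\<lambda>w. \<not> C.well_approximated (D ^ 10 * x) (C.cl w)) \<le> 29 / D"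
      by (rule C.typical'(1)[OF hyps])
    have q\<mu>: "2 * (C.q * C.\<mu>) \<le> x" by (rule C.typical'(2)[OF hyps])
    have qhalf: "C.q \<le> 1/2"
      by (rule C.typical'(3)[OF hyps])
    have B: "D ^ 10 * x + 2 * (C.q * C.\<mu>) \<le> B n"
    proof -
      have "1 * x \<le> D ^ 10 * x" using L(1) x0 by (intro mult_right_mono) (auto intro: one_le_power)
      moreover have "D ^ 10 = ln (real n) ^ 200" by (simp add: D_def power_mult[symmetric])
      ultimately show ?thesis using q\<mu> by (simp add: B_def x_def mult.commute)
    qed
    have "1 - 29 / D \<le> C.prb (\<lambda>w. C.well_approximated (D ^ 10 * x) (C.cl w))"
      using fail C.pr_Not[of "\<lambda>w. C.well_approximated (D ^ 10 * x) (C.cl w)"] by linarith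
    also have "\<dots> \<le> C.prb (\<lambda>w. ({..<n}, C.cl w) \<in> \<G> n)"
    proof (rule C.pr_mono)
      fix w assume good: "C.well_approximated (D ^ 10 * x) (C.cl w)"
      obtain e where e: "\<bar>e\<bar> \<le> D ^ 10 * x + 2 * (C.q * C.\<mu>)" "prH n ({..<n}, C.cl w) = base n ({..<n}, C.cl w) e"
        using C.approximation[OF C.cl_sub good qhalf] unfolding prH_def base_def pn_def rn_def by blast
      have "({..<n}, C.cl w) \<in> uniform_hypergraphs {..<n} (r n)"
        using C.cl_sub[of w] unfolding C.R_def uniform_hypergraphs_def rn_def[symmetric] by simp
      thus "({..<n}, C.cl w) \<in> \<G> n" unfolding \<G>_def using e B by (intro CollectI conjI exI[of _ e]) auto
    qed
    also have "\<dots> = measure_pmf.prob (gnp n (p n)) {G. clique_hypergraph (r n) G \<in> \<G> n}"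
      using C.gnp_clique_prob[of "\<lambda>H. H \<in> \<G> n"] by (simp add: pn_def rn_def)
    finally show ?case by (simp add: D_def)
  qed
  have lim: "((\<lambda>n. measure_pmf.prob (gnp n (p n)) {G. clique_hypergraph (r n) G \<in> \<G> n}) \<longlongrightarrow> 1) ?Fil"
  proof (rule tendsto_sandwich[OF ev, where h = "\<lambda>_. 1"])
    have "((\<lambda>n::nat. 1 - 29 / ln (real n) ^ 20) \<longlongrightarrow> 1) at_top" by real_asymp
    thus "((\<lambda>n. 1 - 29 / ln (real n) ^ 20) \<longlongrightarrow> 1) ?Fil" by (rule tendsto_mono[OF inf_le1])
  qed (simp_all add: measure_pmf.prob_le_1)
  have bounded: "\<exists>B\<in>bigo_star ?Fil (\<lambda>n. real n powr \<theta> n). \<forall>n\<in>N. \<forall>H\<in>\<G> n. \<bar>err1 n H\<bar> \<le> B n"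
    using Bstar err1 by blast
  \<comment> \<open>All errors have gone into \<open>B\<close>, so the second error function is
    chosen as 0.\<close>
  have zero: "\<exists>c>0. \<forall>\<^sub>F n in ?Fil. \<forall>H\<in>\<G> n. \<bar>0::real\<bar> \<le> real n powr (- c)"
    by (intro exI[of _ 1]) simp
  have uniform: "\<forall>n\<in>N. \<G> n \<subseteq> uniform_hypergraphs {..<n} (r n)" by (auto simp: \<G>_def)
  have formula: "\<forall>n\<in>N. \<forall>H\<in>\<G> n. measure_pmf.prob (gnp n (p n)) {G. clique_hypergraph (r n) G = H} =
           clique_prob (p n) (r n) ^ num_edges H
           * (1 - clique_prob (p n) (r n)) ^ ((n choose r n) - num_edges H)
           * p n powi (- overlap (r n) H) * exp (- Lambda' n (p n) (r n) + err1 n H + 0)"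
    using err1 unfolding prH_def base_def by simp
  show ?thesis
    by (rule exI[of _ \<G>], rule exI[of _ err1], rule exI[of _ "\<lambda>n H. 0"])
      (intro conjI uniform lim bounded zero formula)
qed

end
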